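(* Let $\boldsymbol{d}=(d_0,\dots,d_n)\in(\mathbb{N}_{>0})^{n+1}$ and let $\mathcal{M}_{\boldsymbol{d}}$ and $\mathcal{N}_{\boldsymbol{d}}$ be the Macaulay matrix and its distinguished principal submatrix for the degree $m=|\boldsymbol{d}|-n$. Then $$\operatorname{Res}_{\boldsymbol{d}}=\frac{\det(\mathcal{M}_{\boldsymbol{d}})}{\det(\mathcal{N}_{\boldsymbol{d}})}.$$
   Context: For a vector, $|\cdot|$ denotes the sum of its coordinates. For $i=0,\dots,n$ let $\boldsymbol{u}_i=\{u_{i,\boldsymbol{c}}\}$ be variables indexed by the $\boldsymbol{c}\in\mathbb{N}^{n+1}$ with $|\boldsymbol{c}|=d_i$, $\boldsymbol{u}=(\boldsymbol{u}_0,\dots,\boldsymbol{u}_n)$, $\mathbb{K}=\mathbb{C}(\boldsymbol{u})$, $\boldsymbol{t}=(t_0,\dots,t_n)$ and $P_i=\sum_{|\boldsymbol{c}|=d_i}u_{i,\boldsymbol{c}}\boldsymbol{t}^{\boldsymbol{c}}\in\mathbb{K}[\boldsymbol{t}]$ the general homogeneous polynomial of degree $d_i$. $\operatorname{Res}_{\boldsymbol{d}}\in\mathbb{Z}[\boldsymbol{u}]$ is the homogeneous resultant: the unique irreducible polynomial in $\mathbb{Z}[\boldsymbol{u}]$ vanishing when evaluated at the coefficients of a system of $n+1$ homogeneous polynomials in $\boldsymbol{t}$ of degrees $\boldsymbol{d}$ if and only if this system has a zero in $\mathbb{P}^n_{\mathbb{C}}$, and verifying $\operatorname{Res}_{\boldsymbol{d}}(t_0^{d_0},\dots,t_n^{d_n})=1$.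 With $m=|\boldsymbol{d}|-n$, let $T_i=\{Q\in\mathbb{K}[\boldsymbol{t}]_{m-d_i}\mid\deg_{t_j}(Q)<d_j\text{ for }j=i+1,\dots,n\}$, $T=\mathbb{K}[\boldsymbol{t}]_m$ (homogeneous parts) and $\Psi_{\boldsymbol{d}}\colon\bigoplus_iT_i\to T$, $\Psi_{\boldsymbol{d}}(Q_0,\dots,Q_n)=\sum_iQ_iP_i$. Let $\mathcal{I}=\{\boldsymbol{c}\in\mathbb{N}^{n+1}\mid|\boldsymbol{c}|=m\}$, partitioned into $\mathcal{I}_i=\{\boldsymbol{c}\in\mathcal{I}\mid c_i\ge d_i,\ c_j<d_j\text{ for }j>i\}$, $i=0,\dots,n$. With $\widehat e_0,\dots,\widehat e_n$ the standard basis of $\mathbb{R}^{n+1}$, $\{\boldsymbol{t}^{\boldsymbol{c}-d_i\widehat e_i}\}_{\boldsymbol{c}\in\mathcal{I}_i}$ is a basis of $T_i$ and $\{\boldsymbol{t}^{\boldsymbol{c}}\}_{\boldsymbol{c}\in\mathcal{I}}$ is a basis of $T$, so that both $\bigoplus_iT_i$ and $T$ have bases indexed by $\mathcal{I}$. $\mathcal{M}_{\boldsymbol{d}}\in\mathbb{K}^{\mathcal{I}\times\mathcal{I}}$ is the matrix of $\Psi_{\boldsymbol{d}}$ in terms of row vectors with respect to these bases: for $\boldsymbol{c}\in\mathcal{I}_i$, the row of $\boldsymbol{c}$ consists of the coefficients of $\boldsymbol{t}^{\boldsymbol{c}-d_i\widehat e_i}P_i$. Let $\mathcal{I}^\circ$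 be the complement in $\mathcal{I}$ of the set of $\boldsymbol{c}$ having a unique $i$ with $c_i\ge d_i$; $\mathcal{N}_{\boldsymbol{d}}$ is the principal submatrix of $\mathcal{M}_{\boldsymbol{d}}$ indexed by $\mathcal{I}^\circ$ (an empty matrix has determinant $1$). *)

theory Defs
  imports
    Complex_Main
    "HOL-Library.Poly_Mapping"
    "HOL-Computational_Algebra.Computational_Algebra"
    "Jordan_Normal_Form.Determinant"
begin

text \<open>
  Multivariate polynomials are finitely supported maps from exponent vectors to coefficients,
  exponent vectors being finitely supported maps from variables to \<^typ>\<open>nat\<close>.
\<close>

type_synonym ('v, 'a) mpol = "('v \<Rightarrow>\<^sub>0 nat) \<Rightarrow>\<^sub>0 'a"

type_synonym expo = "nat \<Rightarrow>\<^sub>0 nat"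

text \<open>\<open>U i c\<close> is the variable $u_{i,c}$.\<close>

datatype uvar = U nat expo

text \<open>
  The ring structure on \<^typ>\<open>('v, 'a) mpol\<close> is known to be an integral domain when the
  variables are linearly ordered; which order is used for the variables is irrelevant.
\<close>

instantiation uvar :: linorder
begin

fun less_eq_uvar :: "uvar \<Rightarrow> uvar \<Rightarrow> bool" where
  "less_eq_uvar (U i c) (U j e) \<longleftrightarrow> i < j \<or> (i = j \<and> c \<le> e)"

definition less_uvar :: "uvar \<Rightarrow> uvar \<Rightarrow> bool" where
  "less_uvar x y \<longleftrightarrow> x \<le> y \<and> \<not> y \<le> x"

instance
proof
  fix x y z :: uvar
  show "x < y \<longleftrightarrow> x \<le> y \<and> \<not> y \<le> x" by (rule less_uvar_def)
  show "x \<le> x" by (cases x) simp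
  show "x \<le> z" if "x \<le> y" "y \<le> z" using that by (cases x; cases y; cases z) auto
  show "x = y" if "x \<le> y" "y \<le> x" using that by (cases x; cases y) auto
  show "x \<le> y \<or> y \<le> x" by (cases x; cases y) auto
qed

end

text \<open>
  The field $\mathbb{C}(u)$. The type provides variables \<open>U i c\<close> for all \<open>i\<close> and \<open>c\<close>; only those
  in \<open>uvars n d\<close> below occur for given \<open>n\<close> and \<open>d\<close>.
\<close>

type_synonym ratfun = "(uvar, complex) mpol fract"

definition eval :: "('v \<Rightarrow> 'a) \<Rightarrow> ('v, 'a::comm_semiring_1) mpol \<Rightarrow> 'a" where
  "eval a p = (\<Sum>e\<in>Poly_Mapping.keys p.
      Poly_Mapping.lookup p e * (\<Prod>v\<in>Poly_Mapping.keys e. a v ^ Poly_Mapping.lookup e v))"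

definition int_to_complex :: "('v, int) mpol \<Rightarrow> ('v, complex) mpol" where
  "int_to_complex = Poly_Mapping.map of_int"

text \<open>Exponent vectors in $\mathbb{N}^{n+1}$ with coordinate sum \<open>k\<close>.\<close>

definition expos :: "nat \<Rightarrow> nat \<Rightarrow> expo set" where
  "expos n k = {c. Poly_Mapping.keys c \<subseteq> {..n} \<and> (\<Sum>j\<le>n. Poly_Mapping.lookup c j) = k}"

lemma finite_expos: "finite (expos n k)"
proof -
  let ?f = "\<lambda>c. restrict (Poly_Mapping.lookup c) {..n}"
  have "inj_on ?f (expos n k)"
  proof (rule inj_onI, rule poly_mapping_eqI)
    fix c e :: expo and j
    assume ce: "c \<in> expos n k" "e \<in> expos n k" and eq: "?f c = ?f e"
    show "Poly_Mapping.lookup c j = Poly_Mapping.lookup e j"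
    proof (cases "j \<le> n")
      case True
      then show ?thesis using fun_cong[OF eq, of j] by simp
    next
      case False
      then have "j \<notin> Poly_Mapping.keys c" "j \<notin> Poly_Mapping.keys e"
        using ce by (auto simp: expos_def)
      then show ?thesis by (simp add: in_keys_iff)
    qed
  qed
  moreover have "?f ` expos n k \<subseteq> {..n} \<rightarrow>\<^sub>E {..k}"
  proof (rule image_subsetI)
    fix c assume c: "c \<in> expos n k"
    have "Poly_Mapping.lookup c j \<le> k" if "j \<le> n" for j
      using c member_le_sum[of j "{..n}" "Poly_Mapping.lookup c"] that
      by (auto simp: expos_def)
    then show "?f c \<in> {..n} \<rightarrow>\<^sub>E {..k}" by auto
  qed
  moreover have "finite ({..n} \<rightarrow>\<^sub>E {..k})" by (rule finite_PiE) auto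
  ultimately show ?thesis by (meson finite_subset inj_on_finite)
qed

text \<open>Homogeneous of degree \<open>k\<close> in $t_0,\dots,t_n$; this includes the zero polynomial.\<close>

definition homogeneous :: "nat \<Rightarrow> nat \<Rightarrow> (nat, 'a::zero) mpol \<Rightarrow> bool" where
  "homogeneous n k p \<longleftrightarrow> Poly_Mapping.keys p \<subseteq> expos n k"

text \<open>The system $F_0,\dots,F_n$ has a zero in $\mathbb{P}^n_{\mathbb{C}}$ (homogeneous coordinates \<open>z\<close>).\<close>

definition has_proj_zero :: "nat \<Rightarrow> (nat \<Rightarrow> (nat, complex) mpol) \<Rightarrow> bool" where
  "has_proj_zero n F \<longleftrightarrow> (\<exists>z. (\<exists>j\<le>n. z j \<noteq> 0) \<and> (\<forall>i\<le>n. eval z (F i) = 0))"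

definition uvars :: "nat \<Rightarrow> (nat \<Rightarrow> nat) \<Rightarrow> uvar set" where
  "uvars n d = {U i c | i c. i \<le> n \<and> c \<in> expos n (d i)}"

definition eval_at_system :: "(uvar, int) mpol \<Rightarrow> (nat \<Rightarrow> (nat, complex) mpol) \<Rightarrow> complex" where
  "eval_at_system R F =
     eval (\<lambda>v. case v of U i c \<Rightarrow> Poly_Mapping.lookup (F i) c) (int_to_complex R)"

text \<open>
  The first condition says $R \in \mathbb{Z}[u]$. Irreducibility is taken in the polynomial ring
  over all variables of type \<^typ>\<open>uvar\<close>: the factors of a nonzero polynomial over a domain only
  contain variables of that polynomial, so this is the same as irreducibility in $\mathbb{Z}[u]$.
\<close>

definition is_resultant :: "nat \<Rightarrow> (nat \<Rightarrow> nat) \<Rightarrow> (uvar, int) mpol \<Rightarrow> bool" where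
  "is_resultant n d R \<longleftrightarrow>
     (\<forall>e\<in>Poly_Mapping.keys R. Poly_Mapping.keys e \<subseteq> uvars n d) \<and>
     irreducible R \<and>
     (\<forall>F. (\<forall>i\<le>n. homogeneous n (d i) (F i)) \<longrightarrow>
        (eval_at_system R F = 0 \<longleftrightarrow> has_proj_zero n F)) \<and>
     eval_at_system R (\<lambda>i. Poly_Mapping.single (Poly_Mapping.single i (d i)) 1) = 1"

definition Res :: "nat \<Rightarrow> (nat \<Rightarrow> nat) \<Rightarrow> (uvar, int) mpol" where
  "Res n d = (THE R. is_resultant n d R)"

definition uvar_K :: "nat \<Rightarrow> expo \<Rightarrow> ratfun" where
  "uvar_K i c = to_fract (Poly_Mapping.single (Poly_Mapping.single (U i c) 1) 1)"

definition general_poly :: "nat \<Rightarrow> (nat \<Rightarrow> nat) \<Rightarrow> nat \<Rightarrow> (nat, ratfun) mpol" where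
  "general_poly n d i = (\<Sum>c\<in>expos n (d i). Poly_Mapping.single c (uvar_K i c))"

text \<open>The subtraction does not truncate when \<open>d 0, ..., d n\<close> are positive.\<close>

definition macaulay_degree :: "nat \<Rightarrow> (nat \<Rightarrow> nat) \<Rightarrow> nat" where
  "macaulay_degree n d = (\<Sum>i\<le>n. d i) - n"

definition macaulay_index :: "nat \<Rightarrow> (nat \<Rightarrow> nat) \<Rightarrow> expo set" where
  "macaulay_index n d = expos n (macaulay_degree n d)"

definition macaulay_block :: "nat \<Rightarrow> (nat \<Rightarrow> nat) \<Rightarrow> nat \<Rightarrow> expo set" where
  "macaulay_block n d i = {c \<in> macaulay_index n d. d i \<le> Poly_Mapping.lookup c i \<and>
     (\<forall>j. i < j \<and> j \<le> n \<longrightarrow> Poly_Mapping.lookup c j < d j)}"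

definition block_of :: "nat \<Rightarrow> (nat \<Rightarrow> nat) \<Rightarrow> expo \<Rightarrow> nat" where
  "block_of n d c = (THE i. i \<le> n \<and> c \<in> macaulay_block n d i)"

lemma macaulay_partition:
  assumes d: "\<And>i. i \<le> n \<Longrightarrow> 0 < d i" and c: "c \<in> macaulay_index n d"
  shows "\<exists>!i. i \<le> n \<and> c \<in> macaulay_block n d i"
proof -
  let ?c = "Poly_Mapping.lookup c"
  let ?S = "{i. i \<le> n \<and> d i \<le> ?c i}"
  have "?S \<noteq> {}"
  proof
    assume "?S = {}"
    then have "?c i + 1 \<le> d i" if "i \<le> n" for i
      using that \<open>?S = {}\<close> by (simp add: Suc_le_eq not_le[symmetric])
    then have "(\<Sum>i\<le>n. ?c i + 1) \<le> (\<Sum>i\<le>n. d i)" by (intro sum_mono) auto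
    moreover have "(\<Sum>i\<le>n. ?c i + 1) = (\<Sum>i\<le>n. ?c i) + (n + 1)" by (simp only: sum.distrib) simp
    ultimately show False
      using c by (auto simp: macaulay_index_def macaulay_degree_def expos_def)
  qed
  moreover have "finite ?S" by simp
  ultimately have max: "Max ?S \<in> ?S" "\<And>j. j \<in> ?S \<Longrightarrow> j \<le> Max ?S"
    using Max_in[of ?S] Max_ge[of ?S] by blast+
  show ?thesis
  proof (intro ex1I conjI)
    show "Max ?S \<le> n" using max(1) by simp
    show "c \<in> macaulay_block n d (Max ?S)"
      unfolding macaulay_block_def using max(1) c
    proof (safe, goal_cases)
      case (1 j)
      then show ?case using max(2)[of j] by (force simp: not_le[symmetric])
    qed
  next
    fix i assume i: "i \<le> n \<and> c \<in> macaulay_block n d i"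
    then have "i \<le> Max ?S" by (intro max(2)) (simp add: macaulay_block_def)
    moreover have "\<not> i < Max ?S"
      using i max(1) by (auto simp: macaulay_block_def not_less[symmetric] simp del: Max_less_iff)
    ultimately show "i = Max ?S" by linarith
  qed
qed

definition macaulay_map ::
    "nat \<Rightarrow> (nat \<Rightarrow> nat) \<Rightarrow> (nat \<Rightarrow> (nat, ratfun) mpol) \<Rightarrow> (nat, ratfun) mpol" where
  "macaulay_map n d Q = (\<Sum>i\<le>n. Q i * general_poly n d i)"

text \<open>The summand $T_i$ of the domain of $\Psi_d$.\<close>

definition macaulay_space :: "nat \<Rightarrow> (nat \<Rightarrow> nat) \<Rightarrow> nat \<Rightarrow> (nat, ratfun) mpol set" where
  "macaulay_space n d i = {Q. homogeneous n (macaulay_degree n d - d i) Q \<and>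
     (\<forall>j. i < j \<and> j \<le> n \<longrightarrow> (\<forall>e\<in>Poly_Mapping.keys Q. Poly_Mapping.lookup e j < d j))}"

text \<open>
  The basis vector of $\bigoplus_i T_i$ indexed by \<open>c\<close>: it is $t^{c - d_i \hat e_i}$ in the component
  \<open>i = block_of n d c\<close>, and zero in the other ones.
\<close>

definition macaulay_basis :: "nat \<Rightarrow> (nat \<Rightarrow> nat) \<Rightarrow> expo \<Rightarrow> nat \<Rightarrow> (nat, ratfun) mpol" where
  "macaulay_basis n d c i = (if i = block_of n d c
     then Poly_Mapping.single (c - Poly_Mapping.single i (d i)) 1 else 0)"

text \<open>Row vector convention: the row of \<open>c\<close> is the image of the basis vector of \<open>c\<close>.\<close>

definition macaulay_entry :: "nat \<Rightarrow> (nat \<Rightarrow> nat) \<Rightarrow> expo \<Rightarrow> expo \<Rightarrow> ratfun" where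
  "macaulay_entry n d c c' = Poly_Mapping.lookup (macaulay_map n d (macaulay_basis n d c)) c'"

lemma block_of_eqI:
  assumes "\<And>j. j \<le> n \<Longrightarrow> 0 < d j" "i \<le> n" "c \<in> macaulay_block n d i"
  shows "block_of n d c = i"
  unfolding block_of_def
  using assms macaulay_partition[of n d c] by (intro the1_equality) (auto simp: macaulay_block_def)

lemma macaulay_entry_row:
  assumes "\<And>j. j \<le> n \<Longrightarrow> 0 < d j" "i \<le> n" "c \<in> macaulay_block n d i"
  shows "macaulay_entry n d c c' = Poly_Mapping.lookup
    (Poly_Mapping.single (c - Poly_Mapping.single i (d i)) 1 * general_poly n d i) c'"
proof -
  have b: "block_of n d c = i"
    using assms by (rule block_of_eqI)
  have "macaulay_map n d (macaulay_basis n d c) = (\<Sum>j\<le>n. if j = i then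
      Poly_Mapping.single (c - Poly_Mapping.single i (d i)) 1 * general_poly n d i else 0)"
    unfolding macaulay_map_def macaulay_basis_def b by (intro sum.cong) auto
  then show ?thesis using assms(2) by (simp add: macaulay_entry_def)
qed

lemma macaulay_space_eq:
  assumes d: "\<And>j. j \<le> n \<Longrightarrow> 0 < d j" and i: "i \<le> n"
  shows "macaulay_space n d i = {Q. Poly_Mapping.keys Q \<subseteq>
    (\<lambda>c. c - Poly_Mapping.single i (d i)) ` macaulay_block n d i}"
proof -
  let ?s = "Poly_Mapping.single i (d i)"
  let ?m = "macaulay_degree n d"
  have "card ({..n} - {i}) \<le> (\<Sum>j\<in>{..n} - {i}. d j)"
    using sum_mono[of "{..n} - {i}" "\<lambda>_. 1" d] d by (simp add: Suc_le_eq)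
  then have dm: "d i \<le> ?m"
    using i sum.remove[of "{..n}" i d] by (simp add: macaulay_degree_def)
  have sum_s: "(\<Sum>j\<le>n. Poly_Mapping.lookup ?s j) = d i"
    using i by (simp add: lookup_single when_def)
  have iff: "e \<in> expos n (?m - d i) \<and> (\<forall>j. i < j \<and> j \<le> n \<longrightarrow> Poly_Mapping.lookup e j < d j)
      \<longleftrightarrow> e \<in> (\<lambda>c. c - ?s) ` macaulay_block n d i" for e
  proof
    assume e: "e \<in> expos n (?m - d i) \<and> (\<forall>j. i < j \<and> j \<le> n \<longrightarrow> Poly_Mapping.lookup e j < d j)"
    have "(\<Sum>j\<le>n. Poly_Mapping.lookup (e + ?s) j) = ?m"
      using e dm sum_s by (simp add: lookup_add sum.distrib expos_def)
    moreover have "Poly_Mapping.keys (e + ?s) \<subseteq> {..n}"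
      using e i Poly_Mapping.keys_add[of e ?s] by (auto simp: expos_def split: if_splits)
    ultimately have "e + ?s \<in> macaulay_block n d i"
      using e by (auto simp: macaulay_block_def macaulay_index_def expos_def lookup_add lookup_single)
    then show "e \<in> (\<lambda>c. c - ?s) ` macaulay_block n d i"
      by (intro image_eqI[where x = "e + ?s"]) auto
  next
    assume "e \<in> (\<lambda>c. c - ?s) ` macaulay_block n d i"
    then obtain c where c: "c \<in> macaulay_block n d i" "e = c - ?s" by blast
    have ce: "c = e + ?s"
      using c by (intro poly_mapping_eqI)
        (auto simp: lookup_add lookup_minus lookup_single when_def macaulay_block_def)
    have "(\<Sum>j\<le>n. Poly_Mapping.lookup c j) = ?m" "Poly_Mapping.keys c \<subseteq> {..n}"
      using c by (auto simp: macaulay_block_def macaulay_index_def expos_def)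
    moreover have "Poly_Mapping.keys e \<subseteq> Poly_Mapping.keys c"
      by (auto simp: ce in_keys_iff lookup_add)
    ultimately have "e \<in> expos n (?m - d i)"
      using sum_s by (auto simp: ce lookup_add sum.distrib expos_def)
    then show "e \<in> expos n (?m - d i) \<and>
        (\<forall>j. i < j \<and> j \<le> n \<longrightarrow> Poly_Mapping.lookup e j < d j)"
      using c(1) by (auto simp: ce macaulay_block_def lookup_add lookup_single)
  qed
  show ?thesis
    unfolding macaulay_space_def homogeneous_def using iff by blast
qed

definition macaulay_distinguished :: "nat \<Rightarrow> (nat \<Rightarrow> nat) \<Rightarrow> expo set" where
  "macaulay_distinguished n d = macaulay_index n d -
     {c. \<exists>!i. i \<le> n \<and> d i \<le> Poly_Mapping.lookup c i}"

text \<open>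
  Square matrices indexed by a finite set \<open>S\<close>, listed in increasing order. Rows and columns are
  listed in the same order, so the determinant does not depend on it.
\<close>

definition indexed_mat :: "'i::linorder set \<Rightarrow> ('i \<Rightarrow> 'i \<Rightarrow> 'a) \<Rightarrow> 'a mat" where
  "indexed_mat S a = mat (card S) (card S)
     (\<lambda>(k, l). a (sorted_list_of_set S ! k) (sorted_list_of_set S ! l))"

definition macaulay_matrix :: "nat \<Rightarrow> (nat \<Rightarrow> nat) \<Rightarrow> ratfun mat" where
  "macaulay_matrix n d = indexed_mat (macaulay_index n d) (macaulay_entry n d)"

definition macaulay_submatrix :: "nat \<Rightarrow> (nat \<Rightarrow> nat) \<Rightarrow> ratfun mat" where
  "macaulay_submatrix n d = indexed_mat (macaulay_distinguished n d) (macaulay_entry n d)"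

end

theory Submission
  imports Defs "Jordan_Normal_Form.Char_Poly" "HOL-Analysis.Continuum_Not_Denumerable"
begin

text \<open>
  The resultant is found as the generator of a prime ideal. For a finite set \<open>J\<close> of indices, let
  the inertia forms be the polynomials in \<open>\<int>[u]\<close> that vanish at every complex system
  \<open>(F\<^sub>i)\<^bsub>i\<in>J\<^esub>\<close> with a common zero in projective space. They form a prime ideal, because the
  systems with a zero can be joined by polynomial curves of such systems. The ideal contains no
  nonzero polynomial free of the variable \<open>x = u\<^bsub>0,d\<^sub>0e\<^sub>0\<^esub>\<close>, because the other coefficients can
  be prescribed generically. As \<open>\<int>[u]\<close> is a unique factorisation domain, a prime ideal with these
  two properties is generated by any irreducible element \<open>R\<close> in it: if \<open>R\<close> did not divide an
  inertia form \<open>f\<close>, eliminating \<open>x\<close> from \<open>R\<close> and \<open>f\<close> would give a nonzero inertia form without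
  \<open>x\<close>. The determinant of every matrix whose rows are multiples \<open>t\<^sup>e P\<^sub>i\<close> is an inertia form, since
  the monomials evaluated at a zero lie in its kernel; the Macaulay determinant is one that takes
  the value 1 at \<open>(t\<^sub>i\<^bsup>d\<^sub>i\<^esup>)\<close>, so \<open>R\<close> exists and can be normalised. Conversely, a system without zeros
  has some maximal minor that does not vanish, by the Nullstellensatz, so \<open>R\<close> does not vanish.

  The resultant is homogeneous of degree \<open>\<delta>\<^sub>i\<close>, the product of the other degrees \<open>d\<^sub>j\<close>, in the
  coefficients of \<open>P\<^sub>i\<close>. It has at most this degree since it divides a Macaulay determinant whose
  rows use \<open>P\<^sub>i\<close> only when this cannot be avoided. It has at least this degree since for
  \<open>P\<^sub>j = t\<^sub>j\<^bsup>d\<^sub>j\<^esup> - t\<^sub>i\<^bsup>d\<^sub>j\<^esup>\<close> it must vanish at \<open>\<delta>\<^sub>i\<close> different values of the coefficient of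
  \<open>t\<^sub>i\<^bsup>d\<^sub>i\<^esup>\<close> in \<open>P\<^sub>i\<close>.

  Macaulay's formula is shown for all degrees from the critical one on, by induction on \<open>J\<close>,
  removing its least element 0. Write \<open>det M = R E\<close>. Only \<open>\<delta>\<^sub>0\<close> rows of \<open>M\<close> use \<open>P\<^sub>0\<close>, so \<open>E\<close> is
  free of the coefficients of \<open>P\<^sub>0\<close> and can be computed for \<open>P\<^sub>0 = t\<^sub>0\<^bsup>d\<^sub>0\<^esup>\<close>. The resultant then
  becomes \<open>R'\<^bsup>d\<^sub>0\<^esup>\<close>, where \<open>R'\<close> is the resultant of the other forms with \<open>t\<^sub>0 = 0\<close>: both have the
  same zeros and the same degrees. The matrix becomes block triangular with respect to the exponent
  \<open>k\<close> of \<open>t\<^sub>0\<close>. For \<open>k < d\<^sub>0\<close> its block is the Macaulay matrix of the other forms in degree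
  \<open>\<nu> - k\<close>, for \<open>k \<ge> d\<^sub>0\<close> its block is equal to the block of the distinguished submatrix \<open>N\<close>. The
  induction hypothesis applied to the \<open>d\<^sub>0\<close> first blocks gives \<open>det M = R'\<^bsup>d\<^sub>0\<^esup> det N\<close>, and hence
  \<open>E = det N\<close>.
\<close>

section \<open>Evaluating polynomials in several variables\<close>

abbreviation lk :: "('v \<Rightarrow>\<^sub>0 'a::zero) \<Rightarrow> 'v \<Rightarrow> 'a" where "lk \<equiv> Poly_Mapping.lookup"
abbreviation kys :: "('v \<Rightarrow>\<^sub>0 'a::zero) \<Rightarrow> 'v set" where "kys \<equiv> Poly_Mapping.keys"
abbreviation sgl :: "'v \<Rightarrow> 'a::zero \<Rightarrow> 'v \<Rightarrow>\<^sub>0 'a" where "sgl \<equiv> Poly_Mapping.single"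

definition mono_val :: "('v \<Rightarrow> 'b::comm_ring_1) \<Rightarrow> ('v \<Rightarrow>\<^sub>0 nat) \<Rightarrow> 'b" where
  "mono_val a e = (\<Prod>v\<in>kys e. a v ^ lk e v)"

text \<open>
  Evaluation with a change of the coefficient ring along \<open>\<kappa>\<close>; all substitutions below, also those
  into polynomial rings and fraction fields, are instances of it.
\<close>

definition ins :: "('a \<Rightarrow> 'b::comm_ring_1) \<Rightarrow> ('v \<Rightarrow> 'b) \<Rightarrow> ('v, 'a::comm_ring_1) mpol \<Rightarrow> 'b" where
  "ins \<kappa> a p = (\<Sum>e\<in>kys p. \<kappa> (lk p e) * mono_val a e)"

definition Var :: "'v \<Rightarrow> ('v, 'a::comm_ring_1) mpol" where "Var v = sgl (sgl v 1) 1"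

definition vars :: "('v, 'a::zero) mpol \<Rightarrow> 'v set" where "vars p = (\<Union>e\<in>kys p. kys e)"

lemma finite_vars [simp]: "finite (vars p)"
  by (simp add: vars_def)

lemma mono_val_superset:
  assumes "finite S" "kys e \<subseteq> S"
  shows "mono_val a e = (\<Prod>v\<in>S. a v ^ lk e v)"
  unfolding mono_val_def using assms
  by (intro prod.mono_neutral_left) (auto simp: in_keys_iff)

lemma mono_val_0 [simp]: "mono_val a 0 = 1"
  by (simp add: mono_val_def)

lemma mono_val_single [simp]: "mono_val a (sgl v k) = a v ^ k"
  by (cases "k = 0") (simp_all add: mono_val_def)

lemma mono_val_add: "mono_val a (e + f) = mono_val a e * mono_val a f"
proof -
  let ?S = "kys e \<union> kys f"
  have "kys (e + f) \<subseteq> ?S" by (rule Poly_Mapping.keys_add)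
  then have "mono_val a (e + f) = (\<Prod>v\<in>?S. a v ^ lk (e + f) v)"
    by (intro mono_val_superset) auto
  also have "\<dots> = (\<Prod>v\<in>?S. a v ^ lk e v) * (\<Prod>v\<in>?S. a v ^ lk f v)"
    by (simp add: lookup_add power_add prod.distrib)
  also have "\<dots> = mono_val a e * mono_val a f"
    by (simp add: mono_val_superset[of ?S])
  finally show ?thesis .
qed

lemma mono_val_cong: "(\<And>v. v \<in> kys e \<Longrightarrow> a v = b v) \<Longrightarrow> mono_val a e = mono_val b e"
  by (simp add: mono_val_def)

lemma monomial_expansion: "p = (\<Sum>e\<in>kys p. sgl e (lk p e))"
proof (rule poly_mapping_eqI)
  fix k
  show "lk p k = lk (\<Sum>e\<in>kys p. sgl e (lk p e)) k"
    by (simp add: lookup_sum lookup_single when_def in_keys_iff sum.delta)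
qed

context
  fixes \<kappa> :: "'a::comm_ring_1 \<Rightarrow> 'b::comm_ring_1"
  assumes \<kappa>: "comm_ring_hom \<kappa>"
begin

interpretation \<kappa>: comm_ring_hom \<kappa> by (rule \<kappa>)

lemma ins_superset:
  assumes "finite K" "kys p \<subseteq> K"
  shows "ins \<kappa> a p = (\<Sum>e\<in>K. \<kappa> (lk p e) * mono_val a e)"
  unfolding ins_def using assms
  by (intro sum.mono_neutral_left) (auto simp: in_keys_iff)

lemma ins_add: "ins \<kappa> a (p + q) = ins \<kappa> a p + ins \<kappa> a q"
proof -
  let ?K = "kys p \<union> kys q"
  have "kys (p + q) \<subseteq> ?K" by (rule Poly_Mapping.keys_add)
  then have "ins \<kappa> a (p + q) = (\<Sum>e\<in>?K. \<kappa> (lk (p + q) e) * mono_val a e)"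
    by (intro ins_superset) auto
  also have "\<dots> = (\<Sum>e\<in>?K. \<kappa> (lk p e) * mono_val a e) + (\<Sum>e\<in>?K. \<kappa> (lk q e) * mono_val a e)"
    by (simp add: lookup_add \<kappa>.hom_add algebra_simps sum.distrib)
  also have "\<dots> = ins \<kappa> a p + ins \<kappa> a q"
    by (simp add: ins_superset[of ?K])
  finally show ?thesis .
qed

lemma ins_0: "ins \<kappa> a 0 = 0"
  by (simp add: ins_def)

lemma ins_sum: "ins \<kappa> a (sum f S) = (\<Sum>x\<in>S. ins \<kappa> a (f x))"
  by (induction S rule: infinite_finite_induct) (simp_all add: ins_add ins_0)

lemma ins_single: "ins \<kappa> a (sgl e c) = \<kappa> c * mono_val a e"
  by (cases "c = 0") (simp_all add: ins_def)

lemma ins_mult: "ins \<kappa> a (p * q) = ins \<kappa> a p * ins \<kappa> a q"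
proof -
  have "p * q = (\<Sum>e\<in>kys p. sgl e (lk p e)) * (\<Sum>f\<in>kys q. sgl f (lk q f))"
    using monomial_expansion[of p] monomial_expansion[of q] by simp
  also have "\<dots> = (\<Sum>e\<in>kys p. \<Sum>f\<in>kys q. sgl (e + f) (lk p e * lk q f))"
    by (simp add: sum_product mult_single)
  finally have "ins \<kappa> a (p * q) = (\<Sum>e\<in>kys p. \<Sum>f\<in>kys q. ins \<kappa> a (sgl (e + f) (lk p e * lk q f)))"
    by (simp add: ins_sum)
  also have "\<dots> = ins \<kappa> a p * ins \<kappa> a q"
    unfolding ins_def[of \<kappa> a p] ins_def[of \<kappa> a q] sum_product
    by (intro sum.cong refl) (simp add: ins_single mono_val_add \<kappa>.hom_mult ac_simps)
  finally show ?thesis .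
qed

lemma ins_hom: "comm_ring_hom (ins \<kappa> a)"
proof
  show "ins \<kappa> a 1 = 1" using ins_single[of a 0 1] by (simp flip: single_one)
qed (simp_all add: ins_0 ins_add ins_mult)

lemma ins_Var: "ins \<kappa> a (Var v) = a v"
  by (simp add: Var_def ins_single)

text \<open>
  A subring containing the coefficients and the values of the variables contains the value of the
  polynomial. This is the way in which properties of all polynomials are proved by induction.
\<close>

lemma ins_closed:
  assumes "\<And>x y. x \<in> B \<Longrightarrow> y \<in> B \<Longrightarrow> x + y \<in> B" "\<And>x y. x \<in> B \<Longrightarrow> y \<in> B \<Longrightarrow> x * y \<in> B"
    and "0 \<in> B" "1 \<in> B" "\<And>c. \<kappa> c \<in> B" and a: "\<And>v. v \<in> vars p \<Longrightarrow> a v \<in> B"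
  shows "ins \<kappa> a p \<in> B"
proof -
  have sum: "sum f S \<in> B" if "\<And>x. x \<in> S \<Longrightarrow> f x \<in> B" for f and S :: "('v \<Rightarrow>\<^sub>0 nat) set"
    using that assms(1,3) by (induction S rule: infinite_finite_induct) auto
  have prod: "prod f S \<in> B" if "\<And>x. x \<in> S \<Longrightarrow> f x \<in> B" for f and S :: "'v set"
    using that assms(2,4) by (induction S rule: infinite_finite_induct) auto
  have pow: "x ^ k \<in> B" if "x \<in> B" for x and k :: nat
    using that assms(2,4) by (induction k) auto
  show ?thesis unfolding ins_def mono_val_def using a
    by (intro sum assms(2) prod pow assms(5)) (auto simp: vars_def)
qed

end

lemma ins_cong: "(\<And>v. v \<in> vars p \<Longrightarrow> a v = b v) \<Longrightarrow> ins \<kappa> a p = ins \<kappa> b p"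
  unfolding ins_def by (intro sum.cong refl arg_cong2[of _ _ _ _ "(*)"] mono_val_cong) (auto simp: vars_def)

text \<open>
  Homomorphisms commute with evaluation, so two homomorphisms out of a polynomial ring are compared
  by their values at the variables.
\<close>

lemma hom_ins:
  assumes "comm_ring_hom h"
  shows "h (ins \<kappa> a p) = ins (\<lambda>c. h (\<kappa> c)) (\<lambda>v. h (a v)) p"
proof -
  interpret h: comm_ring_hom h by (rule assms)
  show ?thesis by (simp add: ins_def mono_val_def h.hom_sum h.hom_mult h.hom_prod h.hom_power)
qed

lemma mono_val_Var: "mono_val Var e = (sgl e 1 :: ('v, 'a::comm_ring_1) mpol)"
proof -
  have pow: "Var v ^ k = (sgl (sgl v k) 1 :: ('v, 'a) mpol)" for v :: 'v and k
    by (induction k) (simp_all add: Var_def mult_single flip: single_add)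
  have "(\<Prod>v\<in>S. (sgl (sgl v (k v)) 1 :: ('v, 'a) mpol)) = sgl (\<Sum>v\<in>S. sgl v (k v)) 1" for S and k :: "'v \<Rightarrow> nat"
    by (induction S rule: infinite_finite_induct) (simp_all add: mult_single)
  then show ?thesis using monomial_expansion[of e] by (simp add: mono_val_def pow)
qed

lemma comm_ring_hom_sgl0: "comm_ring_hom (sgl 0 :: 'a::comm_ring_1 \<Rightarrow> ('v, 'a) mpol)"
  by standard (simp_all add: single_add mult_single)

lemma ins_id_general: "ins (sgl 0) Var p = p"
proof -
  have "ins (sgl 0) Var p = (\<Sum>e\<in>kys p. sgl e (lk p e))"
    unfolding ins_def mono_val_Var by (intro sum.cong refl) (simp add: mult_single)
  then show ?thesis using monomial_expansion[of p] by simp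
qed

abbreviation ev :: "('v \<Rightarrow> 'b::comm_ring_1) \<Rightarrow> ('v, int) mpol \<Rightarrow> 'b" where "ev \<equiv> ins of_int"

lemma comm_ring_hom_of_int: "comm_ring_hom (of_int :: int \<Rightarrow> 'b::comm_ring_1)"
  by standard simp_all

lemma ev_hom: "comm_ring_hom (ev a)"
  by (rule ins_hom[OF comm_ring_hom_of_int])

interpretation ev: comm_ring_hom "ev a" for a :: "'v \<Rightarrow> 'b::comm_ring_1"
  by (rule ev_hom)

lemma map_poly_const: "h 0 = 0 \<Longrightarrow> map_poly h [:c:] = [:h c:]"
  by (cases "c = 0") (simp_all add: map_poly_pCons)

lemma ev_Var [simp]: "ev a (Var v) = a v"
  by (rule ins_Var[OF comm_ring_hom_of_int])

lemma hom_of_int: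
  assumes "comm_ring_hom h" shows "h (of_int k) = of_int k"
proof -
  interpret h: comm_ring_hom h by (rule assms)
  show ?thesis by (rule h.hom_of_int)
qed

lemma hom_ev: "comm_ring_hom h \<Longrightarrow> h (ev a p) = ev (\<lambda>v. h (a v)) p"
  using hom_ins[of h of_int a p] hom_of_int[of h] by simp

lemma sgl_0_int: "(sgl 0 :: int \<Rightarrow> ('v, int) mpol) = of_int"
proof
  show "sgl 0 k = (of_int k :: ('v, int) mpol)" for k
    using single_of_int[of k, where 'a = "'v \<Rightarrow>\<^sub>0 nat" and 'b = int] by simp
qed

lemma ev_Var_id [simp]: "ev Var p = p"
  using ins_id_general[of p] by (simp add: sgl_0_int)

lemma ev_Var_vars: "(\<And>v. v \<in> vars p \<Longrightarrow> a v = Var v) \<Longrightarrow> ev a p = p"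
  using ins_cong[of p a Var of_int] by simp

lemma comp_hom: "comm_ring_hom f \<Longrightarrow> comm_ring_hom g \<Longrightarrow> comm_ring_hom (\<lambda>x. f (g x))"
proof -
  assume "comm_ring_hom f" "comm_ring_hom g"
  then interpret f: comm_ring_hom f + g: comm_ring_hom g by simp_all
  show ?thesis by standard (simp_all add: f.hom_add g.hom_add f.hom_mult g.hom_mult)
qed

lemma map_poly_hom: "comm_ring_hom h \<Longrightarrow> comm_ring_hom (map_poly h)"
proof -
  assume "comm_ring_hom h"
  then interpret map_poly_comm_ring_hom h by (simp add: map_poly_comm_ring_hom_def)
  show ?thesis by unfold_locales
qed

lemma poly_eval_hom: "comm_ring_hom (\<lambda>p. poly p (x :: 'b::comm_ring_1))"
  by standard simp_all

lemma const_poly_hom: "comm_ring_hom (\<lambda>c :: 'b::comm_ring_1. [:c:])"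
  by standard (simp_all add: one_pCons)

lemma vars_0 [simp]: "vars 0 = {}" and vars_1 [simp]: "vars 1 = {}"
  by (simp_all add: vars_def)

lemma vars_add: "vars (p + q) \<subseteq> vars p \<union> vars q"
  using Poly_Mapping.keys_add[of p q] by (auto simp: vars_def)

lemma vars_mult: "vars (p * q) \<subseteq> vars p \<union> vars q"
proof
  fix v assume "v \<in> vars (p * q)"
  then obtain e where e: "e \<in> kys (p * q)" "v \<in> kys e" by (auto simp: vars_def)
  then obtain e1 e2 where "e = e1 + e2" "e1 \<in> kys p" "e2 \<in> kys q"
    using Poly_Mapping.keys_mult[of p q] by auto
  then show "v \<in> vars p \<union> vars q" using e(2) Poly_Mapping.keys_add[of e1 e2] by (auto simp: vars_def)
qed

lemma vars_Var [simp]: "vars (Var v :: ('v, 'a::comm_ring_1) mpol) = {v}"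
  by (simp add: vars_def Var_def)

lemma Var_nonzero [simp]: "Var v \<noteq> (0 :: ('v, 'a::comm_ring_1) mpol)"
proof
  assume "Var v = (0 :: ('v, 'a) mpol)"
  then have "vars (Var v :: ('v, 'a) mpol) = {}" by simp
  then show False by simp
qed

lemma vars_of_int [simp]: "vars (of_int k :: ('v, 'a::comm_ring_1) mpol) = {}"
  by (simp add: vars_def flip: single_of_int)

lemma vars_uminus [simp]: "vars (- p :: ('v, 'a::comm_ring_1) mpol) = vars p"
  by (simp add: vars_def in_keys_iff set_eq_iff)

lemma vars_diff: "vars (p - q :: ('v, 'a::comm_ring_1) mpol) \<subseteq> vars p \<union> vars q"
  using vars_add[of p "- q"] by simp

lemma vars_sum: "vars (sum f S) \<subseteq> (\<Union>x\<in>S. vars (f x))"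
proof (induction S rule: infinite_finite_induct)
  case (insert x S)
  then show ?case using vars_add[of "f x" "sum f S"] by auto
qed simp_all

lemma vars_empty_const:
  assumes "vars p = {}"
  obtains c where "p = sgl 0 c"
proof -
  have "kys p \<subseteq> {0}" using assms by (auto simp: vars_def)
  then have "p = sgl 0 (lk p 0)"
    by (intro poly_mapping_eqI) (auto simp: lookup_single when_def in_keys_iff)
  then show ?thesis by (rule that)
qed

text \<open>
  The coefficients stay in the same ring but do not contain \<open>v\<close>, so the theory of univariate
  polynomials is available for each variable without leaving the type.
\<close>

definition up :: "'v \<Rightarrow> ('v, int) mpol \<Rightarrow> ('v, int) mpol poly" where
  "up v = ev (\<lambda>w. if w = v then [:0, 1:] else [:Var w:])"

lemma up_hom: "comm_ring_hom (up v)"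
  unfolding up_def by (rule ev_hom)

interpretation up: comm_ring_hom "up v" for v
  by (rule up_hom)

lemma ev_upd: "ev (a(v := s)) p = poly (map_poly (ev a) (up v p)) s"
proof -
  let ?h = "\<lambda>q. poly (map_poly (ev a) q) s"
  have "comm_ring_hom ?h"
    by (rule comp_hom[OF poly_eval_hom map_poly_hom[OF ev_hom]])
  from hom_ev[OF this, of "\<lambda>w. if w = v then [:0, 1:] else [:Var w:]" p]
  have "?h (up v p) = ev (\<lambda>w. ?h (if w = v then [:0, 1:] else [:Var w:])) p"
    unfolding up_def .
  also have "(\<lambda>w. ?h (if w = v then [:0, 1:] else [:Var w:])) = a(v := s)"
    by (auto simp: fun_eq_iff map_poly_pCons map_poly_const)
  finally show ?thesis by (rule sym)
qed

lemma ev_up: "ev a p = poly (map_poly (ev a) (up v p)) (a v)"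
  using ev_upd[of a v "a v" p] by simp

lemma poly_up: "poly (up v p) (Var v) = p"
proof -
  have "map_poly (ev Var) (up v p) = up v p" by (rule map_poly_idI) simp
  then show ?thesis using ev_up[of "Var :: 'a \<Rightarrow> ('a, int) mpol" p v] by simp
qed

lemma up_inj: "up v p = up v q \<Longrightarrow> p = q"
  by (metis poly_up)

lemma up_eq_0_iff [simp]: "up v p = 0 \<longleftrightarrow> p = 0"
  using up_inj[of v p 0] by auto

lemma vars_coeff_up: "vars (coeff (up v p) k) \<subseteq> vars p - {v}"
proof -
  let ?B = "{q :: ('a, int) mpol poly. \<forall>k. vars (coeff q k) \<subseteq> vars p - {v}}"
  have "up v p \<in> ?B" unfolding up_def
  proof (rule ins_closed[OF comm_ring_hom_of_int])
    fix x y assume "x \<in> ?B" "y \<in> ?B"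
    then have xy: "vars (coeff x k) \<subseteq> vars p - {v}" "vars (coeff y k) \<subseteq> vars p - {v}" for k by auto
    have "vars (coeff (x + y) k) \<subseteq> vars p - {v}" for k
      using vars_add[of "coeff x k" "coeff y k"] xy(1)[of k] xy(2)[of k] by auto
    then show "x + y \<in> ?B" by simp
    have "vars (coeff (x * y) k) \<subseteq> vars p - {v}" for k
    proof -
      have "vars (coeff x i * coeff y (k - i)) \<subseteq> vars p - {v}" for i
        using vars_mult[of "coeff x i" "coeff y (k - i)"] xy(1)[of i] xy(2)[of "k - i"] by auto
      then show ?thesis
        using vars_sum[of "\<lambda>i. coeff x i * coeff y (k - i)" "{..k}"] unfolding coeff_mult by blast
    qed
    then show "x * y \<in> ?B" by simp
  next
    show "of_int c \<in> ?B" for c by (auto simp: of_int_poly coeff_pCons split: nat.splits)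
  qed (auto simp: one_pCons coeff_pCons split: nat.splits if_splits)
  then show ?thesis by blast
qed

lemma up_not_var: "v \<notin> vars p \<Longrightarrow> up v p = [:p:]"
proof -
  assume "v \<notin> vars p"
  then have "up v p = ev (\<lambda>w. [:Var w:]) p"
    unfolding up_def by (intro ins_cong) auto
  also have "\<dots> = [:ev Var p:]" by (rule hom_ev[OF const_poly_hom, symmetric])
  finally show ?thesis by simp
qed

lemma degree_up_0_iff: "degree (up v p) = 0 \<longleftrightarrow> v \<notin> vars p"
proof
  assume "degree (up v p) = 0"
  then obtain c where c: "up v p = [:c:]" by (metis degree_eq_zeroE)
  then have "p = c" using poly_up[of v p] by simp
  moreover have "v \<notin> vars c" using vars_coeff_up[of v p 0] c by auto
  ultimately show "v \<notin> vars p" by simp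
qed (simp add: up_not_var)

text \<open>
  Degrees in a variable add up over a domain. In particular, factors of a nonzero polynomial contain
  no new variables.
\<close>

lemma vars_mult_eq:
  fixes f g :: "('v::linorder, int) mpol"
  assumes "f * g \<noteq> 0"
  shows "vars (f * g) = vars f \<union> vars g"
proof -
  have "v \<in> vars (f * g)" if "v \<in> vars f \<union> vars g" for v
  proof -
    have "degree (up v (f * g)) = degree (up v f) + degree (up v g)"
      using assms by (simp add: up.hom_mult degree_mult_eq)
    moreover have "degree (up v f) \<noteq> 0 \<or> degree (up v g) \<noteq> 0"
      using that by (auto simp: degree_up_0_iff)
    ultimately show ?thesis using degree_up_0_iff[of v "f * g"] by auto
  qed
  then show ?thesis using vars_mult[of f g] by blast
qed

lemma vars_dvd:
  fixes f g :: "('v::linorder, int) mpol"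
  assumes "f dvd g" "g \<noteq> 0"
  shows "vars f \<subseteq> vars g"
proof -
  obtain h where h: "g = f * h" using assms(1) by (rule dvdE)
  then show ?thesis using vars_mult_eq[of f h] assms(2) by simp
qed

text \<open>
  Induction on the number of variables: a point where the leading coefficient with respect to one
  variable does not vanish leaves only finitely many bad values for this variable.
\<close>

lemma exists_nonzero_point:
  fixes f :: "('v::linorder, int) mpol"
  assumes "f \<noteq> 0"
  shows "\<exists>a :: 'v \<Rightarrow> complex. ev a f \<noteq> 0"
  using assms
proof (induction "card (vars f)" arbitrary: f rule: less_induct)
  case less
  show ?case
  proof (cases "vars f = {}")
    case True
    then obtain c where "f = sgl 0 c" by (rule vars_empty_const)
    then show ?thesis using less.prems by (auto simp: ins_single[OF comm_ring_hom_of_int])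
  next
    case False
    then obtain v where v: "v \<in> vars f" by auto
    let ?l = "lead_coeff (up v f)"
    have "vars ?l \<subset> vars f" using vars_coeff_up[of v f] v by blast
    then have "card (vars ?l) < card (vars f)" by (intro psubset_card_mono) auto
    then obtain a :: "'v \<Rightarrow> complex" where a: "ev a ?l \<noteq> 0" using less.hyps[of ?l] less.prems by auto
    let ?q = "map_poly (ev a) (up v f)"
    have "coeff ?q (degree (up v f)) \<noteq> 0" using a by (simp add: coeff_map_poly)
    then have "?q \<noteq> 0" by (metis coeff_0)
    then have "finite {s. poly ?q s = 0}" by (rule poly_roots_finite)
    then obtain s where "poly ?q s \<noteq> 0"
      using infinite_UNIV_char_0[where 'a = complex] by (metis (mono_tags, lifting) UNIV_eq_I mem_Collect_eq)
    then have "ev (a(v := s)) f \<noteq> 0" by (simp add: ev_upd)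
    then show ?thesis by blast
  qed
qed

section \<open>Unique factorisation of integer polynomials\<close>

lemma no_vars_of_int:
  fixes p :: "('v, int) mpol"
  assumes "vars p = {}"
  obtains k where "p = of_int k"
  using vars_empty_const[OF assms] sgl_0_int by metis

lemma of_int_dvd_iff_mpol [simp]:
  "(of_int k :: ('v, int) mpol) dvd of_int l \<longleftrightarrow> k dvd l"
proof
  assume "(of_int k :: ('v, int) mpol) dvd of_int l"
  then have "ev (\<lambda>_. 0 :: int) (of_int k :: ('v, int) mpol) dvd ev (\<lambda>_. 0) (of_int l :: ('v, int) mpol)"
    by (rule ev.hom_dvd)
  moreover have "ev (\<lambda>_. 0 :: int) (of_int j :: ('v, int) mpol) = j" for j
    using ev.hom_of_int[of "\<lambda>_. 0 :: int" j] by (simp only: of_int_eq_id id_apply)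
  ultimately show "k dvd l" by (simp only: )
next
  assume "k dvd l"
  then show "(of_int k :: ('v, int) mpol) dvd of_int l" by (auto elim!: dvdE)
qed

lemma unit_mpol_int:
  fixes f :: "('v::linorder, int) mpol"
  assumes "f dvd 1"
  shows "f = 1 \<or> f = -1"
proof -
  have "vars f = {}" using vars_dvd[OF assms] by simp
  then obtain k where k: "f = of_int k" by (rule no_vars_of_int)
  then have "k dvd 1" using assms of_int_dvd_iff_mpol[of k 1, where 'v = 'v] by simp
  then have "k = 1 \<or> k = - 1" by auto
  then show ?thesis using k by auto
qed

text \<open>
  The degree is read off after all variables have been multiplied by a new one; as a univariate
  degree it is additive.
\<close>

definition total_degree :: "('v, int) mpol \<Rightarrow> nat" where
  "total_degree f = degree (ev (\<lambda>v. monom (Var v :: ('v, int) mpol) 1) f)"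

text \<open>
  Together with the total degree, this makes proper division well-founded: a factor of degree zero
  is an integer, and splitting off a nonunit integer decreases the sum of the absolute values.
\<close>

definition coeff_norm :: "('v, int) mpol \<Rightarrow> nat" where
  "coeff_norm f = (\<Sum>e\<in>kys f. nat \<bar>lk f e\<bar>)"

lemma total_degree_aux:
  "poly (ev (\<lambda>v. monom (Var v :: ('v, int) mpol) 1) f) t = ev (\<lambda>v. Var v * t) (f :: ('v, int) mpol)"
  using hom_ev[OF poly_eval_hom[of t], of "\<lambda>v. monom (Var v) 1" f] by (simp add: poly_monom)

lemma total_degree_mult:
  fixes f g :: "('v::linorder, int) mpol"
  assumes "f \<noteq> 0" "g \<noteq> 0"
  shows "total_degree (f * g) = total_degree f + total_degree g"
proof -
  have "ev (\<lambda>v. monom (Var v :: ('v, int) mpol) 1) h \<noteq> 0" if "h \<noteq> 0" for h :: "('v, int) mpol"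
    using total_degree_aux[of h 1] that by auto
  then show ?thesis using assms by (simp add: total_degree_def ev.hom_mult degree_mult_eq)
qed

lemma total_degree_0:
  fixes f :: "('v, int) mpol"
  assumes "total_degree f = 0"
  shows "vars f = {}"
proof -
  obtain c where "ev (\<lambda>v. monom (Var v :: ('v, int) mpol) 1) f = [:c:]"
    using assms unfolding total_degree_def by (metis degree_eq_zeroE)
  then have "f = c" "ev (\<lambda>_. 0) f = c"
    using total_degree_aux[of f 1] total_degree_aux[of f 0] by simp_all
  moreover have "ev (\<lambda>_. 0) f \<in> range (of_int :: int \<Rightarrow> ('v, int) mpol)"
    by (rule ins_closed[OF comm_ring_hom_of_int]) (auto simp flip: of_int_add of_int_mult
      intro: image_eqI[of _ _ 0] image_eqI[of _ _ 1])
  ultimately show ?thesis by auto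
qed

lemma lookup_of_int_mult: "lk (of_int c * (f :: ('v, int) mpol)) e = c * lk f e"
proof -
  have *: "of_int c * (f :: ('v, int) mpol) = (\<Sum>e'\<in>kys f. sgl e' (c * lk f e'))"
    by (subst monomial_expansion[of f])
      (simp add: sum_distrib_left mult_single flip: sgl_0_int)
  then show ?thesis
    by (simp add: lookup_sum lookup_single when_def sum.delta in_keys_iff)
qed

lemma proper_factor_smaller:
  fixes g h :: "('v::linorder, int) mpol"
  assumes "g * h \<noteq> 0" "\<not> h dvd 1"
  shows "(g, g * h) \<in> measures [total_degree, coeff_norm]"
proof (cases "total_degree h = 0")
  case False
  then show ?thesis using assms total_degree_mult[of g h] by auto
next
  case True
  then obtain c where c: "h = of_int c" using total_degree_0 no_vars_of_int by metis
  have "\<not> c dvd 1" using assms(2) of_int_dvd_iff_mpol[of c 1, where 'v = 'v] c by simp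
  moreover have "c \<noteq> 0" using assms(1) c by auto
  ultimately have c2: "\<bar>c\<bar> > 1" by auto
  have lkgh: "lk (g * h) e = c * lk g e" for e
    using lookup_of_int_mult[of c g e] c by (simp add: mult.commute)
  then have "kys (g * h) = kys g" using \<open>c \<noteq> 0\<close> by (auto simp: in_keys_iff)
  moreover have "nat \<bar>lk g e\<bar> < nat \<bar>c * lk g e\<bar>" if "e \<in> kys g" for e
    using that c2 by (simp add: in_keys_iff abs_mult)
  moreover have "kys g \<noteq> {}" using assms(1) by auto
  ultimately have "coeff_norm g < coeff_norm (g * h)"
    unfolding coeff_norm_def lkgh by (simp add: sum_strict_mono)
  moreover have "total_degree (g * h) = total_degree g"
    using assms True total_degree_mult[of g h] by auto
  ultimately show ?thesis by auto
qed

lemma exists_irreducible_factor: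
  fixes f :: "('v::linorder, int) mpol"
  assumes "f \<noteq> 0" "\<not> f dvd 1"
  shows "\<exists>p. irreducible p \<and> p dvd f"
  using assms
proof (induction f rule: wf_induct_rule[OF wf_measures[of "[total_degree, coeff_norm]"]])
  case (1 f)
  show ?case
  proof (cases "irreducible f")
    case False
    then obtain a b where ab: "f = a * b" "\<not> a dvd 1" "\<not> b dvd 1"
      using 1(2,3) by (auto simp: irreducible_def)
    then obtain p where "irreducible p" "p dvd a"
      using 1(1)[of a] proper_factor_smaller[of a b] 1(2) by auto
    then show ?thesis using ab by auto
  qed auto
qed

lemma irreducible_factor_induct [consumes 1, case_names unit mult]:
  fixes f :: "('v::linorder, int) mpol"
  assumes "f \<noteq> 0" and unit: "\<And>u. u dvd 1 \<Longrightarrow> P u"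
    and mult: "\<And>p g. irreducible p \<Longrightarrow> g \<noteq> 0 \<Longrightarrow> P g \<Longrightarrow> P (p * g)"
  shows "P f"
  using assms(1)
proof (induction f rule: wf_induct_rule[OF wf_measures[of "[total_degree, coeff_norm]"]])
  case (1 f)
  show ?case
  proof (cases "f dvd 1")
    case False
    then obtain p g where p: "irreducible p" "f = p * g"
      using exists_irreducible_factor[OF 1(2) False] unfolding dvd_def by blast
    moreover have "(g, f) \<in> measures [total_degree, coeff_norm]"
      using proper_factor_smaller[of g p] p 1(2) by (auto simp: mult.commute irreducible_def)
    ultimately show ?thesis using mult[of p g] 1 by auto
  qed (rule unit)
qed

text \<open>
  Divisibility by a polynomial without \<open>v\<close> is decided on the coefficients with respect to \<open>v\<close>, as in
  Gauss's lemma.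
\<close>

lemma const_dvd_iff_coeffs:
  fixes f a :: "('v::linorder, int) mpol"
  assumes "v \<notin> vars f"
  shows "f dvd a \<longleftrightarrow> (\<forall>k. f dvd coeff (up v a) k)"
proof
  assume "f dvd a"
  then have "[:f:] dvd up v a" using up.hom_dvd[of f a v] up_not_var[OF assms] by simp
  then show "\<forall>k. f dvd coeff (up v a) k" by (simp add: const_poly_dvd_iff)
next
  assume "\<forall>k. f dvd coeff (up v a) k"
  then have "[:f:] dvd up v a" by (simp add: const_poly_dvd_iff)
  then obtain q where "up v a = [:f:] * q" by (rule dvdE)
  then have "poly (up v a) (Var v) = f * poly q (Var v)" by simp
  then show "f dvd a" by (simp add: poly_up)
qed

text \<open>
  Division with remainder in \<open>v\<close> after multiplication by a power of the leading coefficient of \<open>g\<close>.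
  The set \<open>W\<close> keeps track of the other variables.
\<close>

lemma pseudo_division:
  fixes g h :: "('v::linorder, int) mpol"
  assumes "g \<noteq> 0" "v \<notin> W" "vars g \<subseteq> insert v W" "vars h \<subseteq> insert v W"
  shows "\<exists>c q r. c \<noteq> 0 \<and> vars c \<subseteq> W \<and> vars q \<subseteq> insert v W \<and> vars r \<subseteq> insert v W \<and>
    c * h = q * g + r \<and> (r = 0 \<or> degree (up v r) < degree (up v g))"
  using assms(4)
proof (induction "if h = 0 then 0 else Suc (degree (up v h))" arbitrary: h rule: less_induct)
  case less
  let ?dg = "degree (up v g)" and ?dh = "degree (up v h)"
  show ?case
  proof (cases "h = 0 \<or> ?dh < ?dg")
    case True
    then show ?thesis using less.prems
      by (intro exI[of _ 1] exI[of _ 0] exI[of _ h]) auto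
  next
    case False
    define l where "l = lead_coeff (up v g)"
    define m where "m = lead_coeff (up v h)"
    define s where "s = m * Var v ^ (?dh - ?dg)"
    define h1 where "h1 = l * h - s * g"
    have l: "l \<noteq> 0" "v \<notin> vars l" "vars l \<subseteq> W" and m: "v \<notin> vars m" "vars m \<subseteq> W"
      unfolding l_def m_def using assms vars_coeff_up[of v g ?dg] vars_coeff_up[of v h ?dh] less.prems by auto
    have pow: "vars (Var v ^ k :: ('v, int) mpol) \<subseteq> {v}" for k
    proof (induction k)
      case (Suc k)
      then show ?case using vars_mult[of "Var v" "Var v ^ k :: ('v, int) mpol"] by auto
    qed simp
    have vs: "vars s \<subseteq> insert v W"
      using vars_mult[of m "Var v ^ (?dh - ?dg)"] m(2) pow[of "?dh - ?dg"] unfolding s_def by blast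
    have vh1: "vars h1 \<subseteq> insert v W"
      using vars_diff[of "l * h" "s * g"] vars_mult[of l h] vars_mult[of s g] vs l(3) less.prems assms(3)
      unfolding h1_def by blast
    have upV: "up v (Var v) = [:0, 1:]" unfolding up_def by simp
    have up1: "up v h1 = Polynomial.smult l (up v h) - Polynomial.smult m (monom 1 (?dh - ?dg) * up v g)"
      unfolding h1_def s_def
      by (simp add: up.hom_minus up.hom_mult up.hom_power up_not_var l m upV mult.assoc
        flip: x_as_monom monom_altdef)
        (simp add: monom_altdef)
    have deg: "degree (up v h1) \<le> ?dh"
      unfolding up1 using False
      by (intro degree_diff_le) (auto intro!: order.trans[OF degree_smult_le] order.trans[OF degree_mult_le]
        simp: degree_monom_eq)
    have "coeff (up v h1) ?dh = 0"
      unfolding up1 using False by (simp add: coeff_monom_mult l_def m_def)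
    then have deg1: "h1 = 0 \<or> degree (up v h1) < ?dh"
      using deg by (metis up_eq_0_iff leading_coeff_0_iff le_neq_implies_less)
    then have measure: "(if h1 = 0 then 0 else Suc (degree (up v h1))) < (if h = 0 then 0 else Suc ?dh)"
      using False by auto
    obtain c q r where c: "c \<noteq> 0" "vars c \<subseteq> W" "vars q \<subseteq> insert v W" "vars r \<subseteq> insert v W"
      "c * h1 = q * g + r" "r = 0 \<or> degree (up v r) < ?dg"
      using less.hyps[OF measure vh1] by blast
    have "(c * l) * h = (q + c * s) * g + r"
      using c(5) unfolding h1_def by (simp add: algebra_simps)
    moreover have "vars (q + c * s) \<subseteq> insert v W"
      using vars_add[of q "c * s"] vars_mult[of c s] c(2,3) vs by blast
    moreover have "vars (c * l) \<subseteq> W" using vars_mult[of c l] c(2) l(3) by blast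
    moreover have "c * l \<noteq> 0" using c(1) l(1) by simp
    ultimately show ?thesis using c(4,6) by blast
  qed
qed

text \<open>
  Primality tested only against polynomials in the variables \<open>W\<close>. This is the statement that can be
  proved by induction on \<open>W\<close>; primality against all polynomials follows since each test involves
  finitely many variables.
\<close>

definition prime_in :: "'v set \<Rightarrow> ('v, int) mpol \<Rightarrow> bool" where
  "prime_in W f \<longleftrightarrow> (\<forall>a b. vars a \<subseteq> W \<longrightarrow> vars b \<subseteq> W \<longrightarrow> f dvd a * b \<longrightarrow> f dvd a \<or> f dvd b)"

lemma prime_in_empty:
  fixes f :: "('v::linorder, int) mpol"
  assumes "irreducible f" "vars f \<subseteq> {}"
  shows "prime_in {} f"
proof -
  obtain k where k: "f = of_int k" using assms(2) no_vars_of_int[of f] by blast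
  have "irreducible k"
  proof (rule irreducibleI)
    show "k \<noteq> 0" using assms(1) k by auto
    show "\<not> k dvd 1" using assms(1) k of_int_dvd_iff_mpol[of k 1, where 'v = 'v] by (auto simp: irreducible_def)
    fix a b assume "k = a * b"
    then have "f = of_int a * of_int b" using k by simp
    then have "of_int a dvd (1 :: ('v, int) mpol) \<or> of_int b dvd (1 :: ('v, int) mpol)"
      using assms(1) by (auto simp: irreducible_def)
    then show "a dvd 1 \<or> b dvd 1"
      using of_int_dvd_iff_mpol[of a 1, where 'v = 'v] of_int_dvd_iff_mpol[of b 1, where 'v = 'v] by simp
  qed
  then have prime: "prime_elem k" by (rule irreducible_imp_prime_elem)
  show ?thesis unfolding prime_in_def
  proof (intro allI impI)
    fix a b :: "('v, int) mpol"
    assume "vars a \<subseteq> {}" "vars b \<subseteq> {}" and dvd: "f dvd a * b"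
    then obtain x y where xy: "a = of_int x" "b = of_int y"
      by (metis no_vars_of_int subset_empty)
    then have "k dvd x * y" using dvd k of_int_dvd_iff_mpol[of k "x * y", where 'v = 'v] by simp
    then have "k dvd x \<or> k dvd y" by (rule prime_elem_dvd_multD[OF prime])
    then show "f dvd a \<or> f dvd b" using k xy by auto
  qed
qed

context
  fixes W :: "'v::linorder set" and v :: 'v
  assumes vW: "v \<notin> W" and IH: "\<And>f :: ('v, int) mpol. irreducible f \<Longrightarrow> vars f \<subseteq> W \<Longrightarrow> prime_in W f"
begin

text \<open>
  Gauss's lemma: if \<open>f\<close> divides neither \<open>a\<close> nor \<open>b\<close>, then it does not divide the product of the first
  coefficients of \<open>a\<close> and \<open>b\<close> that it does not divide, while it divides all other contributions to the
  same coefficient of \<open>a * b\<close>.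
\<close>

lemma prime_in_insert_const:
  fixes f :: "('v, int) mpol"
  assumes "irreducible f" "vars f \<subseteq> W"
  shows "prime_in (insert v W) f"
  unfolding prime_in_def
proof (intro allI impI, rule ccontr)
  fix a b :: "('v, int) mpol"
  assume ab: "vars a \<subseteq> insert v W" "vars b \<subseteq> insert v W" and dvd: "f dvd a * b"
    and neg: "\<not> (f dvd a \<or> f dvd b)"
  have vf: "v \<notin> vars f" using assms(2) vW by blast
  let ?a = "coeff (up v a)" and ?b = "coeff (up v b)"
  define k where "k = (LEAST k. \<not> f dvd ?a k)"
  define l where "l = (LEAST l. \<not> f dvd ?b l)"
  have "\<exists>k. \<not> f dvd ?a k" using neg const_dvd_iff_coeffs[OF vf, of a] by blast
  then have k: "\<not> f dvd ?a k" unfolding k_def by (rule LeastI_ex)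
  have k_less: "f dvd ?a i" if "i < k" for i
    using not_less_Least[OF that[unfolded k_def]] by blast
  have "\<exists>k. \<not> f dvd ?b k" using neg const_dvd_iff_coeffs[OF vf, of b] by blast
  then have l: "\<not> f dvd ?b l" unfolding l_def by (rule LeastI_ex)
  have l_less: "f dvd ?b i" if "i < l" for i
    using not_less_Least[OF that[unfolded l_def]] by blast
  have "f dvd coeff (up v (a * b)) (k + l)" using dvd const_dvd_iff_coeffs[OF vf] by blast
  also have "coeff (up v (a * b)) (k + l) = (\<Sum>i\<le>k + l. ?a i * ?b (k + l - i))"
    by (simp add: up.hom_mult coeff_mult)
  also have "\<dots> = ?a k * ?b l + (\<Sum>i\<in>{..k + l} - {k}. ?a i * ?b (k + l - i))"
    by (subst sum.remove[of _ k]) auto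
  finally have "f dvd ?a k * ?b l + (\<Sum>i\<in>{..k + l} - {k}. ?a i * ?b (k + l - i))" .
  moreover have "f dvd (\<Sum>i\<in>{..k + l} - {k}. ?a i * ?b (k + l - i))"
  proof (rule dvd_sum)
    fix i assume i: "i \<in> {..k + l} - {k}"
    show "f dvd ?a i * ?b (k + l - i)"
    proof (cases "i < k")
      case False
      then have "k + l - i < l" using i by auto
      then show ?thesis using l_less by (simp add: dvd_mult)
    qed (simp add: k_less)
  qed
  ultimately have "f dvd ?a k * ?b l" using dvd_add_left_iff by blast
  moreover have "vars (?a k) \<subseteq> W" "vars (?b l) \<subseteq> W"
    using vars_coeff_up[of v a k] vars_coeff_up[of v b l] ab by auto
  ultimately show False using IH[OF assms] k l unfolding prime_in_def by blast
qed

text \<open>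
  The irreducible factors of \<open>c\<close> are prime and cannot divide \<open>f\<close>, which contains \<open>v\<close>; they are removed
  one after the other.
\<close>

lemma cancel_v_free_factor:
  fixes f b c :: "('v, int) mpol"
  assumes "c \<noteq> 0" "vars c \<subseteq> W" "irreducible f" "v \<in> vars f" "vars f \<subseteq> insert v W"
    "vars b \<subseteq> insert v W" "f dvd c * b"
  shows "f dvd b"
  using assms(1,2,6,7)
proof (induction c arbitrary: b rule: irreducible_factor_induct)
  case (unit u)
  then show ?case using unit_mpol_int[of u] by auto
next
  case (mult p c)
  show ?case
  proof (cases "b = 0")
    case False
    have p0: "p \<noteq> 0" using mult by auto
    then have vp: "vars p \<subseteq> W" "vars c \<subseteq> W" using vars_mult_eq[of p c] mult by auto
    obtain h where h: "p * c * b = f * h" using mult.prems(3) unfolding dvd_def by blast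
    have nz: "f * h \<noteq> 0" using False p0 mult h by auto
    have "vars h \<subseteq> insert v W"
      using vars_mult_eq[OF nz] vars_mult[of "p * c" b] mult.prems h by auto
    moreover have "p dvd f * h" using h by (metis dvd_triv_left mult.assoc)
    ultimately have "p dvd f \<or> p dvd h"
      using prime_in_insert_const[OF mult(1) vp(1)] assms(5) by (auto simp: prime_in_def)
    moreover have "\<not> p dvd f"
    proof
      assume "p dvd f"
      then obtain k where k: "f = p * k" by auto
      then have "k dvd 1" using assms(3) mult(1) by (auto simp: irreducible_def)
      then have "vars k = {}" using vars_dvd[of k 1] by simp
      then show False using k assms(4) vars_mult[of p k] vp(1) vW by auto
    qed
    ultimately obtain h0 where "h = p * h0" by auto
    then have "c * b = f * h0" using h p0 by (simp add: mult.assoc mult.left_commute)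
    then show ?thesis using mult(3)[of b] vp(2) mult.prems by auto
  qed simp
qed

text \<open>
  Each irreducible factor of \<open>c\<close> is prime, so it can be moved into \<open>q\<close> or into \<open>g\<close>.
\<close>

lemma split_v_free_factor:
  fixes f q g c :: "('v, int) mpol"
  assumes "c \<noteq> 0" "vars c \<subseteq> W" "f \<noteq> 0" "vars q \<subseteq> insert v W" "vars g \<subseteq> insert v W" "c * f = q * g"
  shows "\<exists>q' g' c1 c2. q = q' * c1 \<and> g = g' * c2 \<and> c = c1 * c2"
  using assms(1,2,4-)
proof (induction c arbitrary: q g rule: irreducible_factor_induct)
  case (unit u)
  then obtain w where "u * w = 1" unfolding dvd_def by auto
  then have "q = (q * w) * u" by (simp add: ac_simps)
  then show ?case by (metis mult.right_neutral)
next
  case (mult p c)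
  have p0: "p \<noteq> 0" using mult by auto
  then have vp: "vars p \<subseteq> W" "vars c \<subseteq> W" using vars_mult_eq[of p c] mult by auto
  have nz: "q * g \<noteq> 0" using mult p0 assms(3) by auto
  have "p dvd q * g" using mult(7) by (metis dvd_triv_left mult.assoc)
  then consider "p dvd q" | "p dvd g"
    using prime_in_insert_const[OF mult(1) vp(1)] mult.prems by (auto simp: prime_in_def)
  then show ?case
  proof cases
    case 1
    then obtain q0 where q0: "q = p * q0" by auto
    then have "vars q0 \<subseteq> insert v W" using vars_mult_eq[of p q0] nz mult.prems by auto
    moreover have "c * f = q0 * g" using mult(7) q0 p0 by (simp add: mult.assoc)
    ultimately obtain q' g' c1 c2 where "q0 = q' * c1" "g = g' * c2" "c = c1 * c2"
      using mult(3)[of q0 g] vp(2) mult.prems by auto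
    then have "q = q' * (p * c1)" "g = g' * c2" "p * c = (p * c1) * c2"
      using q0 by (simp_all add: ac_simps)
    then show ?thesis by blast
  next
    case 2
    then obtain g0 where g0: "g = p * g0" by auto
    then have "vars g0 \<subseteq> insert v W" using vars_mult_eq[of p g0] nz mult.prems by auto
    moreover have "c * f = q * g0"
      using mult(7) g0 p0 by (simp add: mult.assoc mult.left_commute[of q])
    ultimately obtain q' g' c1 c2 where "q = q' * c1" "g0 = g' * c2" "c = c1 * c2"
      using mult(3)[of q g0] vp(2) mult.prems by auto
    then have "q = q' * c1" "g = g' * (p * c2)" "p * c = c1 * (p * c2)"
      using g0 by (simp_all add: ac_simps)
    then show ?thesis by blast
  qed
qed

text \<open>
  Let \<open>g\<close> be a nonzero combination of \<open>f\<close> and \<open>a\<close> of least degree in \<open>v\<close>. Pseudo-division shows that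
  \<open>g\<close> divides \<open>f\<close> and \<open>a\<close> up to factors without \<open>v\<close>. As \<open>f\<close> is irreducible, either \<open>g\<close> is \<open>f\<close> up to
  such a factor, and then \<open>f\<close> divides \<open>a\<close>, or \<open>g\<close> is free of \<open>v\<close>, and then \<open>f\<close> divides \<open>g * b\<close> and
  therefore \<open>b\<close>.
\<close>

lemma prime_in_insert:
  fixes f :: "('v, int) mpol"
  assumes f: "irreducible f" "vars f \<subseteq> insert v W"
  shows "prime_in (insert v W) f"
proof (cases "v \<in> vars f")
  case False
  then have "vars f \<subseteq> W" using f(2) by blast
  then show ?thesis by (rule prime_in_insert_const[OF f(1)])
next
  case vf: True
  let ?V = "insert v W"
  have f0: "f \<noteq> 0" using f by auto
  show ?thesis unfolding prime_in_def
  proof (intro allI impI)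
    fix a b :: "('v, int) mpol"
    assume ab: "vars a \<subseteq> ?V" "vars b \<subseteq> ?V" and dvd: "f dvd a * b"
    define S where "S = (\<lambda>g. g \<noteq> 0 \<and> vars g \<subseteq> ?V \<and> (\<exists>\<alpha> \<beta>. vars \<alpha> \<subseteq> ?V \<and> vars \<beta> \<subseteq> ?V \<and> g = \<alpha> * f + \<beta> * a))"
    have "vars (1 :: ('v, int) mpol) \<subseteq> ?V \<and> vars (0 :: ('v, int) mpol) \<subseteq> ?V \<and> f = 1 * f + 0 * a"
      by simp
    then have "S f" unfolding S_def using f f0 by blast
    then have "\<exists>g. S g \<and> (\<forall>h. S h \<longrightarrow> degree (up v g) \<le> degree (up v h))"
      by (rule ex_has_least_nat)
    then obtain g where g: "S g" and min: "\<And>h. S h \<Longrightarrow> degree (up v g) \<le> degree (up v h)"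
      by blast
    obtain \<alpha> \<beta> where al: "vars \<alpha> \<subseteq> ?V" "vars \<beta> \<subseteq> ?V" "g = \<alpha> * f + \<beta> * a" using g unfolding S_def by blast
    have multiple: "\<exists>c q. c \<noteq> 0 \<and> vars c \<subseteq> W \<and> vars q \<subseteq> ?V \<and> c * h = q * g"
      if h: "vars h \<subseteq> ?V" "vars \<alpha>' \<subseteq> ?V" "vars \<beta>' \<subseteq> ?V" "h = \<alpha>' * f + \<beta>' * a" for h \<alpha>' \<beta>'
    proof -
      obtain c q r where c: "c \<noteq> 0" "vars c \<subseteq> W" "vars q \<subseteq> ?V" "vars r \<subseteq> ?V" "c * h = q * g + r"
        "r = 0 \<or> degree (up v r) < degree (up v g)"
        using pseudo_division[of g v W h] g[unfolded S_def] h vW by blast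
      have "r = (c * \<alpha>' - q * \<alpha>) * f + (c * \<beta>' - q * \<beta>) * a"
        using c(5) h(4) al(3) by (simp add: algebra_simps)
      moreover have "vars (c * \<alpha>' - q * \<alpha>) \<subseteq> ?V" "vars (c * \<beta>' - q * \<beta>) \<subseteq> ?V"
        using vars_diff[of "c * \<alpha>'" "q * \<alpha>"] vars_mult[of c \<alpha>'] vars_mult[of q \<alpha>]
          vars_diff[of "c * \<beta>'" "q * \<beta>"] vars_mult[of c \<beta>'] vars_mult[of q \<beta>] c h al by blast+
      ultimately have "r = 0" using min[of r, unfolded S_def] c(4,6) by (metis leD)
      then show ?thesis using c by auto
    qed
    obtain c q where c: "c \<noteq> 0" "vars c \<subseteq> W" "vars q \<subseteq> ?V" "c * f = q * g"
      using multiple[of f 1 0] f by auto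
    obtain c' q' where c': "c' \<noteq> 0" "vars c' \<subseteq> W" "vars q' \<subseteq> ?V" "c' * a = q' * g"
      using multiple[of a 0 1] ab by auto
    obtain q1 g1 c1 c2 where s: "q = q1 * c1" "g = g1 * c2" "c = c1 * c2"
      using split_v_free_factor[OF c(1,2) f0 c(3) _ c(4)] g[unfolded S_def] by blast
    have "c * f = c * (q1 * g1)" using c(4) s by (simp add: ac_simps)
    then have "f = q1 * g1" using c(1) by simp
    then consider "q1 dvd 1" | "g1 dvd 1" using f(1) by (auto simp: irreducible_def)
    then show "f dvd a \<or> f dvd b"
    proof cases
      case 1
      then have "f dvd g1" using \<open>f = q1 * g1\<close> unit_mpol_int[of q1] by auto
      then have "f dvd c' * a" using c'(4) s(2) by auto
      then show ?thesis using cancel_v_free_factor[OF c'(1,2) f(1) vf f(2) ab(1)] by blast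
    next
      case 2
      then have "vars g1 = {}" using vars_dvd[of g1 1] by simp
      moreover have "vars c2 \<subseteq> W" using c(1,2) s(3) vars_mult_eq[of c1 c2] by auto
      ultimately have "vars g \<subseteq> W" using s(2) vars_mult[of g1 c2] by auto
      moreover have "g * b = f * (\<alpha> * b) + \<beta> * (a * b)" unfolding al(3) by (simp add: algebra_simps)
      then have "f dvd g * b" using dvd by simp
      ultimately show ?thesis using cancel_v_free_factor[OF _ _ f(1) vf f(2) ab(2), of g] g[unfolded S_def] by blast
    qed
  qed
qed

end

theorem irreducible_imp_prime_mpol:
  fixes f :: "('v::linorder, int) mpol"
  assumes "irreducible f"
  shows "prime_elem f"
proof -
  have prime: "prime_in W f" if "finite W" "irreducible f" "vars f \<subseteq> W" for W and f :: "('v, int) mpol"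
    using that
  proof (induction W arbitrary: f rule: finite_induct)
    case empty
    then show ?case using prime_in_empty by simp
  next
    case (insert v W)
    then show ?case using prime_in_insert[of v W f] by blast
  qed
  show ?thesis
  proof (rule prime_elemI)
    show "f \<noteq> 0" "\<not> f dvd 1" using assms by (auto simp: irreducible_def)
    fix a b assume "f dvd a * b"
    then show "f dvd a \<or> f dvd b"
      using prime[of "vars f \<union> vars a \<union> vars b" f] assms unfolding prime_in_def by auto
  qed
qed

text \<open>
  This replaces the resultant of two polynomials with respect to \<open>v\<close>. A combination of least degree in
  \<open>v\<close> divides both polynomials up to factors without \<open>v\<close>; if it contained \<open>v\<close>, the prime \<open>R\<close> would
  divide it and hence \<open>G\<close>.
\<close>

lemma elimination:
  fixes R G :: "('v::linorder, int) mpol"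
  assumes R: "irreducible R" "v \<in> vars R" and G: "\<not> R dvd G"
  shows "\<exists>\<alpha> \<beta>. \<alpha> * R + \<beta> * G \<noteq> 0 \<and> v \<notin> vars (\<alpha> * R + \<beta> * G)"
proof -
  have prime: "prime_elem R" by (rule irreducible_imp_prime_mpol[OF R(1)])
  define S where "S = (\<lambda>g. g \<noteq> 0 \<and> (\<exists>\<alpha> \<beta>. g = \<alpha> * R + \<beta> * G))"
  have "R = 1 * R + 0 * G" by simp
  moreover have "R \<noteq> 0" using R by auto
  ultimately have "S R" unfolding S_def by blast
  then have "\<exists>g. S g \<and> (\<forall>h. S h \<longrightarrow> degree (up v g) \<le> degree (up v h))"
      by (rule ex_has_least_nat)
    then obtain g where g: "S g" and min: "\<And>h. S h \<Longrightarrow> degree (up v g) \<le> degree (up v h)"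
      by blast
    obtain \<alpha> \<beta> where al: "g = \<alpha> * R + \<beta> * G" using g unfolding S_def by blast
  have multiple: "\<exists>c q. c \<noteq> 0 \<and> v \<notin> vars c \<and> c * h = q * g" if h: "h = \<alpha>' * R + \<beta>' * G" for h \<alpha>' \<beta>'
  proof -
    have "g \<noteq> 0" "vars g \<subseteq> insert v (- {v})" "vars h \<subseteq> insert v (- {v})"
      using g unfolding S_def by auto
    then obtain c q r where c: "c \<noteq> 0" "vars c \<subseteq> - {v}" "c * h = q * g + r"
      "r = 0 \<or> degree (up v r) < degree (up v g)"
      using pseudo_division[of g v "- {v}" h] by blast
    have "r = (c * \<alpha>' - q * \<alpha>) * R + (c * \<beta>' - q * \<beta>) * G"
      using c(3) h al by (simp add: algebra_simps)
    then have "r = 0" using min[of r, unfolded S_def] c(4) by (metis leD)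
    then show ?thesis using c by auto
  qed
  obtain c q where c: "c \<noteq> 0" "v \<notin> vars c" "c * R = q * g" using multiple[of R 1 0] by auto
  obtain c' q' where c': "c' \<noteq> 0" "v \<notin> vars c'" "c' * G = q' * g" using multiple[of G 0 1] by auto
  have "R dvd q * g" using c(3) by (metis dvd_triv_right)
  then consider "R dvd g" | "R dvd q" using prime by (auto dest: prime_elem_dvd_multD)
  then have "v \<notin> vars g"
  proof cases
    case 1
    then have "R dvd c' * G" using c'(3) by simp
    then have "R dvd c'" using prime G by (auto dest: prime_elem_dvd_multD)
    then show ?thesis using vars_dvd[of R c'] c' R by auto
  next
    case 2
    then obtain q0 where "q = R * q0" by auto
    then have "c = q0 * g" using c(3) R(1) by (auto simp: ac_simps)
    then show ?thesis using c(1,2) vars_mult_eq[of q0 g] by auto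
  qed
  then show ?thesis using g[unfolded S_def] al by blast
qed

section \<open>A projective Nullstellensatz\<close>

text \<open>
  Monomials of degree \<open>k\<close> in the variables \<open>J\<close>. Arbitrary finite index sets are used because the
  induction for Macaulay's formula removes the least index.
\<close>

definition mons :: "nat set \<Rightarrow> nat \<Rightarrow> expo set" where
  "mons J k = {c. kys c \<subseteq> J \<and> (\<Sum>j\<in>J. lk c j) = k}"

text \<open>
  The coefficient of \<open>t\<^sup>c\<close> in \<open>t\<^sup>e\<close> times the form with coefficients \<open>a\<close>. The condition says that the
  difference of the exponent vectors does not truncate.
\<close>

definition shiftc :: "(expo \<Rightarrow> 'a::zero) \<Rightarrow> expo \<Rightarrow> expo \<Rightarrow> 'a" where
  "shiftc a e c = (if \<exists>f. c = e + f then a (c - e) else 0)"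

definition form_val :: "nat set \<Rightarrow> nat \<Rightarrow> (expo \<Rightarrow> 'a::comm_ring_1) \<Rightarrow> (nat \<Rightarrow> 'a) \<Rightarrow> 'a" where
  "form_val J k a z = (\<Sum>c\<in>mons J k. a c * mono_val z c)"

text \<open>
  Systems are given by arbitrary coefficient families; only the coefficients at monomials of the right
  degree matter.
\<close>

definition has_zero :: "nat set \<Rightarrow> (nat \<Rightarrow> nat) \<Rightarrow> (nat \<Rightarrow> expo \<Rightarrow> complex) \<Rightarrow> bool" where
  "has_zero J d F \<longleftrightarrow> (\<exists>z. (\<exists>j\<in>J. z j \<noteq> 0) \<and> (\<forall>i\<in>J. form_val J (d i) (F i) z = 0))"

lemma mons_atMost: "mons {..n} k = expos n k"
  by (simp add: mons_def expos_def)

lemma mons_superset: "J \<subseteq> K \<Longrightarrow> finite K \<Longrightarrow> mons J k \<subseteq> mons K k"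
proof
  fix c assume JK: "J \<subseteq> K" "finite K" and c: "c \<in> mons J k"
  have "(\<Sum>j\<in>J. lk c j) = (\<Sum>j\<in>K. lk c j)"
    using JK c by (intro sum.mono_neutral_left) (auto simp: mons_def in_keys_iff)
  then show "c \<in> mons K k" using c JK by (auto simp: mons_def)
qed

lemma finite_mons [simp]:
  assumes "finite J"
  shows "finite (mons J k)"
proof -
  have "J \<subseteq> {..Max (insert 0 J)}" using assms Max_ge[of "insert 0 J"] by auto
  then have "mons J k \<subseteq> expos (Max (insert 0 J)) k"
    using mons_superset[of J "{..Max (insert 0 J)}" k] by (simp add: mons_atMost)
  then show ?thesis by (rule finite_subset) (rule finite_expos)
qed

lemma mons_add: "e \<in> mons J k \<Longrightarrow> f \<in> mons J l \<Longrightarrow> e + f \<in> mons J (k + l)"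
  using Poly_Mapping.keys_add[of e f] by (auto simp: mons_def lookup_add sum.distrib)

lemma kys_add_eq: "kys (e + f) = kys e \<union> kys (f :: 'v \<Rightarrow>\<^sub>0 nat)"
  by (auto simp: in_keys_iff lookup_add)

lemma mons_add_cancel:
  assumes "e + f \<in> mons J k" "f \<in> mons J l"
  shows "e \<in> mons J (k - l)"
  using assms by (auto simp: mons_def lookup_add sum.distrib kys_add_eq)

text \<open>
  Gaussian elimination of one equation at a time.
\<close>

lemma linear_dependence:
  fixes M :: "'e \<Rightarrow> 'a \<Rightarrow> complex"
  assumes "finite E" "finite A" "card E < card A"
  shows "\<exists>l. (\<exists>a\<in>A. l a \<noteq> 0) \<and> (\<forall>e\<in>E. (\<Sum>a\<in>A. l a * M e a) = 0)"
  using assms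
proof (induction E arbitrary: A M rule: finite_induct)
  case empty
  then have "A \<noteq> {}" by auto
  then show ?case by (intro exI[of _ "\<lambda>_. 1"]) auto
next
  case (insert e E)
  show ?case
  proof (cases "\<forall>a\<in>A. M e a = 0")
    case True
    obtain l where "\<exists>a\<in>A. l a \<noteq> 0" "\<forall>e\<in>E. (\<Sum>a\<in>A. l a * M e a) = 0"
      using insert.IH[of A M] insert.prems insert.hyps by auto
    then show ?thesis using True by (intro exI[of _ l]) auto
  next
    case False
    then obtain p where p: "p \<in> A" "M e p \<noteq> 0" by blast
    let ?A = "A - {p}"
    let ?M = "\<lambda>e' a. M e' a - M e' p * M e a / M e p"
    have "card E < card ?A" using insert p by auto
    then obtain l where l: "\<exists>a\<in>?A. l a \<noteq> 0" "\<forall>e'\<in>E. (\<Sum>a\<in>?A. l a * ?M e' a) = 0"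
      using insert.IH[of ?A ?M] insert.prems by auto
    define l' where "l' = l(p := - (\<Sum>a\<in>?A. l a * M e a) / M e p)"
    have *: "(\<Sum>a\<in>A. l' a * M e' a) = (\<Sum>a\<in>?A. l a * M e' a) - (\<Sum>a\<in>?A. l a * M e a) / M e p * M e' p" for e'
      using sum.remove[of A p "\<lambda>a. l' a * M e' a"] insert.prems p by (auto simp: l'_def intro!: sum.cong)
    have "(\<Sum>a\<in>A. l' a * M e' a) = 0" if "e' \<in> insert e E" for e'
    proof (cases "e' = e")
      case True
      then show ?thesis using * p by simp
    next
      case False
      then have "0 = (\<Sum>a\<in>?A. l a * ?M e' a)" using l that by simp
      also have "\<dots> = (\<Sum>a\<in>?A. l a * M e' a) - (\<Sum>a\<in>?A. l a * M e a) / M e p * M e' p"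
        by (simp add: sum_subtractf sum_distrib_left sum_distrib_right sum_divide_distrib algebra_simps)
      finally show ?thesis using * by simp
    qed
    moreover have "\<exists>a\<in>A. l' a \<noteq> 0" using l(1) by (auto simp: l'_def)
    ultimately show ?thesis by blast
  qed
qed

definition is_ideal :: "'a::comm_ring_1 set \<Rightarrow> bool" where
  "is_ideal I \<longleftrightarrow> 0 \<in> I \<and> (\<forall>x\<in>I. \<forall>y\<in>I. x + y \<in> I) \<and> (\<forall>x\<in>I. \<forall>r. r * x \<in> I)"

lemma is_ideal_sum: "is_ideal I \<Longrightarrow> (\<And>x. x \<in> S \<Longrightarrow> f x \<in> I) \<Longrightarrow> sum f S \<in> I"
  by (induction S rule: infinite_finite_induct) (auto simp: is_ideal_def)

lemma is_ideal_diff: "is_ideal I \<Longrightarrow> x \<in> I \<Longrightarrow> y \<in> I \<Longrightarrow> x - y \<in> I"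
proof -
  assume I: "is_ideal I" "x \<in> I" "y \<in> I"
  then have "x + (-1) * y \<in> I" unfolding is_ideal_def by blast
  then show ?thesis by simp
qed

lemma exists_maximal_ideal:
  assumes "is_ideal I" "(1 :: 'a::comm_ring_1) \<notin> I"
  shows "\<exists>M. is_ideal M \<and> I \<subseteq> M \<and> 1 \<notin> M \<and> (\<forall>g. g \<notin> M \<longrightarrow> (\<exists>h. h * g - 1 \<in> M))"
proof -
  let ?A = "{M. is_ideal M \<and> I \<subseteq> M \<and> 1 \<notin> M}"
  have "\<exists>M\<in>?A. \<forall>X\<in>?A. M \<subseteq> X \<longrightarrow> X = M"
  proof (rule subset_Zorn_nonempty)
    show "?A \<noteq> {}" using assms by blast
    fix C assume C: "C \<noteq> {}" "subset.chain ?A C"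
    then have CA: "\<And>X. X \<in> C \<Longrightarrow> is_ideal X \<and> I \<subseteq> X \<and> 1 \<notin> X"
      and tot: "\<And>X Y. X \<in> C \<Longrightarrow> Y \<in> C \<Longrightarrow> X \<subseteq> Y \<or> Y \<subseteq> X"
      unfolding subset.chain_def by blast+
    have "is_ideal (\<Union>C)" unfolding is_ideal_def
    proof (intro conjI ballI allI)
      show "0 \<in> \<Union>C" using C(1) CA unfolding is_ideal_def by blast
      fix x assume x: "x \<in> \<Union>C"
      show "r * x \<in> \<Union>C" for r using x CA unfolding is_ideal_def by blast
      fix y assume y: "y \<in> \<Union>C"
      obtain X Y where XY: "X \<in> C" "x \<in> X" "Y \<in> C" "y \<in> Y" using x y by blast
      then obtain Z where "Z \<in> C" "x \<in> Z" "y \<in> Z" using tot[of X Y] by blast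
      then show "x + y \<in> \<Union>C" using CA[of Z] unfolding is_ideal_def by blast
    qed
    then show "\<Union>C \<in> ?A" using C(1) CA by blast
  qed
  then obtain M where "M \<in> ?A" and max0: "\<forall>X\<in>?A. M \<subseteq> X \<longrightarrow> X = M" by (rule bexE)
  then have M: "is_ideal M" "I \<subseteq> M" "1 \<notin> M" by simp_all
  have max: "X = M" if "is_ideal X" "I \<subseteq> X" "1 \<notin> X" "M \<subseteq> X" for X
    using max0 that by simp
  have "\<exists>h. h * g - 1 \<in> M" if g: "g \<notin> M" for g
  proof -
    let ?X = "{m + h * g | m h. m \<in> M}"
    have XI: "m + h * g \<in> ?X" if "m \<in> M" for m h using that by blast
    have "is_ideal ?X" unfolding is_ideal_def
    proof (intro conjI ballI allI)
      have "0 \<in> M" using M by (simp add: is_ideal_def)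
      from XI[OF this, of 0] show "0 \<in> ?X" by (simp only: mult_zero_left add_0)
      fix x assume "x \<in> ?X"
      then obtain m h where x: "x = m + h * g" "m \<in> M" by blast
      have "r * x = r * m + (r * h) * g" "r * m \<in> M" for r
        using x M by (simp_all add: algebra_simps is_ideal_def)
      then show "r * x \<in> ?X" for r using XI[of "r * m" "r * h"] by (simp only:)
      fix y assume "y \<in> ?X"
      then obtain m' h' where y: "y = m' + h' * g" "m' \<in> M" by blast
      have "x + y = (m + m') + (h + h') * g" "m + m' \<in> M"
        using x y M by (simp_all add: algebra_simps is_ideal_def)
      then show "x + y \<in> ?X" using XI[of "m + m'" "h + h'"] by (simp only:)
    qed
    moreover have MX: "M \<subseteq> ?X"
    proof
      fix m assume "m \<in> M"
      from XI[OF this, of 0] show "m \<in> ?X" by (simp only: mult_zero_left add_0_right)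
    qed
    moreover have "g \<in> ?X"
    proof -
      have "0 \<in> M" using M by (simp add: is_ideal_def)
      from XI[OF this, of 1] show ?thesis by (simp only: mult_1 add_0)
    qed
    ultimately have "1 \<in> ?X" using max[of ?X] M g by blast
    then obtain m h where mh: "1 = m + h * g" "m \<in> M" by blast
    then have "h * g - 1 = (-1) * m" by (simp add: algebra_simps)
    moreover have "(-1) * m \<in> M" using mh M unfolding is_ideal_def by blast
    ultimately show ?thesis by metis
  qed
  then show ?thesis using M by blast
qed

type_synonym cmpol = "(nat, complex) mpol"

abbreviation Cst :: "'a::comm_ring_1 \<Rightarrow> ('v, 'a) mpol" where "Cst \<equiv> sgl 0"

interpretation Cst: comm_ring_hom "Cst :: 'a::comm_ring_1 \<Rightarrow> ('v, 'a) mpol"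
  by (rule comm_ring_hom_sgl0)

lemma id_hom: "comm_ring_hom (\<lambda>x. x :: 'a::comm_ring_1)"
  by standard auto

lemma lookup_outside: "kys e \<subseteq> S \<Longrightarrow> i \<notin> S \<Longrightarrow> lk e i = 0"
  by (meson in_keys_iff subsetD)

text \<open>
  A countable exhaustion of the exponent vectors by finite sets: this is all that is needed of the fact
  that the polynomial ring has countable dimension.
\<close>

definition ebox :: "nat \<Rightarrow> expo set" where
  "ebox N = {e. kys e \<subseteq> {..N} \<and> (\<Sum>j\<le>N. lk e j) \<le> N}"

lemma finite_ebox: "finite (ebox N)"
proof -
  have "ebox N \<subseteq> (\<Union>k\<le>N. expos N k)" by (auto simp: ebox_def expos_def)
  then show ?thesis by (rule finite_subset) (auto intro: finite_expos)
qed

lemma ebox_mono: "N \<le> N' \<Longrightarrow> ebox N \<subseteq> ebox N'"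
proof
  fix e assume N: "N \<le> N'" and e: "e \<in> ebox N"
  have "(\<Sum>j\<le>N. lk e j) = (\<Sum>j\<le>N'. lk e j)"
  proof (rule sum.mono_neutral_left)
    show "\<forall>i\<in>{..N'} - {..N}. lk e i = 0"
      using e lookup_outside[of e "{..N}"] unfolding ebox_def by blast
  qed (use N in auto)
  then show "e \<in> ebox N'" using N e by (auto simp: ebox_def)
qed

lemma in_some_ebox: "\<exists>N. e \<in> ebox N"
proof -
  let ?N1 = "Max (insert 0 (kys e))"
  let ?N = "max ?N1 (\<Sum>j\<in>kys e. lk e j)"
  have k: "kys e \<subseteq> {..?N}" using Max_ge[of "insert 0 (kys e)"] by (auto simp: le_max_iff_disj)
  then have "(\<Sum>j\<in>kys e. lk e j) = (\<Sum>j\<le>?N. lk e j)"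
    by (intro sum.mono_neutral_left) (auto simp: in_keys_iff)
  then have "(\<Sum>j\<le>?N. lk e j) \<le> ?N" by linarith
  then show ?thesis using k by (auto simp: ebox_def)
qed

lemma finite_subset_some_ebox: "finite K \<Longrightarrow> \<exists>N. K \<subseteq> ebox N"
proof (induction K rule: finite_induct)
  case (insert e K)
  then obtain N N' where "K \<subseteq> ebox N" "e \<in> ebox N'" using in_some_ebox by blast
  then show ?case using ebox_mono[of N "max N N'"] ebox_mono[of N' "max N N'"]
    by (intro exI[of _ "max N N'"]) auto
qed simp

context
  fixes M :: "cmpol set"
  assumes M: "is_ideal M" "1 \<notin> M" and inv: "\<And>g. g \<notin> M \<Longrightarrow> \<exists>h. h * g - 1 \<in> M"
begin

lemma M_Cst: "Cst c \<in> M \<Longrightarrow> c = 0"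
proof (rule ccontr)
  assume c: "Cst c \<in> M" "c \<noteq> 0"
  then have "Cst (1 / c) * Cst c \<in> M" using M unfolding is_ideal_def by blast
  then show False using c M by (simp add: mult_single)
qed

text \<open>
  A nonzero univariate polynomial in \<open>t\<^sub>k\<close> splits into linear factors over the complex numbers, and one
  of them must lie in the maximal ideal \<open>M\<close>.
\<close>

lemma M_linear_factor:
  fixes f :: "complex poly"
  assumes "f \<noteq> 0" "poly (map_poly Cst f) (Var k) \<in> M"
  shows "\<exists>r. Var k - Cst r \<in> M"
  using assms
proof (induction "degree f" arbitrary: f)
  case 0
  then obtain c where "f = [:c:]" by (metis degree_eq_zeroE)
  then show ?case using 0 M_Cst[of c] by (auto simp: map_poly_const)
next
  case (Suc n)
  then have "\<not> constant (poly f)" by (metis constant_degree nat.simps(3))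
  then obtain r where r: "poly f r = 0" using fundamental_theorem_of_algebra by blast
  then obtain g where g: "f = [:- r, 1:] * g" using poly_eq_0_iff_dvd by (metis dvdE)
  interpret h: comm_ring_hom "\<lambda>q. poly (map_poly Cst q) (Var k) :: cmpol"
    by (rule comp_hom[OF poly_eval_hom map_poly_hom[OF comm_ring_hom_sgl0]])
  let ?\<theta> = "\<lambda>q. poly (map_poly Cst q) (Var k) :: cmpol"
  have \<theta>: "?\<theta> f = (Var k - Cst r) * ?\<theta> g"
    unfolding g h.hom_mult by (simp add: map_poly_pCons single_uminus)
  show ?case
  proof (cases "Var k - Cst r \<in> M")
    case False
    then obtain h where h: "h * (Var k - Cst r) - 1 \<in> M" using inv by blast
    have "?\<theta> g = h * ?\<theta> f - ?\<theta> g * (h * (Var k - Cst r) - 1)"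
      unfolding \<theta> by (simp add: algebra_simps)
    moreover have "h * ?\<theta> f \<in> M" "?\<theta> g * (h * (Var k - Cst r) - 1) \<in> M"
      using M Suc.prems(2) h unfolding is_ideal_def by blast+
    ultimately have "?\<theta> g \<in> M" using is_ideal_diff[OF M(1)] by metis
    moreover have "g \<noteq> 0" using Suc.prems(1) g by auto
    moreover from this have "degree g = n"
      using Suc.hyps(2) unfolding g by (subst (asm) degree_mult_eq) auto
    ultimately show ?thesis using Suc.hyps(1)[of g] by auto
  qed blast
qed

text \<open>
  If no \<open>t\<^sub>k - a\<close> were in \<open>M\<close>, all of them would have inverses \<open>q\<^sub>a\<close> modulo \<open>M\<close>. These are uncountably
  many elements of a space of countable dimension, so infinitely many of them lie in one space of
  finite dimension and satisfy a linear relation. Clearing denominators turns the relation into a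
  nonzero univariate polynomial in \<open>M\<close>.
\<close>

lemma M_coordinate: "\<exists>r. Var k - Cst r \<in> M"
proof (rule ccontr)
  assume "\<nexists>r. Var k - Cst r \<in> M"
  then have "\<forall>a :: real. \<exists>q. q * (Var k - Cst (of_real a)) - 1 \<in> M" using inv by blast
  then obtain q where q: "\<And>a :: real. q a * (Var k - Cst (of_real a)) - 1 \<in> M" by metis
  have "(\<Union>N. {a. kys (q a) \<subseteq> ebox N}) = UNIV"
    using finite_subset_some_ebox[OF finite_keys] by auto
  then have "\<not> (\<forall>N. finite {a. kys (q a) \<subseteq> ebox N})"
    using uncountable_UNIV_real countable_UN[of UNIV "\<lambda>N. {a. kys (q a) \<subseteq> ebox N}"]
    by (auto dest: countable_finite)
  then obtain N where "infinite {a. kys (q a) \<subseteq> ebox N}" by blast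
  then obtain A where A: "finite A" "card A = Suc (card (ebox N))" "A \<subseteq> {a. kys (q a) \<subseteq> ebox N}"
    by (meson infinite_arbitrarily_large)
  obtain l where l: "\<exists>a\<in>A. l a \<noteq> 0" "\<forall>e\<in>ebox N. (\<Sum>a\<in>A. l a * lk (q a) e) = 0"
    using linear_dependence[of "ebox N" A "\<lambda>e a. lk (q a) e"] A finite_ebox by auto
  have lq: "(\<Sum>a\<in>A. Cst (l a) * q a) = 0"
  proof (rule poly_mapping_eqI)
    fix e
    have "lk (Cst c * p) e = c * lk p e" for c and p :: cmpol
      by (simp flip: mult_map_scale_conv_mult add: map.rep_eq when_def)
    then have "lk (\<Sum>a\<in>A. Cst (l a) * q a) e = (\<Sum>a\<in>A. l a * lk (q a) e)"
      by (simp add: lookup_sum)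
    also have "\<dots> = 0"
    proof (cases "e \<in> ebox N")
      case False
      then have "lk (q a) e = 0" if "a \<in> A" for a using A(3) that lookup_outside[of "q a" "ebox N"] by blast
      then show ?thesis by simp
    qed (use l in blast)
    finally show "lk (\<Sum>a\<in>A. Cst (l a) * q a) e = lk 0 e" by simp
  qed
  \<comment> \<open>The linear relation between the inverses of \<open>t\<^sub>k - a\<close>, with denominators cleared.\<close>
  define f where "f = (\<Sum>a\<in>A. Polynomial.smult (l a) (\<Prod>b\<in>A - {a}. [:- of_real b, 1:]))"
  obtain a0 where a0: "a0 \<in> A" "l a0 \<noteq> 0" using l by blast
  have "poly f (of_real a0) = (\<Sum>a\<in>A. l a * (\<Prod>b\<in>A - {a}. of_real a0 - of_real b))"
    by (simp add: f_def poly_sum poly_prod)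
  also have "\<dots> = (\<Sum>a\<in>{a0}. l a * (\<Prod>b\<in>A - {a}. of_real a0 - of_real b))"
    using A a0 by (intro sum.mono_neutral_right) auto
  also have "\<dots> \<noteq> 0" using A a0 by auto
  finally have "f \<noteq> 0" by auto
  interpret h: comm_ring_hom "\<lambda>q. poly (map_poly Cst q) (Var k) :: cmpol"
    by (rule comp_hom[OF poly_eval_hom map_poly_hom[OF comm_ring_hom_sgl0]])
  let ?\<theta> = "\<lambda>q. poly (map_poly Cst q) (Var k) :: cmpol"
  let ?X = "\<lambda>b :: real. Var k - Cst (of_real b) :: cmpol"
  have \<theta>X: "?\<theta> [:- of_real b, 1:] = ?X b" for b
    by (simp add: map_poly_pCons single_uminus)
  have "?\<theta> (Polynomial.smult c p) = Cst c * ?\<theta> p" for c p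
    using h.hom_mult[of "[:c:]" p] by (simp add: map_poly_const)
  then have "?\<theta> f = (\<Sum>a\<in>A. Cst (l a) * (\<Prod>b\<in>A - {a}. ?X b))"
    unfolding f_def by (simp add: h.hom_sum h.hom_prod \<theta>X del: map_poly_pCons)
  also have "\<dots> = (\<Sum>a\<in>A. Cst (l a) * q a) * (\<Prod>b\<in>A. ?X b)
      - (\<Sum>a\<in>A. (Cst (l a) * (\<Prod>b\<in>A - {a}. ?X b)) * (q a * ?X a - 1))"
  proof -
    have split: "(\<Prod>b\<in>A. ?X b) = ?X a * (\<Prod>b\<in>A - {a}. ?X b)" if "a \<in> A" for a
      using that A by (intro prod.remove) auto
    have cancel: "u * w * (X * P) - (u * P) * (w * X - 1) = u * P" for u w X P :: cmpol
      by (simp add: algebra_simps)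
    have "Cst (l a) * q a * (\<Prod>b\<in>A. ?X b) - (Cst (l a) * (\<Prod>b\<in>A - {a}. ?X b)) * (q a * ?X a - 1)
        = Cst (l a) * (\<Prod>b\<in>A - {a}. ?X b)" if "a \<in> A" for a
      using that unfolding split[OF that] by (rule_tac cancel)
    then show ?thesis by (simp add: sum_distrib_right flip: sum_subtractf)
  qed
  also have "\<dots> \<in> M"
    unfolding lq using M(1) q by (intro is_ideal_diff is_ideal_sum) (auto simp: is_ideal_def)
  finally show False using M_linear_factor[OF \<open>f \<noteq> 0\<close>] \<open>\<nexists>r. Var k - Cst r \<in> M\<close> by blast
qed

text \<open>
  The coordinates are congruent to constants modulo \<open>M\<close>, hence so is every polynomial.
\<close>

lemma M_point: "\<exists>z. \<forall>g\<in>M. ins (\<lambda>x. x) z g = 0"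
proof -
  obtain z where z: "\<And>k. Var k - Cst (z k) \<in> M" using M_coordinate by metis
  interpret e: comm_ring_hom "ins (\<lambda>x. x) z :: cmpol \<Rightarrow> complex" by (rule ins_hom[OF id_hom])
  let ?e = "ins (\<lambda>x. x) z :: cmpol \<Rightarrow> complex"
  have "g - Cst (?e g) \<in> M" for g
  proof -
    let ?B = "{g. g - Cst (?e g) \<in> M}"
    have "ins Cst Var g \<in> ?B"
    proof (rule ins_closed[OF comm_ring_hom_sgl0])
      fix x y assume xy: "x \<in> ?B" "y \<in> ?B"
      have "x + y - Cst (?e (x + y)) = (x - Cst (?e x)) + (y - Cst (?e y))"
        by (simp add: e.hom_add single_add)
      moreover have "\<dots> \<in> M" using xy M(1) unfolding is_ideal_def by blast
      ultimately show "x + y \<in> ?B" unfolding mem_Collect_eq by argo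
      have "x * y - Cst (?e (x * y)) = y * (x - Cst (?e x)) + Cst (?e x) * (y - Cst (?e y))"
        by (simp add: e.hom_mult Cst.hom_mult algebra_simps)
      moreover have "\<dots> \<in> M" using xy M(1) unfolding is_ideal_def by blast
      ultimately show "x * y \<in> ?B" unfolding mem_Collect_eq by argo
    next
      show "Cst c \<in> ?B" for c using M by (simp add: ins_single[OF id_hom] is_ideal_def)
      show "Var v \<in> ?B" for v using z by (simp add: ins_Var[OF id_hom])
    qed (use M in \<open>auto simp: is_ideal_def e.hom_one e.hom_zero\<close>)
    then show ?thesis by (simp add: ins_id_general)
  qed
  then have "?e g = 0" if "g \<in> M" for g
    using is_ideal_diff[OF M(1) that, of "g - Cst (?e g)"] M_Cst[of "?e g"] by simp
  then show ?thesis by blast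
qed

end

theorem weak_nullstellensatz:
  fixes I :: "cmpol set"
  assumes "is_ideal I" "1 \<notin> I"
  shows "\<exists>z. \<forall>g\<in>I. ins (\<lambda>x. x) z g = 0"
proof -
  obtain M where M: "is_ideal M" "I \<subseteq> M" "1 \<notin> M" "\<And>g. g \<notin> M \<Longrightarrow> \<exists>h. h * g - 1 \<in> M"
    using exists_maximal_ideal[OF assms] by blast
  then show ?thesis using M_point[of M] by blast
qed

definition form_poly :: "nat set \<Rightarrow> nat \<Rightarrow> (expo \<Rightarrow> 'a::comm_ring_1) \<Rightarrow> (nat, 'a) mpol" where
  "form_poly J k a = (\<Sum>c\<in>mons J k. sgl c (a c))"

lemma ins_form_poly: "ins (\<lambda>x. x) z (form_poly J k a) = form_val J k a z"
  by (simp add: form_poly_def form_val_def ins_sum[OF id_hom] ins_single[OF id_hom])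

text \<open>
  The substitution \<open>t\<^sub>v \<mapsto> t\<^sub>v / t\<^sub>j\<close> maps \<open>t\<^sub>j - 1\<close> to zero and each form to itself up to a power of
  \<open>t\<^sub>j\<close>. The polynomials that it sends into the ideal of the forms, up to such a power, form an ideal.
  A zero of this ideal would be a projective zero of the system, so the ideal contains 1.
\<close>

lemma power_of_variable_in_ideal:
  assumes J: "finite J" "j \<in> J" and nz: "\<not> has_zero J d F"
  shows "\<exists>N Q. Var j ^ N = (\<Sum>i\<in>J. Q i * form_poly J (d i) (F i))"
proof -
  define I where "I = {g. \<exists>Q. g = (\<Sum>i\<in>J. Q i * form_poly J (d i) (F i))}"
  have I: "is_ideal I" unfolding is_ideal_def
  proof (intro conjI ballI allI)
    show "0 \<in> I" unfolding I_def by (auto intro: exI[of _ "\<lambda>_. 0"])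
    fix x assume "x \<in> I"
    then obtain Q where x: "x = (\<Sum>i\<in>J. Q i * form_poly J (d i) (F i))" unfolding I_def by blast
    show "r * x \<in> I" for r unfolding I_def x
      by (auto simp: sum_distrib_left mult.assoc intro!: exI[of _ "\<lambda>i. r * Q i"])
    fix y assume "y \<in> I"
    then obtain Q' where y: "y = (\<Sum>i\<in>J. Q' i * form_poly J (d i) (F i))" unfolding I_def by blast
    show "x + y \<in> I" unfolding I_def x y
      by (auto simp: sum.distrib algebra_simps intro!: exI[of _ "\<lambda>i. Q i + Q' i"])
  qed
  have FI: "form_poly J (d i) (F i) \<in> I" if "i \<in> J" for i
  proof -
    have "form_poly J (d i) (F i) = (\<Sum>k\<in>J. (if k = i then 1 else 0) * form_poly J (d k) (F k))"
      using J that by (simp add: if_distrib[of "\<lambda>x. x * _"] sum.delta cong: if_cong)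
    then show ?thesis unfolding I_def by (auto intro: exI[of _ "\<lambda>k. if k = i then 1 else 0"])
  qed
  let ?f = "to_fract :: cmpol \<Rightarrow> cmpol fract"
  let ?X = "?f (Var j)"
  have X0: "?X \<noteq> 0" by (simp add: Var_def keys_eq_empty[symmetric] del: keys_eq_empty)
  have f_hom: "comm_ring_hom ?f" by standard simp_all
  interpret f: comm_ring_hom ?f by (rule f_hom)
  have fC: "comm_ring_hom (\<lambda>c. ?f (Cst c))" by (rule comp_hom[OF f_hom comm_ring_hom_sgl0])
  define \<theta> where "\<theta> = ins (\<lambda>c. ?f (Cst c)) (\<lambda>v. ?f (Var v) / ?X)"
  interpret \<theta>: comm_ring_hom \<theta> unfolding \<theta>_def by (rule ins_hom[OF fC])
  have denom: "\<exists>K p. ?X ^ K * \<theta> g = ?f p" for g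
  proof -
    let ?B = "{y. \<exists>K p. ?X ^ K * y = ?f p}"
    have "\<theta> g \<in> ?B" unfolding \<theta>_def
    proof (rule ins_closed[OF fC])
      fix x y assume "x \<in> ?B" "y \<in> ?B"
      then obtain K p K' p' where xy: "?X ^ K * x = ?f p" "?X ^ K' * y = ?f p'" by blast
      have "?X ^ (K + K') * (x + y) = ?f (Var j ^ K' * p + Var j ^ K * p')"
        by (simp add: f.hom_add f.hom_mult f.hom_power power_add algebra_simps flip: xy)
      then show "x + y \<in> ?B" by blast
      have "?X ^ (K + K') * (x * y) = ?f (p * p')"
        by (simp add: f.hom_mult power_add algebra_simps flip: xy)
      then show "x * y \<in> ?B" by blast
    next
      have *: "?f p \<in> ?B" for p by (auto intro: exI[of _ 0])
      show "0 \<in> ?B" using *[of 0] by simp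
      show "1 \<in> ?B" using *[of 1] by simp
      show "?f (Cst c) \<in> ?B" for c by (rule *)
      show "?f (Var v) / ?X \<in> ?B" for v
        using X0 by (auto intro!: exI[of _ 1] exI[of _ "Var v"])
    qed
    then show ?thesis by blast
  qed
  define B where "B = {g. \<exists>N. \<exists>h\<in>I. ?X ^ N * \<theta> g = ?f h}"
  have "is_ideal B" unfolding is_ideal_def
  proof (intro conjI ballI allI)
    show "0 \<in> B" unfolding B_def using I by (auto simp: is_ideal_def \<theta>.hom_zero intro!: bexI[of _ 0])
    fix x assume "x \<in> B"
    then obtain N h where x: "h \<in> I" "?X ^ N * \<theta> x = ?f h" unfolding B_def by blast
    show "r * x \<in> B" for r
    proof -
      obtain K p where p: "?X ^ K * \<theta> r = ?f p" using denom by blast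
      have "?X ^ (K + N) * \<theta> (r * x) = ?f (p * h)"
        by (simp add: f.hom_mult \<theta>.hom_mult power_add algebra_simps flip: x(2) p)
      moreover have "p * h \<in> I" using I x unfolding is_ideal_def by blast
      ultimately show ?thesis unfolding B_def by blast
    qed
    fix y assume "y \<in> B"
    then obtain N' h' where y: "h' \<in> I" "?X ^ N' * \<theta> y = ?f h'" unfolding B_def by blast
    have "?X ^ (N + N') * \<theta> (x + y) = ?f (Var j ^ N' * h + Var j ^ N * h')"
      by (simp add: f.hom_add f.hom_mult f.hom_power \<theta>.hom_add power_add algebra_simps flip: x(2) y(2))
    moreover have "Var j ^ N' * h + Var j ^ N * h' \<in> I" using I x y unfolding is_ideal_def by blast
    ultimately show "x + y \<in> B" unfolding B_def by blast
  qed
  have "1 \<in> B"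
  proof (rule ccontr)
    assume "1 \<notin> B"
    then obtain z where z: "\<And>g. g \<in> B \<Longrightarrow> ins (\<lambda>x. x) z g = 0"
      using weak_nullstellensatz[OF \<open>is_ideal B\<close>] by blast
    interpret e: comm_ring_hom "ins (\<lambda>x. x) z :: cmpol \<Rightarrow> complex" by (rule ins_hom[OF id_hom])
    have "\<theta> (Var j - 1) = 0"
      using X0 by (simp add: \<theta>.hom_minus \<theta>.hom_one) (simp add: \<theta>_def ins_Var[OF fC])
    then have "Var j - 1 \<in> B" using I unfolding B_def by (auto simp: is_ideal_def intro!: bexI[of _ 0])
    then have zj: "z j = 1"
      using z[of "Var j - 1"] by (simp add: e.hom_minus e.hom_one ins_Var[OF id_hom])
    have "form_val J (d i) (F i) z = 0" if i: "i \<in> J" for i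
    proof -
      have "?X ^ d i * \<theta> (sgl c a) = ?f (sgl c a)" if c: "c \<in> mons J (d i)" for c a
      proof -
        have "?X ^ d i = (\<Prod>v\<in>J. ?X ^ lk c v)" using c by (simp add: mons_def flip: power_sum)
        moreover have "mono_val (\<lambda>v. ?f (Var v) / ?X) c = (\<Prod>v\<in>J. (?f (Var v) / ?X) ^ lk c v)"
          using c J by (intro mono_val_superset) (auto simp: mons_def)
        moreover have "(\<Prod>v\<in>J. ?X ^ lk c v) \<noteq> 0" using X0 J(1) by (simp add: prod_zero_iff)
        ultimately have "?X ^ d i * mono_val (\<lambda>v. ?f (Var v) / ?X) c = (\<Prod>v\<in>J. ?f (Var v) ^ lk c v)"
          using X0 by (simp add: power_divide prod_dividef)
        also have "\<dots> = ?f (\<Prod>v\<in>J. Var v ^ lk c v)" by (simp add: f.hom_prod f.hom_power)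
        also have "(\<Prod>v\<in>J. Var v ^ lk c v) = (mono_val Var c :: cmpol)"
          using c J by (intro mono_val_superset[symmetric]) (auto simp: mons_def)
        finally have *: "?X ^ d i * mono_val (\<lambda>v. ?f (Var v) / ?X) c = ?f (sgl c 1)" by (simp add: mono_val_Var)
        have "?X ^ d i * \<theta> (sgl c a) = ?f (Cst a) * (?X ^ d i * mono_val (\<lambda>v. ?f (Var v) / ?X) c)"
          unfolding \<theta>_def ins_single[OF fC] by (simp add: ac_simps)
        also have "\<dots> = ?f (Cst a * sgl c 1)" unfolding * by (simp add: f.hom_mult)
        finally show ?thesis by (simp add: mult_single)
      qed
      then have "?X ^ d i * \<theta> (form_poly J (d i) (F i)) = ?f (form_poly J (d i) (F i))"
        by (simp add: form_poly_def \<theta>.hom_sum f.hom_sum sum_distrib_left)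
      then have "form_poly J (d i) (F i) \<in> B" using FI[OF i] unfolding B_def by blast
      then show ?thesis using z ins_form_poly by metis
    qed
    moreover have "\<exists>j\<in>J. z j \<noteq> 0" using zj J(2) by (intro bexI[of _ j]) simp_all
    ultimately have "has_zero J d F" unfolding has_zero_def by blast
    then show False using nz by blast
  qed
  then obtain N h where "h \<in> I" "?X ^ N * \<theta> 1 = ?f h" unfolding B_def by blast
  then have "Var j ^ N = h" by (simp add: \<theta>.hom_one flip: f.hom_power)
  then show ?thesis using \<open>h \<in> I\<close> unfolding I_def by blast
qed

lemma lookup_mult_form_poly:
  fixes Q :: "(nat, 'a::comm_ring_1) mpol"
  assumes J: "finite J" and c: "c \<in> mons J \<nu>" and k: "k \<le> \<nu>"
  shows "lk (Q * form_poly J k a) c = (\<Sum>e\<in>mons J (\<nu> - k). lk Q e * shiftc a e c)"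
proof -
  have "Q * form_poly J k a = (\<Sum>e\<in>kys Q. \<Sum>f\<in>mons J k. sgl (e + f) (lk Q e * a f))"
    by (subst monomial_expansion[of Q]) (simp add: form_poly_def sum_product mult_single)
  then have "lk (Q * form_poly J k a) c = (\<Sum>e\<in>kys Q. \<Sum>f\<in>mons J k. if e + f = c then lk Q e * a f else 0)"
    by (simp add: lookup_sum lookup_single when_def)
  also have "\<dots> = (\<Sum>e\<in>kys Q. if e \<in> mons J (\<nu> - k) then lk Q e * shiftc a e c else 0)"
  proof (rule sum.cong[OF refl])
    fix e
    show "(\<Sum>f\<in>mons J k. if e + f = c then lk Q e * a f else 0) = (if e \<in> mons J (\<nu> - k) then lk Q e * shiftc a e c else 0)"
    proof (cases "e \<in> mons J (\<nu> - k) \<and> (\<exists>f. c = e + f)")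
      case True
      then obtain f where f: "c = e + f" by blast
      then have fm: "f \<in> mons J k" using True c k
        mons_add_cancel[of f e J \<nu> "\<nu> - k"] by (simp add: add.commute)
      have "(\<Sum>f\<in>mons J k. if e + f = c then lk Q e * a f else 0) = (\<Sum>g\<in>mons J k. if g = f then lk Q e * a g else 0)"
        using f by (intro sum.cong refl) auto
      then show ?thesis using True fm f J by (auto simp: shiftc_def)
    next
      case False
      have "e + f \<noteq> c" if "f \<in> mons J k" for f
        using False that c mons_add_cancel[of e f J \<nu> k] by auto
      then show ?thesis using False by (auto simp: shiftc_def)
    qed
  qed
  also have "\<dots> = (\<Sum>e\<in>mons J (\<nu> - k). lk Q e * shiftc a e c)"
    using J by (simp add: sum.If_cases flip: sum.inter_restrict)
      (intro sum.mono_neutral_left, auto simp: in_keys_iff)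
  finally show ?thesis .
qed

text \<open>
  In large degree each monomial is divisible by one of the powers \<open>t\<^sub>j\<^bsup>N\<^sub>j\<^esup>\<close> that lie in the ideal; taking
  the components of the right degree of the cofactors gives the coefficients \<open>Q\<close>.
\<close>

theorem no_zero_imp_spanning:
  assumes J: "finite J" and nz: "\<not> has_zero J d F"
  shows "\<exists>\<nu>. (\<forall>i\<in>J. d i \<le> \<nu>) \<and> (\<forall>c\<in>mons J \<nu>. \<exists>Q :: nat \<Rightarrow> expo \<Rightarrow> complex. \<forall>c'\<in>mons J \<nu>.
    (\<Sum>i\<in>J. \<Sum>e\<in>mons J (\<nu> - d i). Q i e * shiftc (F i) e c') = (if c' = c then 1 else 0))"
proof -
  have "\<forall>j\<in>J. \<exists>N Q. Var j ^ N = (\<Sum>i\<in>J. Q i * form_poly J (d i) (F i))"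
    using power_of_variable_in_ideal[OF J _ nz] by blast
  then obtain N Q where NQ: "\<And>j. j \<in> J \<Longrightarrow> Var j ^ N j = (\<Sum>i\<in>J. Q j i * form_poly J (d i) (F i))"
    by metis
  \<comment> \<open>The summand 1 makes the set of monomials empty for empty \<open>J\<close>.\<close>
  define \<nu> where "\<nu> = (\<Sum>j\<in>J. N j) + (\<Sum>j\<in>J. d j) + 1"
  have d: "d i \<le> \<nu>" if "i \<in> J" for i
    using member_le_sum[of i J d] that J by (simp add: \<nu>_def)
  have "\<exists>Q :: nat \<Rightarrow> expo \<Rightarrow> complex. \<forall>c'\<in>mons J \<nu>.
    (\<Sum>i\<in>J. \<Sum>e\<in>mons J (\<nu> - d i). Q i e * shiftc (F i) e c') = (if c' = c then 1 else 0)"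
    if c: "c \<in> mons J \<nu>" for c
  proof -
    have "\<exists>j\<in>J. N j \<le> lk c j"
    proof (rule ccontr)
      assume "\<not> (\<exists>j\<in>J. N j \<le> lk c j)"
      then have "(\<Sum>j\<in>J. lk c j) \<le> (\<Sum>j\<in>J. N j)" by (intro sum_mono) (auto simp: not_le less_imp_le)
      then show False using c by (simp add: mons_def \<nu>_def)
    qed
    then obtain j where j: "j \<in> J" "N j \<le> lk c j" by blast
    let ?m = "sgl (c - sgl j (N j)) 1 :: cmpol"
    have "c = (c - sgl j (N j)) + sgl j (N j)"
      using j by (intro poly_mapping_eqI) (auto simp: lookup_add lookup_minus lookup_single when_def)
    then have "sgl c 1 = ?m * sgl (sgl j (N j)) 1" by (simp add: mult_single)
    also have "sgl (sgl j (N j)) 1 = (Var j ^ N j :: cmpol)"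
      by (simp flip: mono_val_Var)
    finally have eq: "sgl c 1 = (\<Sum>i\<in>J. (?m * Q j i) * form_poly J (d i) (F i))"
      using NQ[OF j(1)] by (simp add: sum_distrib_left mult.assoc)
    have "(\<Sum>i\<in>J. \<Sum>e\<in>mons J (\<nu> - d i). lk (?m * Q j i) e * shiftc (F i) e c') = (if c' = c then 1 else 0)"
      if c': "c' \<in> mons J \<nu>" for c'
    proof -
      have "(\<Sum>i\<in>J. \<Sum>e\<in>mons J (\<nu> - d i). lk (?m * Q j i) e * shiftc (F i) e c')
          = (\<Sum>i\<in>J. lk ((?m * Q j i) * form_poly J (d i) (F i)) c')"
        by (intro sum.cong refl) (rule lookup_mult_form_poly[OF J c' d, symmetric])
      also have "\<dots> = lk (sgl c 1 :: cmpol) c'" unfolding eq by (simp add: lookup_sum)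
      finally show ?thesis by (auto simp: lookup_single when_def)
    qed
    then show ?thesis by (intro exI[of _ "\<lambda>i e. lk (?m * Q j i) e"] ballI)
  qed
  then show ?thesis using d by blast
qed

section \<open>Determinants indexed by finite sets\<close>

text \<open>
  Determinants of matrices indexed by a finite set. The ordering of the index type only serves to
  list the set and does not influence the value.
\<close>

abbreviation idet :: "'i::linorder set \<Rightarrow> ('i \<Rightarrow> 'i \<Rightarrow> 'a::comm_ring_1) \<Rightarrow> 'a" where
  "idet S a \<equiv> det (indexed_mat S a)"

definition list_mat :: "'i list \<Rightarrow> ('i \<Rightarrow> 'i \<Rightarrow> 'a) \<Rightarrow> 'a mat" where
  "list_mat xs a = mat (length xs) (length xs) (\<lambda>(k, l). a (xs ! k) (xs ! l))"

lemma indexed_mat_list: "indexed_mat S a = list_mat (sorted_list_of_set S) a"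
  by (simp add: indexed_mat_def list_mat_def)

lemma list_mat_carrier [simp]: "list_mat xs a \<in> carrier_mat (length xs) (length xs)"
  by (simp add: list_mat_def)

text \<open>
  Rows and columns are permuted in the same way, so the sign of the permutation occurs twice.
\<close>

lemma det_list_mat_reorder:
  assumes "mset xs = mset ys"
  shows "det (list_mat xs a) = det (list_mat ys a)"
proof -
  let ?n = "length ys"
  obtain p where p: "p permutes {..<?n}" "permute_list p ys = xs"
    using mset_eq_permutation[OF assms] by blast
  have len: "length xs = ?n" using assms by (metis size_mset)
  have p0: "p permutes {0..<?n}" using p(1) by (simp add: atLeast0LessThan)
  have pl: "p i < ?n" if "i < ?n" for i using p(1) that permutes_in_image by fastforce
  have xs: "xs ! i = ys ! p i" if "i < ?n" for i
    using p that permute_list_nth by metis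
  let ?A = "mat ?n ?n (\<lambda>(i, j). a (ys ! i) (ys ! p j))"
  let ?B = "list_mat ys a"
  have "list_mat xs a = mat ?n ?n (\<lambda>(i, j). ?A $$ (p i, j))"
    using len by (intro eq_matI) (auto simp: list_mat_def xs pl)
  then have "det (list_mat xs a) = signof p * det ?A"
    by (simp add: det_permute_rows[OF _ p0])
  also have "det ?A = det (transpose_mat ?A)" by (rule det_transpose[symmetric, of _ ?n]) simp
  also have "transpose_mat ?A = mat ?n ?n (\<lambda>(i, j). transpose_mat ?B $$ (p i, j))"
    by (intro eq_matI) (auto simp: list_mat_def pl)
  also have "det \<dots> = signof p * det (transpose_mat ?B)"
    by (rule det_permute_rows[OF _ p0]) simp
  also have "det (transpose_mat ?B) = det ?B" by (rule det_transpose[of _ ?n]) simp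
  finally show ?thesis by (simp add: sign_def)
qed

text \<open>
  The freedom in the listing makes block decompositions and reindexing easy.
\<close>

lemma idet_list:
  assumes "distinct xs" "set xs = S"
  shows "idet S a = det (list_mat xs a)"
proof -
  have "mset (sorted_list_of_set S) = mset xs"
    using assms by (metis distinct_sorted_list_of_set finite_set set_eq_iff_mset_eq_distinct set_sorted_list_of_set)
  then show ?thesis unfolding indexed_mat_list by (rule det_list_mat_reorder)
qed

lemma list_mat_cong:
  "(\<And>c c'. c \<in> set xs \<Longrightarrow> c' \<in> set xs \<Longrightarrow> a c c' = b c c') \<Longrightarrow> list_mat xs a = list_mat xs b"
  by (intro eq_matI) (auto simp: list_mat_def)

lemma idet_cong:
  assumes "finite S" "\<And>c c'. c \<in> S \<Longrightarrow> c' \<in> S \<Longrightarrow> a c c' = b c c'"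
  shows "idet S a = idet S b"
  using list_mat_cong[of "sorted_list_of_set S" a b] assms by (simp add: indexed_mat_list)

lemma idet_empty [simp]: "idet {} a = 1"
  by (simp add: indexed_mat_def)

lemma idet_hom:
  assumes "comm_ring_hom h"
  shows "h (idet S a) = idet S (\<lambda>c c'. h (a c c'))"
proof -
  interpret h: comm_ring_hom h by (rule assms)
  have "h (idet S a) = det (map_mat h (indexed_mat S a))" by simp
  also have "map_mat h (indexed_mat S a) = indexed_mat S (\<lambda>c c'. h (a c c'))"
    by (intro eq_matI) (auto simp: indexed_mat_def)
  finally show ?thesis .
qed

lemma idet_block:
  fixes a :: "'i::linorder \<Rightarrow> 'i \<Rightarrow> 'a::idom"
  assumes S: "finite S1" "finite S2" "S1 \<inter> S2 = {}"
    and zero: "\<And>c c'. c \<in> S1 \<Longrightarrow> c' \<in> S2 \<Longrightarrow> a c c' = 0"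
  shows "idet (S1 \<union> S2) a = idet S1 a * idet S2 a"
proof -
  let ?x = "sorted_list_of_set S1" and ?y = "sorted_list_of_set S2"
  let ?n = "length ?x" and ?m = "length ?y"
  let ?A3 = "mat ?m ?n (\<lambda>(i, j). a (?y ! i) (?x ! j))"
  have mem: "?x ! i \<in> S1" if "i < ?n" for i using that S nth_mem[of i ?x] by simp
  have mem': "?y ! i \<in> S2" if "i < ?m" for i using that S nth_mem[of i ?y] by simp
  have "idet (S1 \<union> S2) a = det (list_mat (?x @ ?y) a)"
    using S by (intro idet_list) auto
  also have "list_mat (?x @ ?y) a = four_block_mat (list_mat ?x a) (0\<^sub>m ?n ?m) ?A3 (list_mat ?y a)"
  proof (intro eq_matI)
    fix i j
    assume "i < dim_row (four_block_mat (list_mat ?x a) (0\<^sub>m ?n ?m) ?A3 (list_mat ?y a))"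
      "j < dim_col (four_block_mat (list_mat ?x a) (0\<^sub>m ?n ?m) ?A3 (list_mat ?y a))"
    then have ij: "i < ?n + ?m" "j < ?n + ?m" by (simp_all add: list_mat_def)
    have "a (?x ! i) (?y ! (j - ?n)) = 0" if "i < ?n" "\<not> j < ?n"
      using that ij by (intro zero mem mem') auto
    then show "list_mat (?x @ ?y) a $$ (i, j)
        = four_block_mat (list_mat ?x a) (0\<^sub>m ?n ?m) ?A3 (list_mat ?y a) $$ (i, j)"
      using ij by (auto simp: list_mat_def nth_append)
  qed (auto simp: list_mat_def)
  also have "det \<dots> = det (list_mat ?x a) * det (list_mat ?y a)"
    by (rule det_four_block_mat_upper_right_zero[OF list_mat_carrier refl _ list_mat_carrier]) simp
  finally show ?thesis by (simp add: indexed_mat_list)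
qed

lemma idet_identity:
  assumes "finite S" "\<And>c c'. c \<in> S \<Longrightarrow> c' \<in> S \<Longrightarrow> a c c' = (if c' = c then 1 else 0)"
  shows "idet S a = 1"
proof -
  let ?xs = "sorted_list_of_set S"
  have "list_mat ?xs a = 1\<^sub>m (length ?xs)"
  proof (intro eq_matI)
    fix i j assume "i < dim_row (1\<^sub>m (length ?xs))" "j < dim_col (1\<^sub>m (length ?xs))"
    then have ij: "i < length ?xs" "j < length ?xs" by simp_all
    then have "?xs ! i \<in> S" "?xs ! j \<in> S" using assms(1) nth_mem[of _ ?xs] by auto
    then show "list_mat ?xs a $$ (i, j) = 1\<^sub>m (length ?xs) $$ (i, j)"
      using ij assms by (auto simp: list_mat_def nth_eq_iff_index_eq)
  qed (auto simp: list_mat_def)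
  then show ?thesis by (simp add: indexed_mat_list)
qed

lemma idet_kernel:
  fixes a :: "'i::linorder \<Rightarrow> 'i \<Rightarrow> 'a::idom"
  assumes S: "finite S" and v: "c0 \<in> S" "v c0 \<noteq> 0"
    and zero: "\<And>c. c \<in> S \<Longrightarrow> (\<Sum>c'\<in>S. a c c' * v c') = 0"
  shows "idet S a = 0"
proof -
  let ?xs = "sorted_list_of_set S"
  let ?n = "length ?xs" and ?A = "list_mat ?xs a"
  let ?v = "vec ?n (\<lambda>i. v (?xs ! i))"
  have bij: "bij_betw (\<lambda>i. ?xs ! i) {0..<?n} S"
    using S by (intro bij_betw_nth) auto
  have "?v \<noteq> 0\<^sub>v ?n"
  proof
    assume eq: "?v = 0\<^sub>v ?n"
    obtain i where i: "i < ?n" "?xs ! i = c0" using S v(1) by (metis in_set_conv_nth set_sorted_list_of_set)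
    then have "?v $ i = 0" using eq by simp
    then show False using i v by simp
  qed
  moreover have "?A *\<^sub>v ?v = 0\<^sub>v ?n"
  proof (rule eq_vecI)
    fix i assume "i < dim_vec (0\<^sub>v ?n :: 'a vec)"
    then have i: "i < ?n" by simp
    have "(?A *\<^sub>v ?v) $ i = (\<Sum>j = 0..<?n. a (?xs ! i) (?xs ! j) * v (?xs ! j))"
      using i by (simp add: list_mat_def scalar_prod_def)
    also have "\<dots> = (\<Sum>c'\<in>S. a (?xs ! i) c' * v c')"
      by (rule sum.reindex_bij_betw[OF bij])
    also have "\<dots> = 0" using i S nth_mem[of i ?xs] by (intro zero) auto
    finally show "(?A *\<^sub>v ?v) $ i = 0\<^sub>v ?n $ i" using i by simp
  qed (simp add: list_mat_def)
  moreover have "?v \<in> carrier_vec ?n" by simp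
  ultimately have "det ?A = 0"
    using det_0_iff_vec_prod_zero[OF list_mat_carrier, of ?xs a] by blast
  then show ?thesis by (simp add: indexed_mat_list)
qed

lemma idet_reindex:
  assumes "finite S" "inj_on f S"
  shows "idet (f ` S) a = idet S (\<lambda>c c'. a (f c) (f c'))"
proof -
  let ?xs = "sorted_list_of_set S"
  have "idet (f ` S) a = det (list_mat (map f ?xs) a)"
    using assms by (intro idet_list) (auto simp: distinct_map)
  also have "list_mat (map f ?xs) a = list_mat ?xs (\<lambda>c c'. a (f c) (f c'))"
    by (intro eq_matI) (auto simp: list_mat_def)
  finally show ?thesis by (simp add: indexed_mat_list)
qed

lemma det_list_mat_leibniz:
  "det (list_mat xs a) = (\<Sum>p | p permutes {0..<length xs}.
     signof p * (\<Prod>i = 0..<length xs. a (xs ! i) (xs ! p i)))"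
proof -
  have "(\<Prod>i = 0..<length xs. list_mat xs a $$ (i, p i)) = (\<Prod>i = 0..<length xs. a (xs ! i) (xs ! p i))"
    if "p permutes {0..<length xs}" for p
    using permutes_in_image[OF that] by (intro prod.cong refl) (auto simp: list_mat_def)
  then show ?thesis by (simp add: det_def'[OF list_mat_carrier])
qed

lemma idet_scale_rows:
  assumes "finite S"
  shows "idet S (\<lambda>c c'. s c * a c c') = (\<Prod>c\<in>S. s c) * idet S a"
proof -
  let ?xs = "sorted_list_of_set S"
  have bij: "bij_betw (\<lambda>i. ?xs ! i) {0..<length ?xs} S"
    using assms by (intro bij_betw_nth) auto
  have "(\<Prod>i = 0..<length ?xs. s (?xs ! i)) = (\<Prod>c\<in>S. s c)"
    by (rule prod.reindex_bij_betw[OF bij])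
  then show ?thesis
    by (simp add: indexed_mat_list det_list_mat_leibniz prod.distrib sum_distrib_left ac_simps)
qed

lemma idet_row_linear:
  assumes "finite S" "c0 \<in> S" "finite K"
  shows "idet S (a(c0 := \<lambda>c'. \<Sum>k\<in>K. q k * r k c')) = (\<Sum>k\<in>K. q k * idet S (a(c0 := r k)))"
proof -
  let ?xs = "sorted_list_of_set S"
  let ?n = "length ?xs"
  obtain i0 where i0: "i0 < ?n" "?xs ! i0 = c0" using assms by (metis in_set_conv_nth set_sorted_list_of_set)
  have ne: "?xs ! i \<noteq> c0" if "i \<in> {0..<?n} - {i0}" for i
    using that i0 by (metis Diff_iff atLeastLessThan_iff distinct_sorted_list_of_set insertI1 nth_eq_iff_index_eq)
  have prod: "(\<Prod>i = 0..<?n. (a(c0 := f)) (?xs ! i) (?xs ! p i))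
      = f (?xs ! p i0) * (\<Prod>i\<in>{0..<?n} - {i0}. a (?xs ! i) (?xs ! p i))" for f p
    using i0 ne by (subst prod.remove[of _ i0]) auto
  show ?thesis
    unfolding indexed_mat_list det_list_mat_leibniz prod
    by (simp add: sum_distrib_left sum_distrib_right ac_simps) (rule sum.swap)
qed

lemma idet_closed:
  assumes S: "finite S"
    and B: "\<And>x y. x \<in> B \<Longrightarrow> y \<in> B \<Longrightarrow> x + y \<in> B" "\<And>x y. x \<in> B \<Longrightarrow> y \<in> B \<Longrightarrow> x * y \<in> B"
    "0 \<in> B" "1 \<in> B" "-1 \<in> B"
    and a: "\<And>c c'. c \<in> S \<Longrightarrow> c' \<in> S \<Longrightarrow> a c c' \<in> B"
  shows "idet S a \<in> B"
proof -
  let ?xs = "sorted_list_of_set S"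
  have sum: "sum f T \<in> B" if "\<And>x. x \<in> T \<Longrightarrow> f x \<in> B" for f and T :: "(nat \<Rightarrow> nat) set"
    using that B by (induction T rule: infinite_finite_induct) auto
  have prod: "prod f T \<in> B" if "\<And>x. x \<in> T \<Longrightarrow> f x \<in> B" for f and T :: "nat set"
    using that B by (induction T rule: infinite_finite_induct) auto
  have mem: "?xs ! i \<in> S" if "i < length ?xs" for i using that S nth_mem[of i ?xs] by simp
  have "signof p \<in> B" for p :: "nat \<Rightarrow> nat" using B by (auto simp: sign_def)
  moreover have "p i < length ?xs" if "p permutes {0..<length ?xs}" "i < length ?xs" for p i
    using permutes_in_image[OF that(1)] that(2) by auto
  ultimately show ?thesis unfolding indexed_mat_list det_list_mat_leibniz
    by (intro sum B(2) prod a mem) auto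
qed

text \<open>
  The rows of the identity matrix are exchanged one by one: each unit row is a combination of the given
  rows, so by linearity in this row some given row keeps the determinant nonzero.
\<close>

lemma nonzero_minor_from_span:
  fixes r :: "'k \<Rightarrow> 'i::linorder \<Rightarrow> 'a::idom"
  assumes S: "finite S" and K: "finite K"
    and span: "\<And>c. c \<in> S \<Longrightarrow> \<exists>q. \<forall>c'\<in>S. (\<Sum>k\<in>K. q k * r k c') = (if c' = c then 1 else 0)"
  shows "\<exists>\<phi>. (\<forall>c\<in>S. \<phi> c \<in> K) \<and> idet S (\<lambda>c. r (\<phi> c)) \<noteq> 0"
proof -
  define A where "A T \<phi> = (\<lambda>c. if c \<in> T then r (\<phi> c) else (\<lambda>c'. if c' = c then 1 else 0))" for T \<phi>
  have "\<exists>\<phi>. (\<forall>c\<in>T. \<phi> c \<in> K) \<and> idet S (A T \<phi>) \<noteq> 0" if "finite T" "T \<subseteq> S" for T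
    using that
  proof (induction T rule: finite_induct)
    case empty
    have "idet S (A {} undefined) = 1" using S by (intro idet_identity) (auto simp: A_def)
    then show ?case by (intro exI[of _ undefined]) simp
  next
    case (insert c0 T)
    then obtain \<phi> where \<phi>: "\<forall>c\<in>T. \<phi> c \<in> K" "idet S (A T \<phi>) \<noteq> 0" by auto
    obtain q where q: "\<forall>c'\<in>S. (\<Sum>k\<in>K. q k * r k c') = (if c' = c0 then 1 else 0)"
      using span[of c0] insert by auto
    have "idet S (A T \<phi>) = idet S ((A T \<phi>)(c0 := \<lambda>c'. \<Sum>k\<in>K. q k * r k c'))"
      using S q insert.hyps by (intro idet_cong) (auto simp: A_def)
    also have "\<dots> = (\<Sum>k\<in>K. q k * idet S ((A T \<phi>)(c0 := r k)))"
      using insert by (intro idet_row_linear S K) auto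
    finally have "(\<Sum>k\<in>K. q k * idet S ((A T \<phi>)(c0 := r k))) \<noteq> 0" using \<phi> by simp
    then obtain k where k: "k \<in> K" "idet S ((A T \<phi>)(c0 := r k)) \<noteq> 0"
      by (metis (no_types, lifting) mult_zero_right sum.neutral)
    have "(A T \<phi>)(c0 := r k) = A (insert c0 T) (\<phi>(c0 := k))"
      using insert.hyps by (auto simp: A_def fun_eq_iff)
    then have "idet S (A (insert c0 T) (\<phi>(c0 := k))) \<noteq> 0" using k(2) by metis
    moreover have "\<forall>c\<in>insert c0 T. (\<phi>(c0 := k)) c \<in> K" using k(1) \<phi>(1) by auto
    ultimately show ?case by blast
  qed
  from this[OF S] obtain \<phi> where \<phi>: "\<forall>c\<in>S. \<phi> c \<in> K" "idet S (A S \<phi>) \<noteq> 0" by auto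
  moreover have "idet S (A S \<phi>) = idet S (\<lambda>c. r (\<phi> c))"
    using S by (intro idet_cong) (auto simp: A_def)
  ultimately show ?thesis by auto
qed

section \<open>Inertia forms\<close>

type_synonym cring = "(uvar, int) mpol"

lemma has_zeroI:
  assumes "j \<in> J" "z j \<noteq> 0" "\<And>i. i \<in> J \<Longrightarrow> form_val J (d i) (F i) z = 0"
  shows "has_zero J d F"
  unfolding has_zero_def using assms by blast

definition at_coeffs :: "(nat \<Rightarrow> expo \<Rightarrow> 'a) \<Rightarrow> uvar \<Rightarrow> 'a" where
  "at_coeffs F = (\<lambda>v. case v of U i c \<Rightarrow> F i c)"

lemma at_coeffs_U [simp]: "at_coeffs F (U i c) = F i c"
  by (simp add: at_coeffs_def)

lemma at_coeffs_decomp: "a = at_coeffs (\<lambda>i c. a (U i c))"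
  by (auto simp: fun_eq_iff at_coeffs_def split: uvar.split)

text \<open>
  The terminology is that of elimination theory: these are the inertia forms of the general system.
\<close>

definition inertia :: "nat set \<Rightarrow> (nat \<Rightarrow> nat) \<Rightarrow> cring set" where
  "inertia J d = {f. \<forall>F. has_zero J d F \<longrightarrow> ev (at_coeffs F) f = 0}"

lemma inertia_comb: "f \<in> inertia J d \<Longrightarrow> g \<in> inertia J d \<Longrightarrow> \<alpha> * f + \<beta> * g \<in> inertia J d"
  by (simp add: inertia_def ev.hom_add ev.hom_mult)

lemma hom_form_val:
  assumes "comm_ring_hom h"
  shows "h (form_val J k a z) = form_val J k (\<lambda>c. h (a c)) (\<lambda>j. h (z j))"
proof -
  interpret h: comm_ring_hom h by (rule assms)
  show ?thesis by (simp add: form_val_def h.hom_sum h.hom_mult mono_val_def h.hom_prod h.hom_power)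
qed

lemma hom_at_coeffs: "(\<lambda>v. h (at_coeffs F v)) = at_coeffs (\<lambda>i c. h (F i c))"
  by (auto simp: fun_eq_iff at_coeffs_def split: uvar.split)

lemma poly_ev_at_coeffs: "poly (ev (at_coeffs F) f) s = ev (at_coeffs (\<lambda>i c. poly (F i c) s)) f"
  for s :: "'a::comm_ring_1"
  using hom_ev[OF poly_eval_hom[of s], of "at_coeffs F" f] by (simp add: hom_at_coeffs[of "\<lambda>p. poly p s"])

lemma poly_form_val: "poly (form_val J k a z) s = form_val J k (\<lambda>c. poly (a c) s) (\<lambda>j. poly (z j) s)"
  for s :: "'a::comm_ring_1"
  by (rule hom_form_val[OF poly_eval_hom])

lemma form_val_pure:
  assumes "finite J" "j \<in> J"
  shows "form_val J k (\<lambda>c. if c = sgl j k then x else 0) z = x * z j ^ k"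
proof -
  have "sgl j k \<in> mons J k" using assms by (auto simp: mons_def lookup_single when_def)
  then show ?thesis using assms
    by (simp add: form_val_def if_distrib[of "\<lambda>x. x * _"] sum.delta cong: if_cong)
qed

lemma form_val_lin: "form_val J k (\<lambda>c. x * a c - y * b c) z = x * form_val J k a z - y * form_val J k b z"
  by (simp add: form_val_def left_diff_distrib sum_subtractf sum_distrib_left mult.assoc)

lemma form_val_add: "form_val J k (\<lambda>c. a c + b c) z = form_val J k a z + form_val J k b z"
  by (simp add: form_val_def distrib_right sum.distrib)

lemma form_val_scale: "form_val J k (\<lambda>c. a c / (x :: complex)) z = form_val J k a z / x"
  by (simp add: form_val_def sum_divide_distrib)

text \<open>
  A pure power of a variable, or a sum of two of them.
\<close>

lemma form_nonzero_at_two_points: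
  fixes z1 z2 :: "nat \<Rightarrow> complex"
  assumes J: "finite J" and z: "j1 \<in> J" "z1 j1 \<noteq> 0" "j2 \<in> J" "z2 j2 \<noteq> 0" and k: "0 < k"
  shows "\<exists>h. form_val J k h z1 \<noteq> 0 \<and> form_val J k h z2 \<noteq> 0"
proof -
  let ?h = "\<lambda>j c. if c = sgl j k then 1 else 0 :: complex"
  have v: "form_val J k (?h j) z = z j ^ k" if "j \<in> J" for j z
    using form_val_pure[OF J that, of k 1 z] by simp
  consider "z2 j1 \<noteq> 0" | "z1 j2 \<noteq> 0" | "z2 j1 = 0" "z1 j2 = 0" by blast
  then show ?thesis
  proof cases
    case 1
    then show ?thesis using z v by (intro exI[of _ "?h j1"]) simp
  next
    case 2
    then show ?thesis using z v by (intro exI[of _ "?h j2"]) simp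
  next
    case 3
    then show ?thesis using z v k
      by (intro exI[of _ "\<lambda>c. ?h j1 c + ?h j2 c"]) (simp add: form_val_add zero_power)
  qed
qed

text \<open>
  Suppose that \<open>f\<close> and \<open>g\<close> do not vanish at two systems \<open>F1\<close> and \<open>F2\<close> with zeros \<open>z1\<close> and \<open>z2\<close>. The
  line from one system to the other is corrected by a multiple of an auxiliary form so that it has
  the zero \<open>z\<close> on the line from \<open>z1\<close> to \<open>z2\<close>. On this curve \<open>f\<close> and \<open>g\<close> are nonzero polynomials in
  one variable and so is their product.
\<close>

lemma inertia_prime:
  assumes J: "finite J" and d: "\<And>i. i \<in> J \<Longrightarrow> 0 < d i"
    and fg: "f * g \<in> inertia J d"
  shows "f \<in> inertia J d \<or> g \<in> inertia J d"
proof (rule ccontr)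
  assume "\<not> (f \<in> inertia J d \<or> g \<in> inertia J d)"
  then obtain F1 F2 where F: "has_zero J d F1" "ev (at_coeffs F1) f \<noteq> 0" "has_zero J d F2" "ev (at_coeffs F2) g \<noteq> 0"
    unfolding inertia_def by blast
  then obtain z1 z2 j1 j2 where z1: "j1 \<in> J" "z1 j1 \<noteq> 0" "\<And>i. i \<in> J \<Longrightarrow> form_val J (d i) (F1 i) z1 = 0"
    and z2: "j2 \<in> J" "z2 j2 \<noteq> 0" "\<And>i. i \<in> J \<Longrightarrow> form_val J (d i) (F2 i) z2 = 0"
    unfolding has_zero_def by blast
  have "\<forall>i\<in>J. \<exists>h. form_val J (d i) h z1 \<noteq> 0 \<and> form_val J (d i) h z2 \<noteq> 0"
    using form_nonzero_at_two_points[of J j1 z1 j2 z2] J z1(1,2) z2(1,2) d by blast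
  then obtain h where h: "\<And>i. i \<in> J \<Longrightarrow> form_val J (d i) (h i) z1 \<noteq> 0 \<and> form_val J (d i) (h i) z2 \<noteq> 0"
    by metis
  let ?line = "\<lambda>x y. [:x, y - x:] :: complex poly"
  define \<alpha> where "\<alpha> i = form_val J (d i) (h i) z1" for i
  define \<beta> where "\<beta> i = form_val J (d i) (h i) z2" for i
  define z where "z j = ?line (z1 j) (z2 j)" for j
  define G where "G i c = ?line (F1 i c / \<alpha> i) (F2 i c / \<beta> i)" for i c
  define H where "H i c = [:h i c:]" for i c
  \<comment> \<open>The correction needs no division: the line \<open>G\<close> is multiplied by the value of \<open>H\<close> at \<open>z\<close>. The
    scaling of \<open>F1\<close> and \<open>F2\<close> in \<open>G\<close> cancels this factor at the end points.\<close>
  define F where "F i c = (if i \<in> J then form_val J (d i) (H i) z * G i c - form_val J (d i) (G i) z * H i c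
    else ?line (F1 i c) (F2 i c))" for i c
  have zero: "form_val J (d i) (F i) z = 0" if "i \<in> J" for i
  proof -
    have "F i = (\<lambda>c. form_val J (d i) (H i) z * G i c - form_val J (d i) (G i) z * H i c)"
      using that by (simp add: F_def fun_eq_iff)
    then show ?thesis by (simp only: form_val_lin) (simp add: mult.commute)
  qed
  have prod0: "ev (at_coeffs F) f * ev (at_coeffs F) g * z j1 = 0"
  proof -
    \<comment> \<open>The factor \<open>z j1\<close> vanishes at the parameters where the line of points meets the origin.\<close>
    have "poly (ev (at_coeffs F) f * ev (at_coeffs F) g * z j1) s = 0" for s
    proof (cases "poly (z j1) s = 0")
      case False
      have "form_val J (d i) (\<lambda>c. poly (F i c) s) (\<lambda>j. poly (z j) s) = 0" if "i \<in> J" for i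
        using zero[OF that] poly_form_val[of J "d i" "F i" z s] by simp
      then have "has_zero J d (\<lambda>i c. poly (F i c) s)"
        by (rule has_zeroI[of j1 J "\<lambda>j. poly (z j) s", OF z1(1) False])
      then have "ev (at_coeffs (\<lambda>i c. poly (F i c) s)) (f * g) = 0" using fg by (simp add: inertia_def)
      then show ?thesis by (simp add: poly_ev_at_coeffs ev.hom_mult)
    qed simp
    then show ?thesis using poly_all_0_iff_0 by blast
  qed
  have at0: "poly (F i c) 0 = F1 i c" for i c
    using h[of i] z1(3)[of i]
    by (simp add: F_def G_def H_def z_def poly_form_val form_val_scale \<alpha>_def)
  have at1: "poly (F i c) 1 = F2 i c" for i c
    using h[of i] z2(3)[of i]
    by (simp add: F_def G_def H_def z_def poly_form_val form_val_scale \<beta>_def left_diff_distrib)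
  have "poly (ev (at_coeffs F) f) 0 \<noteq> 0" using F(2) by (simp add: poly_ev_at_coeffs at0)
  moreover have "poly (ev (at_coeffs F) g) 1 \<noteq> 0" using F(4) by (simp add: poly_ev_at_coeffs at1)
  moreover have "poly (z j1) 0 \<noteq> 0" using z1(2) by (simp add: z_def)
  ultimately show False using prod0 by auto
qed

text \<open>
  The summation bound may exceed the degree, as it does when a coefficient map lowers the degree.
\<close>

lemma poly_as_sum_upto:
  fixes q :: "'a::comm_ring_1 poly"
  assumes "degree q \<le> n"
  shows "poly q x = (\<Sum>k\<le>n. coeff q k * x ^ k)"
  unfolding poly_altdef using assms
  by (intro sum.mono_neutral_left) (auto simp: coeff_eq_0)

lemma mono_val_mult: "mono_val (\<lambda>j. a j * b j) e = mono_val a e * mono_val b e"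
  by (simp add: mono_val_def power_mult_distrib prod.distrib)

text \<open>
  In the chart \<open>t\<^bsub>i0\<^esub> = 1\<close>, the coefficients \<open>y\<^sub>i\<close> of \<open>t\<^bsub>i0\<^esub>\<^bsup>d\<^sub>i\<^esup>\<close> in the forms \<open>i \<noteq> i0\<close> are determined by
  the zero, and the coefficient of \<open>t\<^bsub>i0\<^esub>\<^bsup>d\<^bsub>i0\<^esub>\<^esup>\<close> in the form \<open>i0\<close> is adjusted last. Large diagonal
  coefficients, of size \<open>1/\<epsilon>\<close>, allow arbitrary values of the \<open>y\<^sub>i\<close> at a zero of size \<open>\<epsilon>\<close>: all other
  terms tend to zero. Hence the top component of \<open>f\<close> in the diagonal coefficients vanishes at a
  point that was chosen generically.
\<close>

lemma inertia_free_of_pure_coefficient: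
  assumes J: "finite J" "i0 \<in> J" and d: "\<And>i. i \<in> J \<Longrightarrow> 0 < d i"
    and f: "f \<in> inertia J d" and x: "U i0 (sgl i0 (d i0)) \<notin> vars f"
  shows "f = 0"
proof (rule ccontr)
  assume f0: "f \<noteq> 0"
  define J' where "J' = J - {i0}"
  define cy where "cy i = sgl i0 (d i)" for i
  define cD where "cD i = sgl i0 (d i - 1) + sgl i 1" for i
  define D where "D = (\<lambda>i. U i (cD i)) ` J'"
  have cyD: "cy i \<noteq> cD i" if "i \<in> J'" for i
  proof
    assume "cy i = cD i"
    then have "lk (cy i) i = lk (cD i) i" by simp
    then show False using that by (simp add: cy_def cD_def J'_def lookup_add lookup_single when_def split: if_splits)
  qed
  have cy_mem: "cy i \<in> mons J (d i)" for i
    using J by (auto simp: cy_def mons_def lookup_single when_def)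
  have cD_mem: "cD i \<in> mons J (d i)" if "i \<in> J'" for i
  proof -
    have "sgl i0 (d i - 1) \<in> mons J (d i - 1)" "sgl i 1 \<in> mons J 1"
      using J that by (auto simp: J'_def mons_def lookup_single when_def)
    then have "cD i \<in> mons J (d i - 1 + 1)" unfolding cD_def by (rule mons_add)
    then show ?thesis using d[of i] that by (simp add: J'_def)
  qed
  define p where "p = ev (\<lambda>v. if v \<in> D then monom (Var v :: cring) 1 else [:Var v:]) f"
  have "poly p 1 = f"
    using hom_ev[OF poly_eval_hom[of 1], of "\<lambda>v. if v \<in> D then monom (Var v :: cring) 1 else [:Var v:]" f]
    by (simp add: p_def if_distrib[of "\<lambda>q. poly q 1"] poly_monom cong: if_cong)
  then have "p \<noteq> 0" using f0 by auto
  let ?m = "degree p" and ?l = "lead_coeff p"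
  have "?l * (\<Prod>i\<in>J'. Var (U i (cD i))) \<noteq> 0"
    using \<open>p \<noteq> 0\<close> J by (simp add: J'_def prod_zero_iff)
  then obtain a :: "uvar \<Rightarrow> complex" where "ev a (?l * (\<Prod>i\<in>J'. Var (U i (cD i)))) \<noteq> 0"
    using exists_nonzero_point by blast
  then have a: "ev a ?l \<noteq> 0" "\<And>i. i \<in> J' \<Longrightarrow> a (U i (cD i)) \<noteq> 0"
    using J by (auto simp: ev.hom_mult ev.hom_prod J'_def prod_zero_iff)
  \<comment> \<open>The direction of the zero; it makes the diagonal term of form \<open>i\<close> cancel the value \<open>a (U i (cy i))\<close>.\<close>
  define \<tau> where "\<tau> j = (if j = i0 then 1 else - a (U j (cy j)) / a (U j (cD j)))" for j
  define rest where "rest i = mons J (d i) - {cy i, cD i}" for i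
  define r where "r i = (\<Sum>c\<in>rest i. monom (a (U i c) * mono_val \<tau> c) (d i - lk c i0))" for i
  define G where "G = at_coeffs (\<lambda>i c. if i \<in> J' \<and> c = cy i then [:a (U i c):] - r i else [:a (U i c):])"
  have less: "lk c i0 < d i" if "c \<in> mons J (d i)" "c \<noteq> cy i" for c i
  proof (rule ccontr)
    assume "\<not> lk c i0 < d i"
    moreover have sum: "lk c i0 + (\<Sum>j\<in>J'. lk c j) = d i"
      using that(1) J sum.remove[of J i0 "lk c"] by (simp add: mons_def J'_def)
    ultimately have "lk c i0 = d i" "(\<Sum>j\<in>J'. lk c j) = 0" by auto
    then have "lk c j = 0" if "j \<in> J'" for j using that J by (simp add: J'_def)
    then have "lk c j = lk (cy i) j" for j
      using \<open>lk c i0 = d i\<close> that(1) lookup_outside[of c J j]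
      by (cases "j \<in> J") (auto simp: cy_def J'_def mons_def lookup_single when_def)
    then show False using that(2) poly_mapping_eqI by blast
  qed
  have G0: "poly (G v) 0 = a v" for v
  proof -
    have "poly (r i) 0 = 0" for i
      unfolding r_def poly_sum
    proof (rule sum.neutral, rule ballI)
      fix c assume "c \<in> rest i"
      then have "0 < d i - lk c i0" using less[of c i] by (auto simp: rest_def)
      then show "poly (monom (a (U i c) * mono_val \<tau> c) (d i - lk c i0)) 0 = 0" by (simp add: poly_monom)
    qed
    then show ?thesis by (cases v) (simp add: G_def)
  qed
  have GD: "G v = [:a v:]" if "v \<in> D" for v
    using that cyD[THEN not_sym] by (auto simp: D_def G_def)
  have van: "ev (\<lambda>v. if v \<in> D then a v / \<epsilon> else poly (G v) \<epsilon>) f = 0" if \<epsilon>: "\<epsilon> \<noteq> 0" for \<epsilon>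
  proof -
    define b where "b = (\<lambda>v. if v \<in> D then a v / \<epsilon> else poly (G v) \<epsilon>)"
    define z where "z j = (if j = i0 then 1 else \<epsilon> * \<tau> j)" for j
    define X where "X = - (\<Sum>c\<in>mons J (d i0) - {cy i0}. b (U i0 c) * mono_val z c)"
    define F where "F = (\<lambda>i c. (b(U i0 (cy i0) := X)) (U i c))"
    have zc: "mono_val z c = \<epsilon> ^ (d i - lk c i0) * mono_val \<tau> c" if c: "c \<in> mons J (d i)" for c i
    proof -
      have "z = (\<lambda>j. (if j = i0 then 1 else \<epsilon>) * \<tau> j)" by (auto simp: z_def \<tau>_def)
      then have "mono_val z c = mono_val (\<lambda>j. if j = i0 then 1 else \<epsilon>) c * mono_val \<tau> c"
        by (simp add: mono_val_mult)
      also have "mono_val (\<lambda>j. if j = i0 then 1 else \<epsilon>) c = (\<Prod>j\<in>J. (if j = i0 then 1 else \<epsilon>) ^ lk c j)"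
        using c J by (intro mono_val_superset) (auto simp: mons_def)
      also have "\<dots> = (\<Prod>j\<in>J'. \<epsilon> ^ lk c j)"
        using J by (subst prod.remove[of J i0]) (auto simp: J'_def intro!: prod.cong)
      also have "\<dots> = \<epsilon> ^ (\<Sum>j\<in>J'. lk c j)" by (simp add: power_sum)
      also have "(\<Sum>j\<in>J'. lk c j) = d i - lk c i0"
      proof -
        have "lk c i0 + (\<Sum>j\<in>J'. lk c j) = d i"
          using c J sum.remove[of J i0 "lk c"] by (simp add: mons_def J'_def)
        then show ?thesis by linarith
      qed
      finally show ?thesis .
    qed
    have zy: "mono_val z (cy i) = 1" for i by (simp add: cy_def z_def)
    have "form_val J (d i) (F i) z = 0" if i: "i \<in> J" for i
    proof (cases "i = i0")
      case True
      have "form_val J (d i) (F i) z = F i (cy i) * mono_val z (cy i) + (\<Sum>c\<in>mons J (d i) - {cy i}. F i c * mono_val z c)"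
        unfolding form_val_def using J cy_mem by (intro sum.remove) auto
      also have "(\<Sum>c\<in>mons J (d i) - {cy i}. F i c * mono_val z c) = - X"
        unfolding X_def using True by (simp add: F_def)
      also have "F i (cy i) = X" using True by (simp add: F_def)
      finally show ?thesis by (simp add: zy)
    next
      case False
      then have iJ: "i \<in> J'" using i by (simp add: J'_def)
      have Fi: "F i = (\<lambda>c. b (U i c))" using False by (simp add: F_def)
      have yD: "U i (cy i) \<notin> D" using cyD iJ by (auto simp: D_def)
      have "form_val J (d i) (F i) z = F i (cy i) * mono_val z (cy i) + (\<Sum>c\<in>mons J (d i) - {cy i}. F i c * mono_val z c)"
        unfolding form_val_def using J cy_mem by (intro sum.remove) auto
      also have "(\<Sum>c\<in>mons J (d i) - {cy i}. F i c * mono_val z c) = F i (cD i) * mono_val z (cD i) + (\<Sum>c\<in>rest i. F i c * mono_val z c)"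
        unfolding rest_def using J cD_mem[OF iJ] cyD[OF iJ]
        by (subst sum.remove[of _ "cD i"]) (auto simp: Diff_insert2[symmetric] insert_commute)
      also have "(\<Sum>c\<in>rest i. F i c * mono_val z c) = poly (r i) \<epsilon>"
        unfolding r_def poly_sum
      proof (rule sum.cong[OF refl])
        fix c assume c: "c \<in> rest i"
        then have "U i c \<notin> D" by (auto simp: D_def rest_def)
        then have "F i c = a (U i c)" using c by (simp add: Fi b_def G_def rest_def)
        then show "F i c * mono_val z c = poly (monom (a (U i c) * mono_val \<tau> c) (d i - lk c i0)) \<epsilon>"
          using zc[of c i] c by (simp add: rest_def poly_monom)
      qed
      also have "F i (cD i) * mono_val z (cD i) = - a (U i (cy i))"
      proof -
        have "mono_val z (cD i) = \<epsilon> * \<tau> i"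
          using False by (simp add: cD_def mono_val_add z_def)
        moreover have "F i (cD i) = a (U i (cD i)) / \<epsilon>" using iJ by (simp add: Fi b_def D_def)
        ultimately show ?thesis using \<epsilon> a(2)[OF iJ] False by (simp add: \<tau>_def)
      qed
      also have "F i (cy i) = a (U i (cy i)) - poly (r i) \<epsilon>"
        using yD iJ by (simp add: Fi b_def G_def)
      finally show ?thesis by (simp add: zy)
    qed
    moreover have "z i0 \<noteq> 0" by (simp add: z_def)
    ultimately have "has_zero J d F" by (intro has_zeroI[OF J(2)])
    then have "ev (at_coeffs F) f = 0" using f by (simp add: inertia_def)
    moreover have "ev (at_coeffs F) f = ev b f"
    proof (rule ins_cong)
      fix v assume "v \<in> vars f"
      then have "v \<noteq> U i0 (cy i0)" using x by (auto simp: cy_def)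
      then show "at_coeffs F v = b v" by (cases v) (auto simp: F_def)
    qed
    ultimately show ?thesis by (simp add: b_def)
  qed
  \<comment> \<open>The value of \<open>f\<close> along the curve, multiplied by \<open>\<epsilon>\<close> to the degree in the diagonal coefficients.\<close>
  define H where "H = (\<Sum>k\<le>?m. ev G (coeff p k) * monom 1 (?m - k))"
  have "poly H \<epsilon> = 0" if \<epsilon>: "\<epsilon> \<noteq> 0" for \<epsilon>
  proof -
    let ?g = "\<lambda>v. poly (G v) \<epsilon>"
    let ?h = "\<lambda>q. poly (map_poly (ev ?g) q) (1 / \<epsilon>)"
    have hom: "comm_ring_hom ?h" by (rule comp_hom[OF poly_eval_hom map_poly_hom[OF ev_hom]])
    have "?h p = ev (\<lambda>v. ?h (if v \<in> D then monom (Var v :: cring) 1 else [:Var v:])) f"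
      unfolding p_def by (rule hom_ev[OF hom])
    also have "(\<lambda>v. ?h (if v \<in> D then monom (Var v :: cring) 1 else [:Var v:])) = (\<lambda>v. if v \<in> D then a v / \<epsilon> else poly (G v) \<epsilon>)"
      by (auto simp: fun_eq_iff map_poly_const map_poly_monom poly_monom GD)
    finally have "?h p = 0" using van[OF \<epsilon>] by simp
    moreover have "?h p = (\<Sum>k\<le>?m. ev ?g (coeff p k) * (1 / \<epsilon>) ^ k)"
    proof -
      have "degree (map_poly (ev ?g) p) \<le> ?m" by (rule degree_map_poly_le)
      from poly_as_sum_upto[OF this, of "1 / \<epsilon>"] show ?thesis by (simp add: coeff_map_poly)
    qed
    moreover have "poly H \<epsilon> = \<epsilon> ^ ?m * (\<Sum>k\<le>?m. ev ?g (coeff p k) * (1 / \<epsilon>) ^ k)"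
    proof -
      have G_ev: "poly (ev G q) \<epsilon> = ev ?g q" for q by (rule hom_ev[OF poly_eval_hom])
      have "\<epsilon> ^ (?m - k) = \<epsilon> ^ ?m * (1 / \<epsilon>) ^ k" if "k \<le> ?m" for k
        using that \<epsilon> by (simp add: power_diff field_simps)
      then show ?thesis unfolding H_def poly_sum sum_distrib_left
        by (intro sum.cong refl) (simp add: G_ev poly_monom)
    qed
    ultimately show ?thesis by simp
  qed
  then have "poly ([:0, 1:] * H) \<epsilon> = 0" for \<epsilon> by (cases "\<epsilon> = 0") simp_all
  then have "[:0, 1:] * H = 0" using poly_all_0_iff_0 by blast
  then have "H = 0" by (simp only: mult_eq_0_iff) simp
  moreover have "poly H 0 = ev a ?l"
  proof -
    have G_ev: "poly (ev G q) 0 = ev a q" for q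
      using hom_ev[OF poly_eval_hom[of 0], of G q] G0 by simp
    have "poly H 0 = (\<Sum>k\<le>?m. if k = ?m then ev a (coeff p k) else 0)"
      unfolding H_def poly_sum by (intro sum.cong refl) (auto simp: G_ev poly_monom)
    then show ?thesis by simp
  qed
  ultimately show False using a(1) by simp
qed

section \<open>The Macaulay matrices and the existence of the resultant\<close>

lemma sgl_mem_mons: "finite J \<Longrightarrow> j \<in> J \<Longrightarrow> sgl j k \<in> mons J k"
  by (auto simp: mons_def lookup_single when_def)

text \<open>
  The row of \<open>t\<^sup>e F\<close> applied to the vector of all monomials at \<open>z\<close> is the value of \<open>t\<^sup>e F\<close> at \<open>z\<close>.
\<close>

lemma shiftc_kernel:
  assumes J: "finite J" and e: "e \<in> mons J (\<nu> - k)" and k: "k \<le> \<nu>"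
  shows "(\<Sum>c\<in>mons J \<nu>. shiftc a e c * mono_val z c) = mono_val z e * form_val J k a z"
proof -
  have add: "e + f \<in> mons J \<nu>" if "f \<in> mons J k" for f
    using mons_add[OF e that] k by simp
  have "(\<Sum>c\<in>mons J \<nu>. shiftc a e c * mono_val z c) = (\<Sum>c\<in>(+) e ` mons J k. shiftc a e c * mono_val z c)"
  proof (rule sum.mono_neutral_right)
    show "\<forall>c\<in>mons J \<nu> - (+) e ` mons J k. shiftc a e c * mono_val z c = 0"
    proof
      fix c assume c: "c \<in> mons J \<nu> - (+) e ` mons J k"
      have "c \<noteq> e + f" for f
      proof
        assume "c = e + f"
        then have "f \<in> mons J k" using c e k mons_add_cancel[of f e J \<nu> "\<nu> - k"] by (simp add: add.commute)
        then show False using c \<open>c = e + f\<close> by blast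
      qed
      then show "shiftc a e c * mono_val z c = 0" by (simp add: shiftc_def)
    qed
  qed (use J add in auto)
  also have "\<dots> = (\<Sum>f\<in>mons J k. shiftc a e (e + f) * mono_val z (e + f))"
    by (subst sum.reindex) auto
  also have "\<dots> = mono_val z e * form_val J k a z"
    by (auto simp: shiftc_def form_val_def sum_distrib_left mono_val_add intro!: sum.cong)
  finally show ?thesis .
qed

lemma hom_shiftc: "h 0 = 0 \<Longrightarrow> h (shiftc a e c) = shiftc (\<lambda>c. h (a c)) e c"
  by (simp add: shiftc_def)

definition gen_coeff :: "nat \<Rightarrow> expo \<Rightarrow> cring" where "gen_coeff i c = Var (U i c)"

lemma ev_shiftc_gen_coeff: "ev (at_coeffs F) (shiftc (gen_coeff i) e c) = shiftc (F i) e c"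
  by (simp add: hom_shiftc[of "ev (at_coeffs F)"] ev.hom_zero gen_coeff_def)

lemma ev_idet_gen_coeff:
  "ev (at_coeffs F) (idet S (\<lambda>c. shiftc (gen_coeff (i c)) (e c))) = idet S (\<lambda>c. shiftc (F (i c)) (e c))"
  using idet_hom[OF ev_hom[of "at_coeffs F"], of S "\<lambda>c. shiftc (gen_coeff (i c)) (e c)"]
  by (simp add: ev_shiftc_gen_coeff)

text \<open>
  At a system with the zero \<open>z\<close>, the vector of the monomials at \<open>z\<close> lies in the kernel.
\<close>

lemma minor_in_inertia:
  assumes J: "finite J"
    and rows: "\<And>c. c \<in> mons J \<nu> \<Longrightarrow> i c \<in> J \<and> d (i c) \<le> \<nu> \<and> e c \<in> mons J (\<nu> - d (i c))"
  shows "idet (mons J \<nu>) (\<lambda>c. shiftc (gen_coeff (i c)) (e c)) \<in> inertia J d"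
  unfolding inertia_def
proof (intro CollectI allI impI)
  fix F assume "has_zero J d F"
  then obtain z j where z: "j \<in> J" "z j \<noteq> 0" "\<And>i. i \<in> J \<Longrightarrow> form_val J (d i) (F i) z = 0"
    unfolding has_zero_def by blast
  have "idet (mons J \<nu>) (\<lambda>c. shiftc (F (i c)) (e c)) = 0"
  proof (rule idet_kernel[of _ "sgl j \<nu>" "mono_val z"])
    fix c assume "c \<in> mons J \<nu>"
    then show "(\<Sum>c'\<in>mons J \<nu>. shiftc (F (i c)) (e c) c' * mono_val z c') = 0"
      using rows[of c] z(3) shiftc_kernel[OF J, of "e c" \<nu> "d (i c)" "F (i c)" z] by simp
  qed (use J z in \<open>auto intro: sgl_mem_mons\<close>)
  then show "ev (at_coeffs F) (idet (mons J \<nu>) (\<lambda>c. shiftc (gen_coeff (i c)) (e c))) = 0"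
    by (simp add: ev_idet_gen_coeff)
qed

text \<open>
  The Macaulay matrix for any choice \<open>b\<close> of the form that is used in the row of \<open>c\<close>; different
  choices are needed to bound the degrees of the resultant in the different forms.
\<close>

definition mac_entry :: "(nat \<Rightarrow> nat) \<Rightarrow> (expo \<Rightarrow> nat) \<Rightarrow> (nat \<Rightarrow> expo \<Rightarrow> 'a::zero) \<Rightarrow> expo \<Rightarrow> expo \<Rightarrow> 'a" where
  "mac_entry d b F c = shiftc (F (b c)) (c - sgl (b c) (d (b c)))"

text \<open>
  The condition on \<open>b\<close> under which the row of \<open>c\<close> has a polynomial multiplier.
\<close>

definition assignment :: "nat set \<Rightarrow> (nat \<Rightarrow> nat) \<Rightarrow> nat \<Rightarrow> (expo \<Rightarrow> nat) \<Rightarrow> bool" where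
  "assignment J d \<nu> b \<longleftrightarrow> (\<forall>c\<in>mons J \<nu>. b c \<in> J \<and> d (b c) \<le> lk c (b c))"

lemma minus_sgl_add: "k \<le> lk c i \<Longrightarrow> c - sgl i k + sgl i k = (c :: 'v \<Rightarrow>\<^sub>0 nat)"
  by (intro poly_mapping_eqI) (auto simp: lookup_add lookup_minus lookup_single when_def)

lemma minus_sgl_mons:
  assumes "finite J" "c \<in> mons J \<nu>" "i \<in> J" "k \<le> lk c i"
  shows "c - sgl i k \<in> mons J (\<nu> - k)" "k \<le> \<nu>"
proof -
  show "c - sgl i k \<in> mons J (\<nu> - k)"
    using assms mons_add_cancel[of "c - sgl i k" "sgl i k" J \<nu> k] sgl_mem_mons[of J i k]
    by (simp add: minus_sgl_add)
  show "k \<le> \<nu>" using assms member_le_sum[of i J "lk c"] by (auto simp: mons_def)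
qed

lemma mac_entry_in_inertia:
  assumes "finite J" "assignment J d \<nu> b"
  shows "idet (mons J \<nu>) (mac_entry d b gen_coeff) \<in> inertia J d"
  unfolding mac_entry_def using assms minus_sgl_mons
  by (intro minor_in_inertia) (auto simp: assignment_def)

lemma ev_mac_entry: "ev (at_coeffs F) (idet S (mac_entry d b gen_coeff)) = idet S (mac_entry d b F)"
  unfolding mac_entry_def by (rule ev_idet_gen_coeff)

definition pure :: "(nat \<Rightarrow> nat) \<Rightarrow> nat \<Rightarrow> expo \<Rightarrow> 'a::{zero,one}" where
  "pure d i c = (if c = sgl i (d i) then 1 else 0)"

lemma mac_entry_pure_row:
  assumes "F (b c) = pure d (b c)" "d (b c) \<le> lk c (b c)"
  shows "mac_entry d b F c c' = (if c' = c then 1 else 0)"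
proof (cases "c' = c")
  case True
  have "c = c - sgl (b c) (d (b c)) + sgl (b c) (d (b c))" using assms(2) by (simp add: minus_sgl_add)
  moreover from this have "c - (c - sgl (b c) (d (b c))) = sgl (b c) (d (b c))"
    by (metis add_diff_cancel_left')
  ultimately show ?thesis using True assms by (auto simp: mac_entry_def shiftc_def pure_def)
next
  case False
  have "c' = c" if "c' = c - sgl (b c) (d (b c)) + f" "c' - (c - sgl (b c) (d (b c))) = sgl (b c) (d (b c))" for f
    using that assms(2) by (simp add: minus_sgl_add)
  then show ?thesis using False assms by (auto simp: mac_entry_def shiftc_def pure_def)
qed

lemma idet_mac_entry_pure:
  assumes "finite J" "assignment J d \<nu> b" "S \<subseteq> mons J \<nu>"
  shows "idet S (mac_entry d b (pure d)) = 1"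
proof (rule idet_identity)
  show "finite S" using assms finite_mons finite_subset by blast
  show "mac_entry d b (pure d) c c' = (if c' = c then 1 else 0)" if "c \<in> S" for c c'
    using assms that by (intro mac_entry_pure_row) (auto simp: assignment_def)
qed

text \<open>
  One is added before the number of forms is subtracted, which is correct also for empty \<open>J\<close>.
\<close>

definition crit :: "nat set \<Rightarrow> (nat \<Rightarrow> nat) \<Rightarrow> nat" where
  "crit J d = (\<Sum>i\<in>J. d i) + 1 - card J"

lemma crit_not_reduced:
  assumes J: "finite J" and c: "c \<in> mons J \<nu>" "crit J d \<le> \<nu>"
  shows "\<exists>i\<in>J. d i \<le> lk c i"
proof (rule ccontr)
  assume "\<not> (\<exists>i\<in>J. d i \<le> lk c i)"
  then have "(\<Sum>i\<in>J. lk c i + 1) \<le> (\<Sum>i\<in>J. d i)" by (intro sum_mono) (auto simp: not_le)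
  moreover have "(\<Sum>i\<in>J. lk c i + 1) = \<nu> + card J"
    using c(1) by (simp only: sum.distrib) (simp add: mons_def)
  ultimately show False using c(2) by (simp add: crit_def)
qed

text \<open>
  Macaulay's choice of the form for the row of \<open>c\<close>.
\<close>

definition last_block :: "nat set \<Rightarrow> (nat \<Rightarrow> nat) \<Rightarrow> expo \<Rightarrow> nat" where
  "last_block J d c = Max {i\<in>J. d i \<le> lk c i}"

lemma last_block_props:
  assumes "finite J" "\<exists>i\<in>J. d i \<le> lk c i"
  shows "last_block J d c \<in> J" "d (last_block J d c) \<le> lk c (last_block J d c)"
    "\<And>i. i \<in> J \<Longrightarrow> d i \<le> lk c i \<Longrightarrow> i \<le> last_block J d c"
proof -
  let ?S = "{i\<in>J. d i \<le> lk c i}"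
  have "?S \<noteq> {}" "finite ?S" using assms by auto
  then have "last_block J d c \<in> ?S" "\<And>i. i \<in> ?S \<Longrightarrow> i \<le> last_block J d c" unfolding last_block_def
    using Max_in[of ?S] Max_ge[of ?S] by blast+
  then show "last_block J d c \<in> J" "d (last_block J d c) \<le> lk c (last_block J d c)"
    "\<And>i. i \<in> J \<Longrightarrow> d i \<le> lk c i \<Longrightarrow> i \<le> last_block J d c" by auto
qed

lemma assignment_last_block:
  assumes "finite J" "crit J d \<le> \<nu>"
  shows "assignment J d \<nu> (last_block J d)"
  unfolding assignment_def using crit_not_reduced[OF assms(1) _ assms(2)] last_block_props(1,2)[OF assms(1)] by blast

text \<open>
  The value at the pure powers is taken in \<open>\<int>\<close>, where it fixes the sign.
\<close>

definition is_res :: "nat set \<Rightarrow> (nat \<Rightarrow> nat) \<Rightarrow> cring \<Rightarrow> bool" where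
  "is_res J d R \<longleftrightarrow> irreducible R \<and> R \<in> inertia J d \<and> (\<forall>f\<in>inertia J d. R dvd f) \<and>
     ev (at_coeffs (pure d)) R = (1 :: int)"

lemma irreducible_uminus:
  assumes "irreducible (R :: cring)"
  shows "irreducible (- R)"
proof (rule irreducibleI)
  show "- R \<noteq> 0" "\<not> (- R) dvd 1" using assms by (auto simp: irreducible_def)
  fix a b assume "- R = a * b"
  then have "R = (- a) * b" by (metis minus_equation_iff minus_mult_left)
  then have "(- a) dvd 1 \<or> b dvd 1" using assms unfolding irreducible_def by blast
  then show "a dvd 1 \<or> b dvd 1" by simp
qed

text \<open>
  Some irreducible factor of the Macaulay determinant is an inertia form, since the ideal is prime. It
  divides every inertia form \<open>f\<close>: otherwise \<open>elimination\<close> would produce a nonzero inertia form without the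
  variable that the ideal does not allow to be eliminated.
\<close>

theorem exists_res:
  assumes J: "finite J" "J \<noteq> {}" and d: "\<And>i. i \<in> J \<Longrightarrow> 0 < d i"
  shows "\<exists>R. is_res J d R"
proof -
  obtain i0 where i0: "i0 \<in> J" using J by blast
  let ?\<nu> = "crit J d" and ?x = "U i0 (sgl i0 (d i0))"
  let ?M = "idet (mons J ?\<nu>) (mac_entry d (last_block J d) gen_coeff)"
  have asg: "assignment J d ?\<nu> (last_block J d)" using J by (intro assignment_last_block) auto
  have M: "?M \<in> inertia J d" by (rule mac_entry_in_inertia[OF J(1) asg])
  have M1: "ev (at_coeffs (pure d)) ?M = (1 :: int)"
    unfolding ev_mac_entry by (rule idet_mac_entry_pure[OF J(1) asg subset_refl])
  have "?M \<noteq> 0"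
  proof
    assume "?M = 0"
    then have "ev (at_coeffs (pure d)) (0 :: cring) = (1 :: int)" using M1 by (simp only:)
    then show False unfolding ev.hom_zero by (rule zero_neq_one[THEN notE])
  qed
  have factor: "f \<in> inertia J d \<longrightarrow> (\<exists>p. irreducible p \<and> p \<in> inertia J d \<and> p dvd f)" if "f \<noteq> 0" for f
    using that
  proof (induction f rule: irreducible_factor_induct)
    case (unit u)
    have "has_zero J d (\<lambda>_ _. 0)"
      using i0 by (intro has_zeroI[of i0 _ "\<lambda>_. 1"]) (auto simp: form_val_def)
    then have "u \<notin> inertia J d"
      using unit_mpol_int[OF unit] by (auto simp: inertia_def ev.hom_one ev.hom_uminus)
    then show ?case by blast
  next
    case (mult p g)
    show ?case
    proof
      assume "p * g \<in> inertia J d"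
      then consider "p \<in> inertia J d" | "g \<in> inertia J d" using inertia_prime[of J d p g] J(1) d by blast
      then show "\<exists>q. irreducible q \<and> q \<in> inertia J d \<and> q dvd p * g"
      proof cases
        case 1
        then show ?thesis using mult(1) dvd_triv_left by blast
      next
        case 2
        then obtain q where "irreducible q" "q \<in> inertia J d" "q dvd g" using mult(3) by blast
        then show ?thesis using dvd_mult by blast
      qed
    qed
  qed
  then obtain R where R: "irreducible R" "R \<in> inertia J d" "R dvd ?M"
    using M \<open>?M \<noteq> 0\<close> by blast
  have "R \<noteq> 0" using R(1) by (simp add: irreducible_def)
  then have x: "?x \<in> vars R"
    using inertia_free_of_pure_coefficient[of J i0 d R] J(1) i0 d R(2) by blast
  have dvd: "R dvd f" if "f \<in> inertia J d" for f
  proof (rule ccontr)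
    assume "\<not> R dvd f"
    from elimination[OF R(1) x this] obtain \<alpha> \<beta>
      where ab: "\<alpha> * R + \<beta> * f \<noteq> 0" "?x \<notin> vars (\<alpha> * R + \<beta> * f)" by blast
    have "\<alpha> * R + \<beta> * f \<in> inertia J d" using R(2) that by (rule inertia_comb)
    then show False using inertia_free_of_pure_coefficient[of J i0 d "\<alpha> * R + \<beta> * f"] J(1) i0 d ab by blast
  qed
  have "ev (at_coeffs (pure d)) R dvd (ev (at_coeffs (pure d)) ?M :: int)" using R(3) by (rule ev.hom_dvd)
  then have "ev (at_coeffs (pure d)) R dvd (1 :: int)" unfolding M1 .
  then consider "ev (at_coeffs (pure d)) R = (1 :: int)" | "ev (at_coeffs (pure d)) R = (- 1 :: int)" by fastforce
  then show ?thesis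
  proof cases
    case 1
    then show ?thesis using R(1,2) dvd unfolding is_res_def by blast
  next
    case 2
    then have "ev (at_coeffs (pure d)) (- R) = (1 :: int)" unfolding ev.hom_uminus by simp
    moreover have "- R \<in> inertia J d" using R(2) by (simp add: inertia_def ev.hom_uminus)
    ultimately have "is_res J d (- R)"
      using irreducible_uminus[OF R(1)] dvd by (simp add: is_res_def)
    then show ?thesis by blast
  qed
qed

text \<open>
  A system without zeros has a nonvanishing maximal minor, and this minor is a multiple of the
  resultant.
\<close>

theorem res_vanishes_iff:
  assumes J: "finite J" and R: "is_res J d R"
  shows "ev (at_coeffs F) R = 0 \<longleftrightarrow> has_zero J d F"
proof
  show "has_zero J d F \<Longrightarrow> ev (at_coeffs F) R = 0" using R unfolding is_res_def inertia_def by blast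
next
  assume R0: "ev (at_coeffs F) R = 0"
  show "has_zero J d F"
  proof (rule ccontr)
    assume "\<not> has_zero J d F"
    then obtain \<nu> where \<nu>: "\<And>i. i \<in> J \<Longrightarrow> d i \<le> \<nu>"
      and span: "\<And>c. c \<in> mons J \<nu> \<Longrightarrow> \<exists>Q :: nat \<Rightarrow> expo \<Rightarrow> complex. \<forall>c'\<in>mons J \<nu>.
        (\<Sum>i\<in>J. \<Sum>e\<in>mons J (\<nu> - d i). Q i e * shiftc (F i) e c') = (if c' = c then 1 else 0)"
      using no_zero_imp_spanning[OF J] by blast
    let ?K = "SIGMA i:J. mons J (\<nu> - d i)"
    have "\<exists>q. \<forall>c'\<in>mons J \<nu>. (\<Sum>k\<in>?K. q k * shiftc (F (fst k)) (snd k) c') = (if c' = c then 1 else 0)"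
      if c: "c \<in> mons J \<nu>" for c
    proof -
      obtain Q :: "nat \<Rightarrow> expo \<Rightarrow> complex" where Q: "\<forall>c'\<in>mons J \<nu>.
        (\<Sum>i\<in>J. \<Sum>e\<in>mons J (\<nu> - d i). Q i e * shiftc (F i) e c') = (if c' = c then 1 else 0)"
        using span[OF c] by blast
      have "(\<Sum>k\<in>?K. Q (fst k) (snd k) * shiftc (F (fst k)) (snd k) c')
          = (\<Sum>i\<in>J. \<Sum>e\<in>mons J (\<nu> - d i). Q i e * shiftc (F i) e c')" for c'
        using J by (subst sum.Sigma) (auto simp: case_prod_beta)
      then show ?thesis using Q by (intro exI[of _ "\<lambda>k. Q (fst k) (snd k)"]) simp
    qed
    from nonzero_minor_from_span[OF _ _ this]
    obtain \<phi> where \<phi>: "\<forall>c\<in>mons J \<nu>. \<phi> c \<in> ?K"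
      "idet (mons J \<nu>) (\<lambda>c. shiftc (F (fst (\<phi> c))) (snd (\<phi> c))) \<noteq> 0"
      using J by auto
    let ?D = "idet (mons J \<nu>) (\<lambda>c. shiftc (gen_coeff (fst (\<phi> c))) (snd (\<phi> c)))"
    have "?D \<in> inertia J d" using J \<phi>(1) \<nu> by (intro minor_in_inertia) auto
    then have "R dvd ?D" using R unfolding is_res_def by blast
    then have "ev (at_coeffs F) R dvd ev (at_coeffs F) ?D" by (rule ev.hom_dvd)
    then have "ev (at_coeffs F) ?D = 0" using R0 by simp
    then show False using \<phi>(2) by (simp add: ev_idet_gen_coeff)
  qed
qed

section \<open>The degrees of the resultant\<close>

fun row_of :: "uvar \<Rightarrow> nat" where "row_of (U i c) = i"

definition udeg :: "nat \<Rightarrow> (uvar \<Rightarrow>\<^sub>0 nat) \<Rightarrow> nat" where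
  "udeg i e = (\<Sum>v\<in>kys e. if row_of v = i then lk e v else 0)"

text \<open>
  Homogeneous of degree \<open>r\<close> in the coefficients of the form \<open>i\<close>.
\<close>

definition hom_deg :: "nat \<Rightarrow> cring \<Rightarrow> nat \<Rightarrow> bool" where
  "hom_deg i f r \<longleftrightarrow> (\<forall>e\<in>kys f. udeg i e = r)"

text \<open>
  The coefficients of the form \<open>i\<close> are multiplied by a new variable. Homogeneity means that the result
  is a monomial in it, which makes the step to factors a statement on univariate polynomials.
\<close>

definition scal :: "nat \<Rightarrow> cring \<Rightarrow> cring poly" where
  "scal i = ev (\<lambda>v. if row_of v = i then monom (Var v) 1 else [:Var v:])"

lemma scal_hom: "comm_ring_hom (scal i)"
  unfolding scal_def by (rule ev_hom)

interpretation scal: comm_ring_hom "scal i" for i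
  by (rule scal_hom)

lemma monom_prod: "(\<Prod>v\<in>S. monom (a v) (k v)) = monom (\<Prod>v\<in>S. a v) (\<Sum>v\<in>S. k v)"
  for a :: "'v \<Rightarrow> 'a::comm_ring_1"
  by (induction S rule: infinite_finite_induct) (simp_all add: mult_monom monom_0 one_pCons)

lemma mono_val_scal:
  "mono_val (\<lambda>v. if row_of v = i then monom (Var v :: cring) 1 else [:Var v:]) e = monom (sgl e 1) (udeg i e)"
proof -
  have "(if row_of v = i then monom (Var v :: cring) 1 else [:Var v:]) ^ k
      = monom (Var v ^ k) (if row_of v = i then k else 0)" for v k
    by (simp add: monom_power flip: monom_0)
  then show ?thesis
    by (simp add: mono_val_def monom_prod udeg_def flip: mono_val_Var)
qed

lemma scal_expansion: "scal i f = (\<Sum>e\<in>kys f. monom (sgl e (lk f e)) (udeg i e))"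
  unfolding scal_def ins_def mono_val_scal
  by (intro sum.cong refl) (simp add: of_int_poly smult_monom mult_single flip: sgl_0_int)

lemma hom_deg_iff_scal: "hom_deg i f r \<longleftrightarrow> scal i f = monom f r"
proof
  assume "hom_deg i f r"
  then have "scal i f = (\<Sum>e\<in>kys f. monom (sgl e (lk f e)) r)"
    unfolding scal_expansion hom_deg_def by (intro sum.cong) auto
  also have "\<dots> = monom (\<Sum>e\<in>kys f. sgl e (lk f e)) r"
    by (induction "kys f" rule: infinite_finite_induct) (auto simp: poly_eq_iff coeff_sum)
  finally show "scal i f = monom f r" using monomial_expansion[of f] by simp
next
  assume eq: "scal i f = monom f r"
  show "hom_deg i f r" unfolding hom_deg_def
  proof (intro ballI, rule ccontr)
    fix e assume e: "e \<in> kys f" "udeg i e \<noteq> r"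
    have "lk (coeff (scal i f) (udeg i e)) e = (\<Sum>e'\<in>kys f. if e' = e then lk f e' else 0)"
      unfolding scal_expansion coeff_sum lookup_sum
      by (intro sum.cong refl) (auto simp: coeff_monom lookup_single when_def)
    also have "\<dots> = lk f e" using e by simp
    finally have "lk f e = 0" using eq e by (simp add: coeff_monom)
    then show False using e by (simp add: in_keys_iff)
  qed
qed

lemma poly_scal_1: "poly (scal i f) 1 = f"
  using hom_ev[OF poly_eval_hom[of 1], of "\<lambda>v. if row_of v = i then monom (Var v :: cring) 1 else [:Var v:]" f]
  by (simp add: scal_def if_distrib[of "\<lambda>q. poly q 1"] poly_monom cong: if_cong)

lemma hom_degI_scal: "scal i f = monom g r \<Longrightarrow> hom_deg i f r"
proof -
  assume *: "scal i f = monom g r"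
  then have "f = g" using poly_scal_1[of i f] by (simp add: poly_monom)
  then show ?thesis using * hom_deg_iff_scal by simp
qed

lemma hom_deg_unique: "f \<noteq> 0 \<Longrightarrow> hom_deg i f r \<Longrightarrow> hom_deg i f s \<Longrightarrow> r = s"
  unfolding hom_deg_def by (metis ex_in_conv keys_eq_empty)

lemma hom_deg_mult: "hom_deg i f r \<Longrightarrow> hom_deg i g s \<Longrightarrow> hom_deg i (f * g) (r + s)"
  by (simp add: hom_deg_iff_scal scal.hom_mult mult_monom)

lemma hom_deg_power: "hom_deg i f r \<Longrightarrow> hom_deg i (f ^ k) (k * r)"
  by (simp add: hom_deg_iff_scal scal.hom_power monom_power mult.commute)

text \<open>
  Factors \<open>[:0, 1:]\<close> are removed from the two polynomials until both are constant.
\<close>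

lemma monom_factor:
  fixes p q :: "'a::idom poly"
  assumes "p * q = monom c k" "c \<noteq> 0"
  shows "\<exists>a j. p = monom a j"
  using assms(1)
proof (induction k arbitrary: p q)
  case 0
  then have "degree (p * q) = 0" by (simp add: monom_0)
  moreover have "p * q \<noteq> 0" using 0 assms(2) by (simp add: monom_0)
  ultimately have "degree p = 0" by (auto simp: degree_mult_eq)
  then show ?case by (metis degree_eq_zeroE monom_0)
next
  case (Suc k)
  then have "poly (p * q) 0 = 0" by (simp add: poly_monom)
  then consider "poly p 0 = 0" | "poly q 0 = 0" by auto
  then show ?case
  proof cases
    case 1
    then obtain p' where p': "p = [:0, 1:] * p'" using poly_eq_0_iff_dvd[of p 0] by auto
    then have "[:0, 1:] * (p' * q) = [:0, 1:] * monom c k" using Suc.prems by (simp add: monom_Suc mult.assoc)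
    then have "p' * q = monom c k" by (simp only: mult_cancel_left) simp
    then obtain a j where "p' = monom a j" using Suc.IH by blast
    then have "p = monom a (Suc j)" using p' by (simp add: monom_Suc)
    then show ?thesis by blast
  next
    case 2
    then obtain q' where q': "q = [:0, 1:] * q'" using poly_eq_0_iff_dvd[of q 0] by auto
    then have "[:0, 1:] * (p * q') = [:0, 1:] * monom c k" using Suc.prems
      by (simp add: monom_Suc mult.left_commute)
    then have "p * q' = monom c k" by (simp only: mult_cancel_left) simp
    then show ?thesis using Suc.IH by blast
  qed
qed

lemma hom_deg_factor:
  assumes "hom_deg i (f * g) r" "f * g \<noteq> 0"
  shows "\<exists>s. s \<le> r \<and> hom_deg i f s \<and> hom_deg i g (r - s)"
proof -
  have eq: "scal i f * scal i g = monom (f * g) r"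
    using assms(1) by (simp add: hom_deg_iff_scal scal.hom_mult)
  obtain a j where j: "scal i f = monom a j" using monom_factor[OF eq assms(2)] by blast
  have "scal i g * scal i f = monom (f * g) r" using eq by (simp only: mult.commute[of "scal i g"])
  then obtain b l where l: "scal i g = monom b l" using monom_factor assms(2) by blast
  have f: "hom_deg i f j" and g: "hom_deg i g l" using j l hom_degI_scal by blast+
  have "j + l = r" using hom_deg_unique[OF assms(2) hom_deg_mult[OF f g] assms(1)] .
  then show ?thesis using f g by (intro exI[of _ j]) auto
qed

lemma hom_deg_0_vars:
  assumes "hom_deg i f 0" "v \<in> vars f"
  shows "row_of v \<noteq> i"
proof
  assume v: "row_of v = i"
  obtain e where e: "e \<in> kys f" "v \<in> kys e" using assms(2) by (auto simp: vars_def)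
  then have "(\<Sum>v\<in>kys e. if row_of v = i then lk e v else 0) = 0"
    using assms(1) by (simp add: hom_deg_def udeg_def)
  then have "\<forall>a\<in>kys e. (if row_of a = i then lk e a else 0) = 0" by (simp only: sum_eq_0_iff finite_keys)
  then have "(if row_of v = i then lk e v else 0) = 0" using e(2) by (rule bspec)
  then have "lk e v = 0" using v by simp
  then show False using e by (simp add: in_keys_iff)
qed

text \<open>
  On a line in the coefficients of the form \<open>i\<close>, the degree in the parameter is at most the
  homogeneous degree.
\<close>

lemma hom_deg_degree_bound:
  fixes P :: "uvar \<Rightarrow> 'a::comm_ring_1 poly"
  assumes h: "hom_deg i f r" and P: "\<And>v. row_of v = i \<Longrightarrow> degree (P v) \<le> 1" "\<And>v. row_of v \<noteq> i \<Longrightarrow> degree (P v) = 0"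
  shows "degree (ev P f) \<le> r"
  unfolding ins_def
proof (rule degree_sum_le)
  fix e assume e: "e \<in> kys f"
  have "degree (P v ^ lk e v) \<le> (if row_of v = i then lk e v else 0)" for v
  proof -
    have "degree (P v ^ lk e v) \<le> degree (P v) * lk e v" by (rule degree_power_le)
    also have "\<dots> \<le> (if row_of v = i then lk e v else 0)" using P[of v] by auto
    finally show ?thesis .
  qed
  then have "degree (mono_val P e) \<le> udeg i e"
    unfolding mono_val_def udeg_def
    by (intro order.trans[OF degree_prod_sum_le] sum_mono) auto
  moreover have "degree (of_int (lk f e) * mono_val P e) \<le> degree (of_int (lk f e) :: 'a poly) + degree (mono_val P e)"
    by (rule degree_mult_le)
  moreover have "degree (of_int (lk f e) :: 'a poly) = 0" by simp
  moreover have "udeg i e = r" using h e by (simp add: hom_deg_def)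
  ultimately show "degree (of_int (lk f e) * mono_val P e) \<le> r" by linarith
qed simp

text \<open>
  Each row is linear in the coefficients of its own form.
\<close>

lemma hom_deg_idet_mac_entry:
  assumes J: "finite J"
  shows "hom_deg i (idet (mons J \<nu>) (mac_entry d b gen_coeff)) (card {c\<in>mons J \<nu>. b c = i})"
proof -
  let ?S = "mons J \<nu>"
  let ?s = "\<lambda>c. monom 1 (if b c = i then 1 else 0) :: cring poly"
  have "scal i (idet ?S (mac_entry d b gen_coeff)) = idet ?S (\<lambda>c c'. scal i (mac_entry d b gen_coeff c c'))"
    by (rule idet_hom[OF scal_hom])
  also have "\<dots> = idet ?S (\<lambda>c c'. ?s c * [:mac_entry d b gen_coeff c c':])"
    using J by (intro idet_cong)
      (auto simp: mac_entry_def shiftc_def gen_coeff_def scal_def scal.hom_zero smult_monom mult_monom simp flip: monom_0)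
  also have "\<dots> = (\<Prod>c\<in>?S. ?s c) * idet ?S (\<lambda>c c'. [:mac_entry d b gen_coeff c c':])"
    using J by (intro idet_scale_rows) simp
  also have "idet ?S (\<lambda>c c'. [:mac_entry d b gen_coeff c c':]) = [:idet ?S (mac_entry d b gen_coeff):]"
    by (rule idet_hom[OF const_poly_hom, symmetric])
  also have "(\<Prod>c\<in>?S. ?s c) = monom 1 (\<Sum>c\<in>?S. if b c = i then 1 else 0)"
    by (simp add: monom_prod)
  also have "(\<Sum>c\<in>?S. if b c = i then 1 else 0) = card {c\<in>?S. b c = i}"
    using J by (simp add: sum.If_cases Int_def)
  finally show ?thesis by (intro hom_degI_scal) (simp add: mult_monom flip: monom_0)
qed

text \<open>
  The form \<open>i\<close> is used only for monomials that no other form can serve.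
\<close>

definition avoids :: "nat set \<Rightarrow> (nat \<Rightarrow> nat) \<Rightarrow> nat \<Rightarrow> nat \<Rightarrow> (expo \<Rightarrow> nat) \<Rightarrow> bool" where
  "avoids J d \<nu> i b \<longleftrightarrow> (\<forall>c\<in>mons J \<nu>. b c = i \<longrightarrow> (\<forall>j\<in>J - {i}. lk c j < d j))"

text \<open>
  A monomial of this kind is determined by its exponents at the other indices, as the degree is given.
\<close>

lemma card_avoids:
  assumes J: "finite J" "i \<in> J" and b: "avoids J d \<nu> i b"
  shows "card {c\<in>mons J \<nu>. b c = i} \<le> (\<Prod>j\<in>J - {i}. d j)"
proof -
  let ?T = "{c\<in>mons J \<nu>. b c = i}" and ?f = "\<lambda>c. restrict (lk c) (J - {i})"
  have "inj_on ?f ?T"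
  proof (rule inj_onI, rule poly_mapping_eqI)
    fix c c' :: expo and j assume c: "c \<in> ?T" "c' \<in> ?T" and eq: "?f c = ?f c'"
    have same: "lk c j = lk c' j" if "j \<in> J - {i}" for j using fun_cong[OF eq, of j] that by simp
    have "lk c i + (\<Sum>j\<in>J - {i}. lk c j) = lk c' i + (\<Sum>j\<in>J - {i}. lk c' j)"
      using c J sum.remove[of J i "lk c"] sum.remove[of J i "lk c'"] by (simp add: mons_def)
    then have "lk c i = lk c' i" using same by simp
    then show "lk c j = lk c' j"
      using same[of j] c lookup_outside[of c J j] lookup_outside[of c' J j] by (cases "j \<in> J"; cases "j = i") (auto simp: mons_def)
  qed
  moreover have "?f ` ?T \<subseteq> (\<Pi>\<^sub>E j\<in>J - {i}. {..<d j})"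
    using b unfolding avoids_def by (intro image_subsetI restrict_PiE_iff[THEN iffD2]) blast
  ultimately have "card ?T \<le> card (\<Pi>\<^sub>E j\<in>J - {i}. {..<d j})"
    using J by (intro card_inj_on_le[of ?f]) (auto intro!: finite_PiE)
  also have "\<dots> = (\<Prod>j\<in>J - {i}. d j)" using J by (simp add: card_PiE)
  finally show ?thesis .
qed

lemma exists_avoiding_assignment:
  assumes J: "finite J" "i \<in> J" and \<nu>: "crit J d \<le> \<nu>"
  shows "\<exists>b. assignment J d \<nu> b \<and> avoids J d \<nu> i b"
proof -
  define b where "b c = (if \<exists>j\<in>J - {i}. d j \<le> lk c j then SOME j. j \<in> J - {i} \<and> d j \<le> lk c j else i)" for c
  have b: "b c \<in> J - {i} \<and> d (b c) \<le> lk c (b c)" if "\<exists>j\<in>J - {i}. d j \<le> lk c j" for c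
    using that someI_ex[of "\<lambda>j. j \<in> J - {i} \<and> d j \<le> lk c j"] by (auto simp: b_def)
  have "assignment J d \<nu> b" unfolding assignment_def
  proof
    fix c assume c: "c \<in> mons J \<nu>"
    show "b c \<in> J \<and> d (b c) \<le> lk c (b c)"
    proof (cases "\<exists>j\<in>J - {i}. d j \<le> lk c j")
      case True
      then show ?thesis using b by blast
    next
      case False
      then have "b c = i" by (simp add: b_def)
      moreover have "d i \<le> lk c i" using crit_not_reduced[OF J(1) c \<nu>] False by blast
      ultimately show ?thesis using J by simp
    qed
  qed
  moreover have "avoids J d \<nu> i b"
    unfolding avoids_def using b by (metis Diff_iff insertI1 not_le)
  ultimately show ?thesis by blast
qed

text \<open>
  The coefficients \<open>x\<^sup>j\<close> work for all but finitely many \<open>x\<close>.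
\<close>

lemma exists_separating_form:
  fixes T :: "(nat \<Rightarrow> complex) set"
  assumes "finite T" "finite K" "\<forall>a\<in>T. \<forall>b\<in>T. a \<noteq> b \<longrightarrow> (\<exists>j\<in>K. a j \<noteq> b j)"
  shows "\<exists>l. inj_on (\<lambda>a. \<Sum>j\<in>K. l j * a j) T"
proof -
  define p where "p a = (\<Sum>j\<in>K. monom (a j) j)" for a :: "nat \<Rightarrow> complex"
  let ?D = "{(a, b). a \<in> T \<and> b \<in> T \<and> a \<noteq> b}"
  have fin: "finite ?D" by (rule finite_subset[of _ "T \<times> T"]) (use assms in auto)
  have "p a - p b \<noteq> 0" if ab: "(a, b) \<in> ?D" for a b
  proof -
    obtain j where j: "j \<in> K" "a j \<noteq> b j" using assms(3) ab by auto
    have "coeff (p c) j = c j" for c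
      using j(1) assms(2) by (simp add: p_def coeff_sum coeff_monom)
    then show ?thesis using j by (metis eq_iff_diff_eq_0)
  qed
  then have "(\<Prod>(a, b)\<in>?D. p a - p b) \<noteq> 0" using fin by (auto simp: prod_zero_iff)
  then have "finite {x. poly (\<Prod>(a, b)\<in>?D. p a - p b) x = 0}" by (rule poly_roots_finite)
  then obtain x where "poly (\<Prod>(a, b)\<in>?D. p a - p b) x \<noteq> 0"
    using infinite_UNIV_char_0[where 'a = complex] by (metis (mono_tags, lifting) UNIV_eq_I mem_Collect_eq)
  then have x: "poly (p a) x \<noteq> poly (p b) x" if "a \<in> T" "b \<in> T" "a \<noteq> b" for a b
    using fin that by (force simp: poly_prod prod_zero_iff case_prod_beta)
  have "poly (p a) x = (\<Sum>j\<in>K. x ^ j * a j)" for a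
    by (simp add: p_def poly_sum poly_monom mult.commute)
  then have "inj_on (\<lambda>a. \<Sum>j\<in>K. x ^ j * a j) T" using x by (auto intro!: inj_onI)
  then show ?thesis by blast
qed

lemma form_val_two_terms:
  assumes J: "finite J" and c: "c1 \<in> mons J k" "c2 \<in> mons J k" "c1 \<noteq> c2"
  shows "form_val J k (\<lambda>c. if c = c1 then x else if c = c2 then y else 0) z = x * mono_val z c1 + y * mono_val z c2"
proof -
  have "form_val J k (\<lambda>c. if c = c1 then x else if c = c2 then y else 0) z
      = (\<Sum>c\<in>mons J k. (if c = c1 then x * mono_val z c else 0) + (if c = c2 then y * mono_val z c else 0))"
    unfolding form_val_def using c(3) by (intro sum.cong refl) auto
  then show ?thesis using J c by (simp add: sum.distrib)
qed

text \<open>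
  The forms \<open>t\<^sub>j\<^bsup>d\<^sub>j\<^esup> - t\<^sub>i\<^bsup>d\<^sub>j\<^esup>\<close> have as common zeros the points with \<open>t\<^sub>i = 1\<close> whose other
  coordinates are roots of unity. The form \<open>i\<close> is \<open>t\<^sub>i\<^bsup>d\<^sub>i-1\<^esup>\<close> times a linear form that separates these
  points, plus \<open>s t\<^sub>i\<^bsup>d\<^sub>i\<^esup>\<close>. The system has a zero for exactly one value of \<open>s\<close> per point, so the
  resultant is a polynomial in \<open>s\<close> with that many roots.
\<close>

lemma res_degree_lower_bound:
  assumes J: "finite J" "i \<in> J" and d: "\<And>j. j \<in> J \<Longrightarrow> 0 < d j" and R: "is_res J d R" and h: "hom_deg i R r"
  shows "(\<Prod>j\<in>J - {i}. d j) \<le> r"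
proof -
  let ?K = "J - {i}"
  define T where "T = (\<Pi>\<^sub>E j\<in>?K. {z :: complex. z ^ d j = 1})"
  have "finite {z :: complex. z ^ d j = 1}" if "j \<in> ?K" for j
    using d[of j] that by (intro finite_roots_unity) auto
  then have finT: "finite T" unfolding T_def using J by (intro finite_PiE) auto
  have cardT: "card T = (\<Prod>j\<in>?K. d j)"
  proof -
    have "card {z :: complex. z ^ d j = 1} = d j" if "j \<in> ?K" for j
      using d[of j] that by (intro card_roots_unity_eq) auto
    then show ?thesis unfolding T_def using J by (subst card_PiE) (auto intro!: prod.cong)
  qed
  have sep: "\<forall>a\<in>T. \<forall>b\<in>T. a \<noteq> b \<longrightarrow> (\<exists>j\<in>?K. a j \<noteq> b j)"
    using PiE_ext unfolding T_def by blast
  have "finite ?K" using J by simp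
  from exists_separating_form[OF finT this sep] obtain l where l: "inj_on (\<lambda>a. \<Sum>j\<in>?K. l j * a j) T"
    by (elim exE)
  define cm where "cm j = sgl i (d i - 1) + sgl j 1" for j
  have cm: "cm j \<in> mons J (d i)" if "j \<in> ?K" for j
    using mons_add[OF sgl_mem_mons[OF J, of "d i - 1"] sgl_mem_mons[of J j 1]] J d[of i] that by (simp add: cm_def)
  have cm_inj: "inj_on cm ?K" "\<And>j. j \<in> ?K \<Longrightarrow> cm j \<noteq> sgl i (d i)"
  proof -
    have lkcm: "lk (cm j) j' = (if j' = j then 1 else 0)" if "j' \<noteq> i" for j j'
      using that by (simp add: cm_def lookup_add lookup_single when_def)
    show "inj_on cm ?K"
    proof (rule inj_onI)
      fix j j' assume j: "j \<in> ?K" "j' \<in> ?K" and eq: "cm j = cm j'"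
      have "lk (cm j) j = 1" "lk (cm j') j = (if j = j' then 1 else 0)"
        using lkcm[of j j] lkcm[of j j'] j by simp_all
      then show "j = j'" using eq by (metis zero_neq_one)
    qed
    show "cm j \<noteq> sgl i (d i)" if "j \<in> ?K" for j
    proof
      assume "cm j = sgl i (d i)"
      then have "lk (cm j) j = 0" using that by (simp add: lookup_single when_def)
      then show False using lkcm[of j j] that by simp
    qed
  qed
  define F where "F s j c = (if j = i then (if c = sgl i (d i) then s else if c \<in> cm ` ?K then l (the_inv_into ?K cm c) else 0)
      else if c = sgl j (d j) then 1 else if c = sgl i (d j) then - 1 else 0)" for s :: complex and j c
  have Fi: "form_val J (d i) (F s i) z = z i ^ (d i - 1) * (\<Sum>j\<in>?K. l j * z j) + s * z i ^ d i" for s z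
  proof -
    let ?m = "mons J (d i)"
    have mem: "sgl i (d i) \<in> ?m" by (rule sgl_mem_mons[OF J])
    have "form_val J (d i) (F s i) z = s * z i ^ d i + (\<Sum>c\<in>?m - {sgl i (d i)}. F s i c * mono_val z c)"
      unfolding form_val_def using J mem by (subst sum.remove[of _ "sgl i (d i)"]) (auto simp: F_def)
    also have "(\<Sum>c\<in>?m - {sgl i (d i)}. F s i c * mono_val z c) = (\<Sum>c\<in>cm ` ?K. F s i c * mono_val z c)"
      using J cm cm_inj(2) by (intro sum.mono_neutral_right) (auto simp: F_def)
    also have "\<dots> = (\<Sum>j\<in>?K. F s i (cm j) * mono_val z (cm j))"
      using cm_inj(1) by (subst sum.reindex) auto
    also have "\<dots> = (\<Sum>j\<in>?K. l j * (z i ^ (d i - 1) * z j))"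
    proof (rule sum.cong[OF refl])
      fix j assume j: "j \<in> ?K"
      have "F s i (cm j) = l j"
        using j cm_inj(2)[OF j] the_inv_into_f_f[OF cm_inj(1) j] by (simp add: F_def)
      moreover have "mono_val z (cm j) = z i ^ (d i - 1) * z j" by (simp add: cm_def mono_val_add)
      ultimately show "F s i (cm j) * mono_val z (cm j) = l j * (z i ^ (d i - 1) * z j)" by simp
    qed
    finally show ?thesis by (simp add: sum_distrib_left ac_simps)
  qed
  have Fj: "form_val J (d j) (F s j) z = z j ^ d j - z i ^ d j" if "j \<in> ?K" for s z j
  proof -
    have "sgl j (d j) \<noteq> sgl i (d j)"
    proof
      assume "sgl j (d j) = sgl i (d j)"
      then have "lk (sgl j (d j)) j = lk (sgl i (d j)) j" by simp
      then show False using that d[of j] by (simp add: lookup_single when_def)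
    qed
    moreover have "F s j = (\<lambda>c. if c = sgl j (d j) then 1 else if c = sgl i (d j) then - 1 else 0)"
      using that by (auto simp: F_def)
    ultimately show ?thesis
      using form_val_two_terms[OF J(1) sgl_mem_mons[of J j "d j"] sgl_mem_mons[OF J, of "d j"], of 1 "-1" z] J that by simp
  qed
  let ?V = "(\<lambda>a. - (\<Sum>j\<in>?K. l j * a j)) ` T"
  have zero_V: "has_zero J d (F s)" if "s \<in> ?V" for s
  proof -
    obtain a where a: "a \<in> T" "s = - (\<Sum>j\<in>?K. l j * a j)" using \<open>s \<in> ?V\<close> by blast
    let ?z = "a(i := 1)"
    have "(\<Sum>j\<in>?K. l j * ?z j) = (\<Sum>j\<in>?K. l j * a j)" by (intro sum.cong) auto
    then have "form_val J (d i) (F s i) ?z = 0" using a by (simp add: Fi)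
    moreover have "form_val J (d j) (F s j) ?z = 0" if "j \<in> ?K" for j
      using a that by (simp add: Fj[OF that]) (auto simp: T_def PiE_iff)
    ultimately show ?thesis by (intro has_zeroI[of i J ?z]) (use J in auto)
  qed
  have V_zero: "s \<in> ?V" if hz: "has_zero J d (F s)" for s
  proof -
    obtain z where z: "\<exists>j\<in>J. z j \<noteq> 0" "\<And>j. j \<in> J \<Longrightarrow> form_val J (d j) (F s j) z = 0"
      using hz unfolding has_zero_def by blast
    have zj: "z j ^ d j = z i ^ d j" if "j \<in> ?K" for j using z(2)[of j] Fj[OF that] that by simp
    have zi: "z i \<noteq> 0"
    proof
      assume "z i = 0"
      then have "z j = 0" if "j \<in> ?K" for j using zj[OF that] d[of j] that by (simp add: zero_power)
      then show False using z(1) \<open>z i = 0\<close> by blast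
    qed
    define a where "a = restrict (\<lambda>j. z j / z i) ?K"
    have "a \<in> T" using zj zi by (auto simp: a_def T_def power_divide)
    have "0 = z i ^ (d i - 1) * (\<Sum>j\<in>?K. l j * z j) + s * z i ^ d i" using z(2)[OF J(2)] Fi by simp
    also have "(\<Sum>j\<in>?K. l j * z j) = z i * (\<Sum>j\<in>?K. l j * a j)"
      unfolding sum_distrib_left using zi by (intro sum.cong refl) (simp add: a_def)
    also have "z i ^ (d i - 1) * (z i * (\<Sum>j\<in>?K. l j * a j)) + s * z i ^ d i = z i ^ d i * ((\<Sum>j\<in>?K. l j * a j) + s)"
      using d[OF J(2)] by (simp add: algebra_simps power_eq_if)
    finally have "s = - (\<Sum>j\<in>?K. l j * a j)" using zi by (simp add: eq_neg_iff_add_eq_0 add.commute)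
    then show ?thesis using \<open>a \<in> T\<close> by blast
  qed
  define P where "P = at_coeffs (\<lambda>j c. if j = i \<and> c = sgl i (d i) then [:0, 1:] else [:F 0 j c:])"
  have P: "poly (ev P R) s = ev (at_coeffs (F s)) R" for s
  proof -
    have "(\<lambda>j c. poly (if j = i \<and> c = sgl i (d i) then [:0, 1:] else [:F 0 j c:]) s) = F s"
      by (auto simp: F_def fun_eq_iff)
    then show ?thesis unfolding P_def poly_ev_at_coeffs by simp
  qed
  have roots: "poly (ev P R) s = 0 \<longleftrightarrow> s \<in> ?V" for s
    unfolding P res_vanishes_iff[OF J(1) R] using zero_V V_zero by blast
  have "finite ?V" using finT by simp
  then obtain s0 where "s0 \<notin> ?V" using infinite_UNIV_char_0[where 'a = complex] by (metis UNIV_eq_I)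
  then have "ev P R \<noteq> 0" using roots[of s0] by auto
  have "inj_on (\<lambda>a. - (\<Sum>j\<in>?K. l j * a j)) T" using l by (auto simp: inj_on_def)
  then have "(\<Prod>j\<in>?K. d j) = card ?V" using cardT by (simp add: card_image)
  also have "?V = {s. poly (ev P R) s = 0}" using roots by blast
  also have "card \<dots> \<le> degree (ev P R)" by (rule card_poly_roots_bound[OF \<open>ev P R \<noteq> 0\<close>])
  also have "\<dots> \<le> r"
  proof (rule hom_deg_degree_bound[OF h])
    show "degree (P v) \<le> 1" for v by (cases v) (simp add: P_def)
    show "degree (P v) = 0" if "row_of v \<noteq> i" for v using that by (cases v) (simp add: P_def)
  qed
  finally show ?thesis .
qed

text \<open>
  The two bounds meet, for the resultant and for the number of rows of a Macaulay matrix that use the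
  form \<open>i\<close>. Nothing is left for the cofactor \<open>E\<close>.
\<close>

theorem res_degree:
  assumes J: "finite J" "i \<in> J" and d: "\<And>j. j \<in> J \<Longrightarrow> 0 < d j" and R: "is_res J d R"
  shows "hom_deg i R (\<Prod>j\<in>J - {i}. d j)"
    and "\<lbrakk>crit J d \<le> \<nu>; assignment J d \<nu> b; avoids J d \<nu> i b; idet (mons J \<nu>) (mac_entry d b gen_coeff) = R * E\<rbrakk>
      \<Longrightarrow> hom_deg i E 0"
proof -
  have cofactor: "hom_deg i R (\<Prod>j\<in>J - {i}. d j) \<and> hom_deg i E 0"
    if b: "assignment J d \<nu> b" "avoids J d \<nu> i b" and E: "idet (mons J \<nu>) (mac_entry d b gen_coeff) = R * E" for \<nu> b E
  proof -
    let ?k = "card {c\<in>mons J \<nu>. b c = i}"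
    have "ev (at_coeffs (pure d)) (idet (mons J \<nu>) (mac_entry d b gen_coeff)) = (1 :: complex)"
      unfolding ev_mac_entry by (rule idet_mac_entry_pure[OF J(1) b(1) subset_refl])
    then have nz: "R * E \<noteq> 0" using E by (auto simp: ev.hom_zero)
    have "hom_deg i (R * E) ?k" using hom_deg_idet_mac_entry[OF J(1), of i \<nu> d b] E by simp
    from hom_deg_factor[OF this nz] obtain s where s: "s \<le> ?k" "hom_deg i R s" "hom_deg i E (?k - s)" by blast
    have "(\<Prod>j\<in>J - {i}. d j) \<le> s" using res_degree_lower_bound[of J i d R s] J d R s(2) by blast
    moreover have "?k \<le> (\<Prod>j\<in>J - {i}. d j)" by (rule card_avoids[OF J b(2)])
    ultimately have "s = (\<Prod>j\<in>J - {i}. d j)" "?k - s = 0" using s(1) by linarith+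
    then show ?thesis using s(2,3) by metis
  qed
  obtain b0 where b0: "assignment J d (crit J d) b0" "avoids J d (crit J d) i b0"
    using exists_avoiding_assignment[OF J, of d "crit J d"] by auto
  have "idet (mons J (crit J d)) (mac_entry d b0 gen_coeff) \<in> inertia J d" by (rule mac_entry_in_inertia[OF J(1) b0(1)])
  then obtain E' where "idet (mons J (crit J d)) (mac_entry d b0 gen_coeff) = R * E'"
    using R unfolding is_res_def dvd_def by blast
  then show "hom_deg i R (\<Prod>j\<in>J - {i}. d j)" using cofactor[OF b0] by blast
  show "\<lbrakk>crit J d \<le> \<nu>; assignment J d \<nu> b; avoids J d \<nu> i b; idet (mons J \<nu>) (mac_entry d b gen_coeff) = R * E\<rbrakk>
      \<Longrightarrow> hom_deg i E 0"
    using cofactor by blast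
qed

section \<open>Setting one form to a pure power\<close>

definition set_pure :: "(nat \<Rightarrow> nat) \<Rightarrow> nat \<Rightarrow> (nat \<Rightarrow> expo \<Rightarrow> 'a) \<Rightarrow> nat \<Rightarrow> expo \<Rightarrow> 'a::{zero,one}" where
  "set_pure d k F = F(k := pure d k)"

definition spec :: "(nat \<Rightarrow> nat) \<Rightarrow> nat \<Rightarrow> cring \<Rightarrow> cring" where
  "spec d k = ev (at_coeffs (set_pure d k gen_coeff))"

lemma spec_hom: "comm_ring_hom (spec d k)"
  unfolding spec_def by (rule ev_hom)

interpretation spec: comm_ring_hom "spec d k" for d k
  by (rule spec_hom)

lemma ev_spec: "ev (at_coeffs F) (spec d k f) = ev (at_coeffs (set_pure d k F)) f"
proof -
  have "ev (at_coeffs F) (spec d k f) = ev (\<lambda>v. ev (at_coeffs F) (at_coeffs (set_pure d k gen_coeff) v)) f"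
    unfolding spec_def by (rule hom_ev[OF ev_hom])
  also have "(\<lambda>v. ev (at_coeffs F) (at_coeffs (set_pure d k gen_coeff) v)) = at_coeffs (\<lambda>i c. ev (at_coeffs F) (set_pure d k gen_coeff i c))"
    by (rule hom_at_coeffs)
  also have "(\<lambda>i c. ev (at_coeffs F) (set_pure d k gen_coeff i c)) = set_pure d k F"
    by (auto simp: fun_eq_iff set_pure_def pure_def gen_coeff_def ev.hom_one ev.hom_zero)
  finally show ?thesis .
qed

lemma mons_remove:
  assumes "finite J" "k \<in> J"
  shows "mons (J - {k}) m = {c\<in>mons J m. lk c k = 0}"
proof -
  have "kys c \<subseteq> J - {k} \<longleftrightarrow> kys c \<subseteq> J \<and> lk c k = 0" for c :: expo
    by (auto simp: in_keys_iff)
  moreover have "(\<Sum>j\<in>J. lk c j) = lk c k + (\<Sum>j\<in>J - {k}. lk c j)" for c :: expo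
    using assms by (rule sum.remove)
  ultimately show ?thesis by (auto simp: mons_def)
qed

lemma form_val_remove:
  assumes "finite J" "k \<in> J" "z k = 0"
  shows "form_val J m a z = form_val (J - {k}) m a z"
  unfolding form_val_def
proof (rule sum.mono_neutral_right)
  show "\<forall>c\<in>mons J m - mons (J - {k}) m. a c * mono_val z c = 0"
  proof
    fix c assume "c \<in> mons J m - mons (J - {k}) m"
    then have c: "c \<in> mons J m" "lk c k \<noteq> 0" using mons_remove[OF assms(1,2)] by auto
    have "mono_val z c = (\<Prod>j\<in>J. z j ^ lk c j)"
      using c assms by (intro mono_val_superset) (auto simp: mons_def)
    also have "\<dots> = 0" using assms c(2) by (subst prod.remove[of J k]) (auto simp: zero_power)
    finally show "a c * mono_val z c = 0" by simp
  qed
qed (use assms mons_remove[OF assms(1,2)] in auto)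

lemma form_val_cong: "finite J \<Longrightarrow> (\<And>j. j \<in> J \<Longrightarrow> z j = z' j) \<Longrightarrow> form_val J m a z = form_val J m a z'"
  unfolding form_val_def by (intro sum.cong refl arg_cong2[of _ _ _ _ "(*)"] mono_val_cong) (auto simp: mons_def)

text \<open>
  A zero of \<open>t\<^sub>k\<^bsup>d\<^sub>k\<^esup>\<close> has \<open>t\<^sub>k = 0\<close>.
\<close>

lemma has_zero_set_pure:
  assumes J: "finite J" "k \<in> J" and d: "0 < d k"
  shows "has_zero J d (set_pure d k F) \<longleftrightarrow> has_zero (J - {k}) d F"
proof
  assume "has_zero J d (set_pure d k F)"
  then obtain z j where z: "j \<in> J" "z j \<noteq> 0" "\<And>i. i \<in> J \<Longrightarrow> form_val J (d i) (set_pure d k F i) z = 0"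
    unfolding has_zero_def by blast
  have "form_val J (d k) (\<lambda>c. if c = sgl k (d k) then 1 else 0) z = 0"
    using z(3)[OF J(2)] by (simp add: set_pure_def pure_def[abs_def])
  then have zk: "z k = 0" using form_val_pure[OF J, of "d k" 1 z] by simp
  have "form_val (J - {k}) (d i) (F i) z = 0" if "i \<in> J - {k}" for i
    using z(3)[of i] that form_val_remove[of J k z "d i" "F i"] J zk by (simp add: set_pure_def)
  moreover have "j \<in> J - {k}" using z(1,2) zk by auto
  ultimately show "has_zero (J - {k}) d F" using z(2) by (intro has_zeroI)
next
  assume "has_zero (J - {k}) d F"
  then obtain z j where z: "j \<in> J - {k}" "z j \<noteq> 0" "\<And>i. i \<in> J - {k} \<Longrightarrow> form_val (J - {k}) (d i) (F i) z = 0"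
    unfolding has_zero_def by blast
  let ?z = "z(k := 0)"
  have "form_val J (d i) (set_pure d k F i) ?z = 0" if i: "i \<in> J" for i
  proof (cases "i = k")
    case True
    then show ?thesis using form_val_pure[OF J, of "d k" 1 ?z] d
      by (simp add: set_pure_def pure_def[abs_def] zero_power)
  next
    case False
    have "form_val J (d i) (F i) ?z = form_val (J - {k}) (d i) (F i) ?z"
      using J by (intro form_val_remove) auto
    also have "\<dots> = form_val (J - {k}) (d i) (F i) z"
      using J by (intro form_val_cong) auto
    finally show ?thesis using z(3) i False by (simp add: set_pure_def)
  qed
  moreover have "?z j \<noteq> 0" using z by auto
  ultimately show "has_zero J d (set_pure d k F)" using z(1) by (intro has_zeroI[of j J ?z]) auto
qed

lemma hom_deg_spec:
  assumes "hom_deg i f r" "i \<noteq> k"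
  shows "hom_deg i (spec d k f) r"
proof -
  let ?b = "\<lambda>v. if row_of v = i then monom (Var v :: cring) 1 else [:Var v:]"
  have "scal i (spec d k f) = ev (\<lambda>v. scal i (at_coeffs (set_pure d k gen_coeff) v)) f"
    unfolding spec_def by (rule hom_ev[OF scal_hom])
  also have "(\<lambda>v. scal i (at_coeffs (set_pure d k gen_coeff) v)) = (\<lambda>v. map_poly (spec d k) (?b v))"
  proof
    fix v
    obtain j c where v: "v = U j c" by (cases v)
    have sv: "spec d k (Var v) = set_pure d k gen_coeff j c" unfolding spec_def v by simp
    show "scal i (at_coeffs (set_pure d k gen_coeff) v) = map_poly (spec d k) (?b v)"
    proof (cases "j = k")
      case True
      then show ?thesis using assms(2) sv unfolding v
        by (simp add: map_poly_const spec.hom_zero set_pure_def pure_def scal.hom_one scal.hom_zero one_pCons)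
    next
      case False
      then show ?thesis using sv unfolding v
        by (cases "j = i")
          (simp_all add: map_poly_const map_poly_monom spec.hom_zero set_pure_def gen_coeff_def scal_def)
    qed
  qed
  also have "ev (\<lambda>v. map_poly (spec d k) (?b v)) f = map_poly (spec d k) (scal i f)"
    unfolding scal_def by (rule hom_ev[OF map_poly_hom[OF spec_hom], symmetric])
  also have "\<dots> = monom (spec d k f) r"
    using assms(1) by (simp add: hom_deg_iff_scal map_poly_monom spec.hom_zero)
  finally show ?thesis by (simp add: hom_deg_iff_scal)
qed

text \<open>
  The degree bounds the exponent.
\<close>

lemma multiplicity_decomposition:
  fixes p f :: cring
  assumes deg: "hom_deg i p r" "0 < r" "hom_deg i f s" and nz: "p \<noteq> 0" "f \<noteq> 0"
  shows "\<exists>m g. f = p ^ m * g \<and> \<not> p dvd g"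
proof -
  have bound: "m \<le> s" if "p ^ m dvd f" for m
  proof -
    obtain g where g: "f = p ^ m * g" using \<open>p ^ m dvd f\<close> by (rule dvdE)
    then obtain t where t: "t \<le> s" "hom_deg i (p ^ m) t" using hom_deg_factor[of i "p ^ m" g s] deg(3) nz(2) by auto
    have "t = m * r" using hom_deg_unique[OF _ t(2) hom_deg_power[OF deg(1)]] nz(1) by simp
    moreover have "m \<le> m * r" using deg(2) by simp
    ultimately show ?thesis using t(1) by linarith
  qed
  let ?m = "GREATEST m. p ^ m dvd f"
  have ex: "p ^ 0 dvd f" by simp
  have "p ^ ?m dvd f" by (rule GreatestI_nat[where P = "\<lambda>m. p ^ m dvd f", OF ex bound])
  then obtain g where g: "f = p ^ ?m * g" by (rule dvdE)
  have "\<not> p dvd g"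
  proof
    assume "p dvd g"
    then obtain h where "g = p * h" by (rule dvdE)
    then have "f = p ^ Suc ?m * h" using g by (simp add: ac_simps)
    then have "p ^ Suc ?m dvd f" by (rule dvdI)
    then have "Suc ?m \<le> ?m" by (rule Greatest_le_nat[where P = "\<lambda>m. p ^ m dvd f", OF _ bound])
    then show False by simp
  qed
  then show ?thesis using g by blast
qed

text \<open>
  A case of the Nullstellensatz. An irreducible factor \<open>g\<close> of \<open>G\<close> is coprime to \<open>R\<close>,
  so eliminating a variable \<open>v\<close> of \<open>g\<close> gives a nonzero combination of \<open>g\<close> and \<open>R\<close> without \<open>v\<close>. Over a
  generic choice of the other variables, \<open>g\<close> has a zero in \<open>v\<close>; there \<open>R\<close> vanishes too, but the
  combination does not. The value 1 at \<open>a0\<close> excludes constant factors.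
\<close>

lemma dominated_hypersurface:
  fixes G R :: cring
  assumes R: "irreducible R" "\<not> R dvd G" and G: "ev a0 G = (1 :: int)"
    and van: "\<And>a :: uvar \<Rightarrow> complex. ev a G = 0 \<Longrightarrow> ev a R = 0"
  shows "G dvd 1"
proof (rule ccontr)
  assume nu: "\<not> G dvd 1"
  have G0: "G \<noteq> 0"
  proof
    assume "G = 0"
    then have "ev a0 (0 :: cring) = (1 :: int)" using G by (simp only:)
    then show False unfolding ev.hom_zero by (rule zero_neq_one[THEN notE])
  qed
  obtain g where g: "irreducible g" "g dvd G" using exists_irreducible_factor[OF G0 nu] by blast
  have gnu: "\<not> g dvd 1" using g(1) by (simp add: irreducible_def)
  have "vars g \<noteq> {}"
  proof
    assume "vars g = {}"
    then obtain m where m: "g = of_int m" by (rule no_vars_of_int)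
    have "ev a0 g dvd (ev a0 G :: int)" using g(2) by (rule ev.hom_dvd)
    then have "ev a0 (of_int m :: cring) dvd (1 :: int)" unfolding G m .
    moreover have "ev a0 (of_int m :: cring) = m"
      using ev.hom_of_int[of a0 m] by (simp only: of_int_eq_id id_apply)
    ultimately have "m dvd 1" by (simp only:)
    then have "g dvd 1" using m of_int_dvd_iff_mpol[of m 1, where 'v = uvar] by simp
    then show False using gnu by blast
  qed
  then obtain v where v: "v \<in> vars g" by blast
  have "\<not> g dvd R"
  proof
    assume "g dvd R"
    then obtain h where h: "R = g * h" by (rule dvdE)
    then have "h dvd 1" using R(1) gnu unfolding irreducible_def by blast
    then have "h = 1 \<or> h = -1" by (rule unit_mpol_int)
    then have "R dvd g" using h by auto
    then show False using g(2) R(2) dvd_trans by blast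
  qed
  from elimination[OF g(1) v this] obtain \<alpha> \<beta>
    where c: "\<alpha> * g + \<beta> * R \<noteq> 0" "v \<notin> vars (\<alpha> * g + \<beta> * R)" by blast
  let ?c = "\<alpha> * g + \<beta> * R"
  let ?l = "lead_coeff (up v g)"
  have "g \<noteq> 0" using g(1) by (simp add: irreducible_def)
  then have "?c * ?l \<noteq> 0" using c(1) by simp
  then obtain a :: "uvar \<Rightarrow> complex" where "ev a (?c * ?l) \<noteq> 0" using exists_nonzero_point by blast
  then have a: "ev a ?c \<noteq> 0" "ev a ?l \<noteq> 0" by (auto simp: ev.hom_mult)
  let ?q = "map_poly (ev a) (up v g)"
  have "coeff ?q (degree (up v g)) \<noteq> 0" using a(2) by (simp add: coeff_map_poly ev.hom_zero)
  then have "degree (up v g) \<le> degree ?q" by (rule le_degree)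
  moreover have "degree (up v g) \<noteq> 0" using v by (simp add: degree_up_0_iff)
  ultimately have "\<not> constant (poly ?q)" using constant_degree by (metis le_zero_eq)
  then obtain s where "poly ?q s = 0" using fundamental_theorem_of_algebra by blast
  then have "ev (a(v := s)) g = 0" by (simp add: ev_upd)
  moreover have "ev (a(v := s)) g dvd ev (a(v := s)) G" using g(2) by (rule ev.hom_dvd)
  ultimately have "ev (a(v := s)) g = 0" "ev (a(v := s)) R = 0" using van[of "a(v := s)"] by auto
  then have "ev (a(v := s)) ?c = 0" by (simp add: ev.hom_add ev.hom_mult)
  moreover have "ev (a(v := s)) ?c = ev a ?c" using c(2) by (intro ins_cong) auto
  ultimately show False using a(1) by simp
qed

lemma ev_spec_pure: "ev (at_coeffs (pure d)) (spec d k f) = ev (at_coeffs (pure d)) f"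
  unfolding ev_spec by (simp add: set_pure_def)

text \<open>
  The two sides have the same zeros, so the left side is a power of \<open>R'\<close> up to a factor without zeros,
  which is a unit. The exponent is found by comparing the degrees in the coefficients of another form.
\<close>

lemma spec_res:
  assumes J: "finite J" "k \<in> J" "J - {k} \<noteq> {}" and d: "\<And>i. i \<in> J \<Longrightarrow> 0 < d i"
    and R: "is_res J d R" and R': "is_res (J - {k}) d R'"
  shows "spec d k R = R' ^ d k"
proof -
  let ?J = "J - {k}" and ?R0 = "spec d k R"
  obtain i where i: "i \<in> ?J" using J(3) by blast
  have fin: "finite ?J" using J by simp
  have d': "0 < d j" if "j \<in> ?J" for j using d that by blast
  have zeros: "ev a ?R0 = 0 \<longleftrightarrow> ev a R' = 0" for a :: "uvar \<Rightarrow> complex"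
  proof -
    let ?F = "\<lambda>i c. a (U i c)"
    have "ev (at_coeffs ?F) ?R0 = 0 \<longleftrightarrow> ev (at_coeffs ?F) R' = 0"
      unfolding ev_spec res_vanishes_iff[OF J(1) R] res_vanishes_iff[OF fin R']
      by (rule has_zero_set_pure[of J k d, OF J(1,2) d[OF J(2)]])
    then show ?thesis using at_coeffs_decomp[of a] by simp
  qed
  have one: "ev (at_coeffs (pure d)) ?R0 = (1 :: int)" "ev (at_coeffs (pure d)) R' = (1 :: int)"
    using R R' unfolding ev_spec_pure is_res_def by blast+
  have irr: "irreducible R'" using R' by (simp add: is_res_def)
  have nz: "R' \<noteq> 0" using irr by (simp add: irreducible_def)
  have R00: "?R0 \<noteq> 0"
  proof
    assume "?R0 = 0"
    then have "ev (at_coeffs (pure d)) (0 :: cring) = (1 :: int)" using one(1) by (simp only:)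
    then show False unfolding ev.hom_zero by (rule zero_neq_one[THEN notE])
  qed
  let ?\<delta> = "\<Prod>j\<in>?J - {i}. d j"
  have \<delta>: "0 < ?\<delta>" using d' by (intro prod_pos) auto
  have h': "hom_deg i R' ?\<delta>" using res_degree(1)[of ?J i d R'] fin i d' R' by blast
  have "hom_deg i R (\<Prod>j\<in>J - {i}. d j)" using res_degree(1)[of J i d R] J i d R by blast
  then have "hom_deg i ?R0 (\<Prod>j\<in>J - {i}. d j)" using i by (intro hom_deg_spec) auto
  also have "(\<Prod>j\<in>J - {i}. d j) = d k * ?\<delta>"
  proof -
    have "J - {i} - {k} = ?J - {i}" by blast
    then show ?thesis using J i prod.remove[of "J - {i}" k d] by auto
  qed
  finally have h0: "hom_deg i ?R0 (d k * ?\<delta>)" .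
  obtain m G where G: "?R0 = R' ^ m * G" "\<not> R' dvd G"
    using multiplicity_decomposition[OF h' \<delta> h0 nz R00] by blast
  have "ev (at_coeffs (pure d)) ?R0 = ev (at_coeffs (pure d)) R' ^ m * (ev (at_coeffs (pure d)) G :: int)"
    unfolding G(1) by (simp only: ev.hom_mult ev.hom_power)
  then have G1: "ev (at_coeffs (pure d)) G = (1 :: int)" unfolding one by simp
  have "ev a R' = 0" if "ev a G = 0" for a :: "uvar \<Rightarrow> complex"
    using that zeros[of a] G(1) by (simp add: ev.hom_mult)
  then have "G dvd 1" by (rule dominated_hypersurface[OF irr G(2) G1])
  then have "G = 1 \<or> G = -1" by (rule unit_mpol_int)
  moreover have "G \<noteq> -1"
  proof
    assume "G = -1"
    then have "ev (at_coeffs (pure d)) (-1 :: cring) = (1 :: int)" using G1 by (simp only:)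
    then have "(-1 :: int) = 1" unfolding ev.hom_uminus ev.hom_one .
    then show False by simp
  qed
  ultimately have R0: "?R0 = R' ^ m" using G(1) by simp
  have "hom_deg i ?R0 (m * ?\<delta>)" unfolding R0 by (rule hom_deg_power[OF h'])
  from hom_deg_unique[OF R00 this h0] have "m = d k" using \<delta> by simp
  then show ?thesis using R0 by simp
qed

text \<open>
  For empty \<open>J\<close> the value 1 lets the induction start there.
\<close>

definition res :: "nat set \<Rightarrow> (nat \<Rightarrow> nat) \<Rightarrow> cring" where
  "res J d = (if J = {} then 1 else SOME R. is_res J d R)"

lemma is_res_res:
  assumes "finite J" "J \<noteq> {}" "\<And>i. i \<in> J \<Longrightarrow> 0 < d i"
  shows "is_res J d (res J d)"
proof -
  have "\<exists>R. is_res J d R" using assms by (rule exists_res)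
  then have "is_res J d (SOME R. is_res J d R)" by (rule someI_ex)
  then show ?thesis using assms(2) by (simp add: res_def)
qed

lemma res_nonzero:
  assumes "finite J" "\<And>i. i \<in> J \<Longrightarrow> 0 < d i"
  shows "res J d \<noteq> 0"
proof (cases "J = {}")
  case False
  from is_res_res[OF assms(1) this assms(2)] show ?thesis by (simp add: is_res_def irreducible_def)
qed (simp add: res_def)

lemma spec_idet_mac_entry: "spec d k (idet S (mac_entry d b gen_coeff)) = idet S (mac_entry d b (set_pure d k gen_coeff))"
  unfolding spec_def by (rule ev_mac_entry)

text \<open>
  If \<open>k\<close> is the only index, the specialised Macaulay matrix is the identity.
\<close>

lemma spec_res_power:
  assumes J: "finite J" "k \<in> J" and d: "\<And>i. i \<in> J \<Longrightarrow> 0 < d i"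
  shows "spec d k (res J d) = res (J - {k}) d ^ d k"
proof (cases "J - {k} = {}")
  case False
  have "is_res J d (res J d)" using J d by (intro is_res_res) auto
  moreover have "is_res (J - {k}) d (res (J - {k}) d)" using J d False by (intro is_res_res) auto
  ultimately show ?thesis using spec_res[of J k d] J d False by blast
next
  case True
  then have Jk: "J = {k}" using J by blast
  let ?R = "res J d" and ?\<nu> = "crit J d"
  have R: "is_res J d ?R" using J d by (intro is_res_res) auto
  have asg: "assignment J d ?\<nu> (last_block J d)" using J by (intro assignment_last_block) auto
  have "?R dvd idet (mons J ?\<nu>) (mac_entry d (last_block J d) gen_coeff)"
    using R mac_entry_in_inertia[OF J(1) asg] unfolding is_res_def by blast
  then have "spec d k ?R dvd spec d k (idet (mons J ?\<nu>) (mac_entry d (last_block J d) gen_coeff))" by (rule spec.hom_dvd)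
  then have "spec d k ?R dvd idet (mons J ?\<nu>) (mac_entry d (last_block J d) (set_pure d k gen_coeff))"
    unfolding spec_idet_mac_entry .
  also have "\<dots> = 1"
  proof (rule idet_identity)
    show "finite (mons J ?\<nu>)" using J by simp
    show "mac_entry d (last_block J d) (set_pure d k gen_coeff) c c' = (if c' = c then 1 else 0)" if "c \<in> mons J ?\<nu>" for c c'
      using asg that Jk by (intro mac_entry_pure_row) (auto simp: assignment_def set_pure_def)
  qed
  finally have "spec d k ?R = 1 \<or> spec d k ?R = -1" by (rule unit_mpol_int)
  moreover have "spec d k ?R \<noteq> -1"
  proof
    assume "spec d k ?R = -1"
    moreover have "ev (at_coeffs (pure d)) (spec d k ?R) = (1 :: int)"
      using R unfolding ev_spec_pure is_res_def by blast
    ultimately have "ev (at_coeffs (pure d)) (-1 :: cring) = (1 :: int)" by (simp only:)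
    then have "(-1 :: int) = 1" unfolding ev.hom_uminus ev.hom_one .
    then show False by simp
  qed
  ultimately show ?thesis using True by (simp add: res_def)
qed

section \<open>The quotient of the Macaulay determinants\<close>

text \<open>
  Block triangularity with respect to a grading of the index set.
\<close>

lemma idet_graded:
  fixes a :: "'i::linorder \<Rightarrow> 'i \<Rightarrow> 'a::idom" and w :: "'i \<Rightarrow> nat"
  assumes T: "finite T" and a: "\<And>c c'. c \<in> T \<Longrightarrow> c' \<in> T \<Longrightarrow> w c' < w c \<Longrightarrow> a c c' = 0"
  shows "idet {c\<in>T. w c < n} a = (\<Prod>k<n. idet {c\<in>T. w c = k} a)"
proof (induction n)
  case (Suc n)
  have "{c\<in>T. w c < Suc n} = {c\<in>T. w c = n} \<union> {c\<in>T. w c < n}" by auto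
  then have "idet {c\<in>T. w c < Suc n} a = idet ({c\<in>T. w c = n} \<union> {c\<in>T. w c < n}) a" by simp
  also have "\<dots> = idet {c\<in>T. w c = n} a * idet {c\<in>T. w c < n} a"
    using T a by (intro idet_block) auto
  finally show ?case using Suc by simp
qed simp

text \<open>
  In the degrees considered each monomial has at least one \<open>i\<close> with \<open>d\<^sub>i \<le> c\<^sub>i\<close>, so these are the
  monomials with several such indices.
\<close>

definition distinguished :: "nat set \<Rightarrow> (nat \<Rightarrow> nat) \<Rightarrow> nat \<Rightarrow> expo set" where
  "distinguished J d \<nu> = mons J \<nu> - {c. \<exists>!i. i \<in> J \<and> d i \<le> lk c i}"

context
  fixes J :: "nat set" and k0 :: nat and d :: "nat \<Rightarrow> nat" and \<nu> :: nat
  assumes J: "finite J" "k0 \<in> J" and min: "\<And>j. j \<in> J \<Longrightarrow> k0 \<le> j"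
    and d: "\<And>i. i \<in> J \<Longrightarrow> 0 < d i" and \<nu>: "crit J d \<le> \<nu>"
begin

abbreviation (input) "spec_entry \<equiv> mac_entry d (last_block J d) (set_pure d k0 gen_coeff)"

lemma last_block_in:
  assumes "c \<in> mons J \<nu>"
  shows "last_block J d c \<in> J" "d (last_block J d c) \<le> lk c (last_block J d c)" "\<And>i. i \<in> J \<Longrightarrow> d i \<le> lk c i \<Longrightarrow> i \<le> last_block J d c"
  using last_block_props[OF J(1) crit_not_reduced[OF J(1) assms \<nu>]] by blast+

text \<open>
  The rows that remain after the unit rows of the specialised form \<open>k0\<close> have been split off.
\<close>

definition later where "later = {c\<in>mons J \<nu>. last_block J d c \<noteq> k0}"

lemma finite_later: "finite later"
  using J by (simp add: later_def)

lemma distinguished_subset_later: "distinguished J d \<nu> \<subseteq> later"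
proof
  fix c assume c: "c \<in> distinguished J d \<nu>"
  then have cm: "c \<in> mons J \<nu>" by (simp add: distinguished_def)
  have "last_block J d c \<noteq> k0"
  proof
    assume b: "last_block J d c = k0"
    have "\<exists>!i. i \<in> J \<and> d i \<le> lk c i"
    proof (rule ex1I[of _ k0])
      show "k0 \<in> J \<and> d k0 \<le> lk c k0" using last_block_in(2)[OF cm] b J(2) by simp
      show "i = k0" if "i \<in> J \<and> d i \<le> lk c i" for i
        using last_block_in(3)[OF cm, of i] min[of i] b that by simp
    qed
    then show False using c by (simp add: distinguished_def)
  qed
  then show "c \<in> later" using cm by (simp add: later_def)
qed

text \<open>
  The rows of the other forms do not lower the exponent of \<open>t\<^bsub>k0\<^esub>\<close>.
\<close>

lemma spec_entry_graded:
  assumes "c \<in> later" "lk c' k0 < lk c k0"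
  shows "spec_entry c c' = 0"
proof -
  have "c' \<noteq> c - sgl (last_block J d c) (d (last_block J d c)) + f" for f
  proof
    assume "c' = c - sgl (last_block J d c) (d (last_block J d c)) + f"
    then have "lk c' k0 = lk c k0 + lk f k0"
      using assms(1) by (simp add: later_def lookup_add lookup_minus lookup_single when_def)
    then show False using assms(2) by simp
  qed
  then show ?thesis by (simp add: mac_entry_def shiftc_def)
qed

lemma idet_split: "idet (mons J \<nu>) spec_entry = idet later spec_entry"
proof -
  let ?I = "{c\<in>mons J \<nu>. last_block J d c = k0}"
  have I: "spec_entry c c' = (if c' = c then 1 else 0)" if "c \<in> ?I" for c c'
    using that last_block_in(2)[of c] by (intro mac_entry_pure_row) (auto simp: set_pure_def)
  have "mons J \<nu> = ?I \<union> later" by (auto simp: later_def)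
  then have "idet (mons J \<nu>) spec_entry = idet (?I \<union> later) spec_entry" by simp
  also have "\<dots> = idet ?I spec_entry * idet later spec_entry"
    using J I by (intro idet_block) (auto simp: later_def)
  also have "idet ?I spec_entry = 1" using J I by (intro idet_identity) auto
  finally show ?thesis by simp
qed

lemma lookup_le: "c \<in> mons J \<nu> \<Longrightarrow> lk c k0 < Suc \<nu>"
  using member_le_sum[of k0 J "lk c"] J by (auto simp: mons_def)

lemma idet_later_prod: "idet later spec_entry = (\<Prod>k<Suc \<nu>. idet {c\<in>later. lk c k0 = k} spec_entry)"
proof -
  have "later = {c\<in>later. lk c k0 < Suc \<nu>}" using lookup_le by (auto simp: later_def)
  then have "idet later spec_entry = idet {c\<in>later. lk c k0 < Suc \<nu>} spec_entry" by simp
  also have "\<dots> = (\<Prod>k<Suc \<nu>. idet {c\<in>later. lk c k0 = k} spec_entry)"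
    by (rule idet_graded[OF finite_later spec_entry_graded])
  finally show ?thesis .
qed

lemma idet_distinguished_prod: "idet (distinguished J d \<nu>) spec_entry = (\<Prod>k<Suc \<nu>. idet {c\<in>distinguished J d \<nu>. lk c k0 = k} spec_entry)"
proof -
  have "distinguished J d \<nu> = {c\<in>distinguished J d \<nu>. lk c k0 < Suc \<nu>}" using lookup_le by (auto simp: distinguished_def)
  then have "idet (distinguished J d \<nu>) spec_entry = idet {c\<in>distinguished J d \<nu>. lk c k0 < Suc \<nu>} spec_entry" by simp
  also have "\<dots> = (\<Prod>k<Suc \<nu>. idet {c\<in>distinguished J d \<nu>. lk c k0 = k} spec_entry)"
    using finite_subset[OF distinguished_subset_later finite_later] distinguished_subset_later spec_entry_graded by (intro idet_graded) auto
  finally show ?thesis .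
qed

text \<open>
  If \<open>t\<^sup>c\<close> is divisible by \<open>t\<^bsub>k0\<^esub>\<^bsup>d\<^bsub>k0\<^esub>\<^esup>\<close>, a second form that can serve \<open>c\<close> makes it distinguished.
\<close>

lemma high_part: "d k0 \<le> k \<Longrightarrow> {c\<in>later. lk c k0 = k} = {c\<in>distinguished J d \<nu>. lk c k0 = k}"
proof -
  assume k: "d k0 \<le> k"
  have "c \<in> distinguished J d \<nu>" if c: "c \<in> later" "lk c k0 = k" for c
  proof -
    have cm: "c \<in> mons J \<nu>" "last_block J d c \<noteq> k0" using c(1) by (simp_all add: later_def)
    have "\<not> (\<exists>!i. i \<in> J \<and> d i \<le> lk c i)" using last_block_in(1,2)[OF cm(1)] cm(2) k c(2) J(2) by blast
    then show ?thesis using cm(1) by (simp add: distinguished_def)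
  qed
  then show ?thesis using distinguished_subset_later by blast
qed

context
  fixes k assumes k: "k < d k0"
begin

text \<open>
  For \<open>k < d k0\<close>, multiplication by \<open>t\<^bsub>k0\<^esub>\<^bsup>k\<^esup>\<close> identifies the block with exponent \<open>k\<close> with the Macaulay
  matrix of the other forms in degree \<open>\<nu> - k\<close>, which still reaches their critical degree.
\<close>

lemma mons_shift: "{c\<in>mons J \<nu>. lk c k0 = k} = (\<lambda>c. c + sgl k0 k) ` mons (J - {k0}) (\<nu> - k)" if "k \<le> \<nu>"
proof (intro equalityI subsetI)
  fix c assume c: "c \<in> {c\<in>mons J \<nu>. lk c k0 = k}"
  then have eq: "c - sgl k0 k + sgl k0 k = c" by (intro minus_sgl_add) simp
  have "c - sgl k0 k \<in> mons J (\<nu> - k)" using c J by (intro minus_sgl_mons(1)) auto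
  moreover have "lk (c - sgl k0 k) k0 = 0" using c by (simp add: lookup_minus lookup_single)
  ultimately have "c - sgl k0 k \<in> mons (J - {k0}) (\<nu> - k)" using mons_remove[OF J] by simp
  then show "c \<in> (\<lambda>c. c + sgl k0 k) ` mons (J - {k0}) (\<nu> - k)" using eq by (intro image_eqI[of _ _ "c - sgl k0 k"]) simp_all
next
  fix c assume "c \<in> (\<lambda>c. c + sgl k0 k) ` mons (J - {k0}) (\<nu> - k)"
  then obtain e where e: "c = e + sgl k0 k" "e \<in> mons J (\<nu> - k)" "lk e k0 = 0"
    using mons_remove[OF J] by auto
  have "c \<in> mons J (\<nu> - k + k)" unfolding e(1) by (rule mons_add[OF e(2) sgl_mem_mons[OF J]])
  then show "c \<in> {c\<in>mons J \<nu>. lk c k0 = k}" using e that by (simp add: lookup_add lookup_single)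
qed

lemma reduced_shift:
  assumes "e \<in> mons (J - {k0}) m"
  shows "i \<in> J \<and> d i \<le> lk (e + sgl k0 k) i \<longleftrightarrow> i \<in> (J - {k0}) \<and> d i \<le> lk e i"
proof -
  have "lk e k0 = 0" using assms mons_remove[OF J] by simp
  then show ?thesis using k by (cases "i = k0") (auto simp: lookup_add lookup_single when_def)
qed

lemma last_block_shift: "e \<in> mons (J - {k0}) m \<Longrightarrow> last_block J d (e + sgl k0 k) = last_block (J - {k0}) d e"
  using reduced_shift[of e m] unfolding last_block_def by (intro arg_cong[of _ _ Max]) blast

lemma shiftc_shift: "shiftc a (e + s) (c + s) = shiftc a e (c :: expo)"
proof -
  have "c + s = e + s + f \<longleftrightarrow> c = e + f" for f by (metis add.assoc add.commute add_right_cancel)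
  then show ?thesis by (simp add: shiftc_def)
qed

lemma spec_entry_shift:
  assumes e: "e \<in> mons (J - {k0}) m" and m: "crit (J - {k0}) d \<le> m"
  shows "spec_entry (e + sgl k0 k) (e' + sgl k0 k) = mac_entry d (last_block (J - {k0}) d) gen_coeff e e'"
proof -
  let ?b = "last_block (J - {k0}) d e"
  have b: "?b \<in> (J - {k0})" "d ?b \<le> lk e ?b"
    using last_block_props(1,2)[OF _ crit_not_reduced[OF _ e m]] J by auto
  have "e + sgl k0 k - sgl ?b (d ?b) = e - sgl ?b (d ?b) + sgl k0 k"
    using b by (intro poly_mapping_eqI) (auto simp: lookup_add lookup_minus lookup_single when_def)
  then show ?thesis using b
    by (simp add: mac_entry_def last_block_shift[OF e] shiftc_shift set_pure_def)
qed

lemma crit_remove: "crit (J - {k0}) d \<le> \<nu> - k" "k \<le> \<nu>"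
proof -
  have "card (J - {k0}) \<le> (\<Sum>i\<in>(J - {k0}). d i)"
    using sum_mono[of "J - {k0}" "\<lambda>_. 1" d] d by (simp add: Suc_le_eq)
  moreover have "card J = Suc (card (J - {k0}))" using J by (rule card.remove)
  moreover have "(\<Sum>i\<in>J. d i) = d k0 + (\<Sum>i\<in>(J - {k0}). d i)" using J by (rule sum.remove)
  ultimately show "crit (J - {k0}) d \<le> \<nu> - k" "k \<le> \<nu>" using \<nu> k unfolding crit_def by linarith+
qed

lemma low_part:
  "idet {c\<in>later. lk c k0 = k} spec_entry = idet (mons (J - {k0}) (\<nu> - k)) (mac_entry d (last_block (J - {k0}) d) gen_coeff)"
  "idet {c\<in>distinguished J d \<nu>. lk c k0 = k} spec_entry = idet (distinguished (J - {k0}) d (\<nu> - k)) (mac_entry d (last_block (J - {k0}) d) gen_coeff)"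
proof -
  have inj: "inj_on (\<lambda>c. c + sgl k0 k) S" for S by (auto simp: inj_on_def)
  have fin: "finite (mons (J - {k0}) (\<nu> - k))" using J by simp
  have shift: "idet ((\<lambda>c. c + sgl k0 k) ` S) spec_entry = idet S (mac_entry d (last_block (J - {k0}) d) gen_coeff)" if S: "S \<subseteq> mons (J - {k0}) (\<nu> - k)" for S
  proof -
    have "finite S" using S fin finite_subset by blast
    then have "idet ((\<lambda>c. c + sgl k0 k) ` S) spec_entry = idet S (\<lambda>c c'. spec_entry (c + sgl k0 k) (c' + sgl k0 k))" using inj by (rule idet_reindex)
    also have "\<dots> = idet S (mac_entry d (last_block (J - {k0}) d) gen_coeff)"
      using \<open>finite S\<close> S spec_entry_shift[OF _ crit_remove(1)] by (intro idet_cong) auto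
    finally show ?thesis .
  qed
  have "last_block J d c \<noteq> k0" if "c \<in> mons J \<nu>" "lk c k0 = k" for c
    using last_block_in(2)[OF that(1)] that(2) k by auto
  then have "{c\<in>later. lk c k0 = k} = {c\<in>mons J \<nu>. lk c k0 = k}" by (auto simp: later_def)
  also have "\<dots> = (\<lambda>c. c + sgl k0 k) ` mons (J - {k0}) (\<nu> - k)" by (rule mons_shift[OF crit_remove(2)])
  finally show "idet {c\<in>later. lk c k0 = k} spec_entry = idet (mons (J - {k0}) (\<nu> - k)) (mac_entry d (last_block (J - {k0}) d) gen_coeff)"
    using shift[OF subset_refl] by simp
  have "{c\<in>distinguished J d \<nu>. lk c k0 = k} = {c\<in>(\<lambda>c. c + sgl k0 k) ` mons (J - {k0}) (\<nu> - k). \<not> (\<exists>!i. i \<in> J \<and> d i \<le> lk c i)}"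
    unfolding mons_shift[OF crit_remove(2), symmetric] by (auto simp: distinguished_def)
  also have "\<dots> = (\<lambda>c. c + sgl k0 k) ` distinguished (J - {k0}) d (\<nu> - k)"
  proof -
    have "(\<exists>!i. i \<in> J \<and> d i \<le> lk (e + sgl k0 k) i) \<longleftrightarrow> (\<exists>!i. i \<in> (J - {k0}) \<and> d i \<le> lk e i)" if "e \<in> mons (J - {k0}) (\<nu> - k)" for e
      unfolding reduced_shift[OF that] ..
    then have "distinguished (J - {k0}) d (\<nu> - k) = {e\<in>mons (J - {k0}) (\<nu> - k). \<not> (\<exists>!i. i \<in> J \<and> d i \<le> lk (e + sgl k0 k) i)}"
      unfolding distinguished_def set_diff_eq by (simp cong: conj_cong)
    moreover have "{c \<in> f ` A. P c} = f ` {e\<in>A. P (f e)}" for f :: "expo \<Rightarrow> expo" and A P by blast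
    ultimately show ?thesis by simp
  qed
  finally show "idet {c\<in>distinguished J d \<nu>. lk c k0 = k} spec_entry = idet (distinguished (J - {k0}) d (\<nu> - k)) (mac_entry d (last_block (J - {k0}) d) gen_coeff)"
    using shift[of "distinguished (J - {k0}) d (\<nu> - k)"] by (simp add: distinguished_def)
qed

end

lemma distinguished_spec_entry: "idet (distinguished J d \<nu>) spec_entry = idet (distinguished J d \<nu>) (mac_entry d (last_block J d) gen_coeff)"
proof (rule idet_cong)
  show "finite (distinguished J d \<nu>)" using J by (simp add: distinguished_def)
  show "spec_entry c c' = mac_entry d (last_block J d) gen_coeff c c'" if "c \<in> distinguished J d \<nu>" for c c'
    using that distinguished_subset_later by (auto simp: later_def mac_entry_def set_pure_def)
qed

text \<open>
  Both specialised determinants factor into blocks. The \<open>d k0\<close> low blocks contribute the power of the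
  smaller resultant by the induction hypothesis, and the high blocks are the same in both. The
  cofactor \<open>E\<close> is not changed by the specialisation.
\<close>

lemma macaulay_step:
  assumes IH: "\<And>m. crit (J - {k0}) d \<le> m \<Longrightarrow>
    idet (mons (J - {k0}) m) (mac_entry d (last_block (J - {k0}) d) gen_coeff) = res (J - {k0}) d * idet (distinguished (J - {k0}) d m) (mac_entry d (last_block (J - {k0}) d) gen_coeff)"
  shows "idet (mons J \<nu>) (mac_entry d (last_block J d) gen_coeff) = res J d * idet (distinguished J d \<nu>) (mac_entry d (last_block J d) gen_coeff)"
proof -
  let ?M = "idet (mons J \<nu>) (mac_entry d (last_block J d) gen_coeff)"
  let ?N = "idet (distinguished J d \<nu>) (mac_entry d (last_block J d) gen_coeff)"
  let ?t = "\<lambda>k. idet {c\<in>later. lk c k0 = k} spec_entry" and ?n = "\<lambda>k. idet {c\<in>distinguished J d \<nu>. lk c k0 = k} spec_entry"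
  have asg: "assignment J d \<nu> (last_block J d)" by (rule assignment_last_block[OF J(1) \<nu>])
  have R: "is_res J d (res J d)" using J d by (intro is_res_res) auto
  obtain E where E: "?M = res J d * E"
    using R mac_entry_in_inertia[OF J(1) asg] unfolding is_res_def dvd_def by blast
  have "avoids J d \<nu> k0 (last_block J d)" unfolding avoids_def
  proof (intro ballI impI)
    fix c j assume c: "c \<in> mons J \<nu>" "last_block J d c = k0" "j \<in> J - {k0}"
    then have "\<not> j \<le> last_block J d c" using min[of j] by auto
    then show "lk c j < d j" using last_block_in(3)[OF c(1), of j] c(3) by (meson DiffD1 not_le)
  qed
  then have "hom_deg k0 E 0" using res_degree(2)[of J k0 d "res J d" \<nu> "last_block J d" E] J d R \<nu> asg E by blast
  then have "row_of v \<noteq> k0" if "v \<in> vars E" for v using hom_deg_0_vars that by blast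
  then have specE: "spec d k0 E = E" unfolding spec_def
    by (intro ev_Var_vars) (force simp: at_coeffs_def set_pure_def gen_coeff_def split: uvar.split)
  have "?t k = (if k < d k0 then res (J - {k0}) d else 1) * ?n k" for k
    using low_part[of k] IH[OF crit_remove(1)[of k]] high_part[of k] by (cases "k < d k0") (simp_all add: not_less)
  then have "idet later spec_entry = (\<Prod>k<Suc \<nu>. (if k < d k0 then res (J - {k0}) d else 1)) * (\<Prod>k<Suc \<nu>. ?n k)"
    unfolding idet_later_prod by (simp add: prod.distrib)
  also have "(\<Prod>k<Suc \<nu>. (if k < d k0 then res (J - {k0}) d else 1)) = (\<Prod>k<d k0. res (J - {k0}) d)"
  proof -
    have "d k0 - 1 \<le> \<nu>" using crit_remove(2)[of "d k0 - 1"] d[OF J(2)] by simp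
    then have "{..<Suc \<nu>} \<inter> {k. k < d k0} = {..<d k0}" by auto
    then show ?thesis by (subst prod.If_cases) (simp_all del: lessThan_Suc)
  qed
  also have "(\<Prod>k<Suc \<nu>. ?n k) = ?N" using idet_distinguished_prod distinguished_spec_entry by simp
  finally have later: "idet later spec_entry = res (J - {k0}) d ^ d k0 * ?N" by simp
  have "spec d k0 (res J d) = res (J - {k0}) d ^ d k0" using spec_res_power[of J k0 d] J d by blast
  then have "spec d k0 ?M = res (J - {k0}) d ^ d k0 * E"
    unfolding E spec.hom_mult specE by (rule arg_cong)
  moreover have "spec d k0 ?M = res (J - {k0}) d ^ d k0 * ?N"
    unfolding spec_idet_mac_entry idet_split later ..
  moreover have "res (J - {k0}) d \<noteq> 0" using J d by (intro res_nonzero) auto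
  ultimately have "E = ?N" by simp
  then show ?thesis using E by simp
qed

end

theorem macaulay_formula:
  assumes "finite J" "\<And>i. i \<in> J \<Longrightarrow> 0 < d i" "crit J d \<le> \<nu>"
  shows "idet (mons J \<nu>) (mac_entry d (last_block J d) gen_coeff) = res J d * idet (distinguished J d \<nu>) (mac_entry d (last_block J d) gen_coeff)"
  using assms
proof (induction J arbitrary: \<nu> rule: finite_linorder_min_induct)
  case empty
  then have "mons {} \<nu> = {}" by (auto simp: mons_def crit_def)
  then show ?case by (simp add: distinguished_def res_def)
next
  case (insert k J)
  have k: "insert k J - {k} = J" using insert.hyps by auto
  show ?case
  proof (rule macaulay_step[of "insert k J" k d \<nu>, unfolded k])
    show "idet (mons J m) (mac_entry d (last_block J d) gen_coeff) = res J d * idet (distinguished J d m) (mac_entry d (last_block J d) gen_coeff)"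
      if "crit J d \<le> m" for m
      using insert.IH[OF _ that] insert.prems by blast
  qed (use insert in \<open>auto intro: less_imp_le\<close>)
qed

section \<open>The resultant and the Macaulay matrices of the general polynomials\<close>

lemma eval_eq_ins: "eval a p = ins (\<lambda>x. x) a p"
  by (simp add: eval_def ins_def mono_val_def)

text \<open>
  Extension of coefficients is the evaluation at the variables themselves, so that it composes with
  other evaluations.
\<close>

lemma int_to_complex_eq_ev: "int_to_complex f = ev Var f"
proof -
  have "ev Var f = (\<Sum>e\<in>kys f. sgl e (of_int (lk f e)) :: ('a, complex) mpol)"
    unfolding ins_def mono_val_Var
    by (intro sum.cong refl) (simp add: mult_single flip: single_of_int)
  also have "\<dots> = int_to_complex f"
  proof (rule poly_mapping_eqI)
    fix e
    have "lk (\<Sum>e\<in>kys f. sgl e (of_int (lk f e)) :: ('a, complex) mpol) e = of_int (lk f e)"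
      by (simp add: lookup_sum lookup_single when_def in_keys_iff)
    also have "\<dots> = lk (int_to_complex f) e"
      by (simp add: int_to_complex_def map.rep_eq when_def)
    finally show "lk (\<Sum>e\<in>kys f. sgl e (of_int (lk f e)) :: ('a, complex) mpol) e = lk (int_to_complex f) e" .
  qed
  finally show ?thesis by simp
qed

lemma int_to_complex_eq_0: "int_to_complex f = 0 \<Longrightarrow> f = 0"
proof (rule poly_mapping_eqI)
  fix e assume "int_to_complex f = 0"
  then have "lk (int_to_complex f) e = 0" by simp
  then show "lk f e = lk 0 e" by (simp add: int_to_complex_def map.rep_eq when_def split: if_splits)
qed

lemma eval_at_system_eq: "eval_at_system R F = ev (at_coeffs (\<lambda>i c. lk (F i) c)) R"
proof -
  have "eval_at_system R F = ins (\<lambda>x. x) (at_coeffs (\<lambda>i c. lk (F i) c)) (ev Var R)"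
    by (simp add: eval_at_system_def eval_eq_ins int_to_complex_eq_ev at_coeffs_def)
  also have "\<dots> = ev (\<lambda>v. ins (\<lambda>x. x) (at_coeffs (\<lambda>i c. lk (F i) c)) (Var v)) R"
    by (rule hom_ev[OF ins_hom[OF id_hom]])
  finally show ?thesis by (simp add: ins_Var[OF id_hom])
qed

lemma has_proj_zero_eq:
  assumes "\<And>i. i \<le> n \<Longrightarrow> homogeneous n (d i) (F i)"
  shows "has_proj_zero n F \<longleftrightarrow> has_zero {..n} d (\<lambda>i c. lk (F i) c)"
proof -
  have "eval z (F i) = form_val {..n} (d i) (lk (F i)) z" if "i \<le> n" for i z
    unfolding eval_eq_ins form_val_def mons_atMost
    using assms[OF that] finite_expos by (intro ins_superset[OF id_hom]) (auto simp: homogeneous_def)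
  then show ?thesis by (simp add: has_proj_zero_def has_zero_def Bex_def Ball_def)
qed

lemma crit_atMost: "crit {..n} d = macaulay_degree n d"
  by (simp add: crit_def macaulay_degree_def)

lemma vars_idet_mac_entry:
  assumes asg: "assignment {..n} d \<nu> b" and S: "S \<subseteq> mons {..n} \<nu>"
  shows "vars (idet S (mac_entry d b gen_coeff)) \<subseteq> uvars n d"
proof -
  have "idet S (mac_entry d b gen_coeff) \<in> {f. vars f \<subseteq> uvars n d}"
  proof (rule idet_closed)
    show "finite S" using S finite_mons finite_subset by blast
    fix c c' assume "c \<in> S" "c' \<in> S"
    then have c: "c \<in> mons {..n} \<nu>" "c' \<in> mons {..n} \<nu>" using S by auto
    let ?e = "c - sgl (b c) (d (b c))"
    have bc: "b c \<in> {..n}" "d (b c) \<le> lk c (b c)" using asg c(1) by (auto simp: assignment_def)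
    have e: "?e \<in> mons {..n} (\<nu> - d (b c))" "d (b c) \<le> \<nu>"
      using minus_sgl_mons[OF _ c(1) bc] by auto
    show "mac_entry d b gen_coeff c c' \<in> {f. vars f \<subseteq> uvars n d}"
    proof (cases "\<exists>f. c' = ?e + f")
      case True
      then obtain f where f: "c' = ?e + f" by blast
      then have "f \<in> mons {..n} (d (b c))"
        using mons_add_cancel[of f ?e "{..n}" \<nu> "\<nu> - d (b c)"] c(2) e by (simp add: add.commute)
      then show ?thesis using f bc(1) by (auto simp: mac_entry_def shiftc_def gen_coeff_def uvars_def mons_atMost)
    qed (simp add: mac_entry_def shiftc_def)
  next
    fix x y :: cring assume "x \<in> {f. vars f \<subseteq> uvars n d}" "y \<in> {f. vars f \<subseteq> uvars n d}"
    then show "x + y \<in> {f. vars f \<subseteq> uvars n d}" "x * y \<in> {f. vars f \<subseteq> uvars n d}"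
      using vars_add[of x y] vars_mult[of x y] by auto
  qed auto
  then show ?thesis by simp
qed

lemma fract_eq_ev: "to_fract (int_to_complex f) = ev (at_coeffs uvar_K) f"
proof -
  have "comm_ring_hom (to_fract :: (uvar, complex) mpol \<Rightarrow> ratfun)" by standard simp_all
  from hom_ev[OF this, of Var f] have "to_fract (int_to_complex f) = ev (\<lambda>v. to_fract (Var v)) f"
    by (simp add: int_to_complex_eq_ev)
  also have "(\<lambda>v. to_fract (Var v)) = at_coeffs uvar_K"
    by (auto simp: fun_eq_iff at_coeffs_def uvar_K_def Var_def split: uvar.split)
  finally show ?thesis .
qed

context
  fixes n :: nat and d :: "nat \<Rightarrow> nat"
  assumes d: "\<And>i. i \<le> n \<Longrightarrow> 0 < d i"
begin

lemma is_res_J: "is_res {..n} d (res {..n} d)"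
  using d by (intro is_res_res) auto

lemma asg: "assignment {..n} d (macaulay_degree n d) (last_block {..n} d)"
  by (rule assignment_last_block) (simp_all add: crit_atMost)

text \<open>
  The resultant divides the Macaulay determinant, in which only coefficients of the given degrees occur.
\<close>

lemma vars_res: "vars (res {..n} d) \<subseteq> uvars n d"
proof -
  let ?M = "idet (mons {..n} (macaulay_degree n d)) (mac_entry d (last_block {..n} d) gen_coeff)"
  have "res {..n} d dvd ?M"
    using is_res_J mac_entry_in_inertia[OF _ asg] unfolding is_res_def by blast
  moreover have "?M \<noteq> 0"
  proof
    assume M: "?M = 0"
    have "ev (at_coeffs (pure d)) ?M = (1 :: complex)"
      unfolding ev_mac_entry by (rule idet_mac_entry_pure[OF _ asg subset_refl]) simp
    then show False unfolding M ev.hom_zero by simp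
  qed
  ultimately have "vars (res {..n} d) \<subseteq> vars ?M" by (rule vars_dvd)
  also have "\<dots> \<subseteq> uvars n d" by (rule vars_idet_mac_entry[OF asg subset_refl])
  finally show ?thesis .
qed

lemma ev_pure_complex: "ev (at_coeffs (pure d)) f = (of_int (ev (at_coeffs (pure d)) f) :: complex)"
proof -
  have "of_int (ev (at_coeffs (pure d)) f) = ev (\<lambda>v. of_int (at_coeffs (pure d) v) :: complex) f"
    by (rule hom_ev[OF comm_ring_hom_of_int])
  also have "(\<lambda>v. of_int (at_coeffs (pure d) v) :: complex) = at_coeffs (\<lambda>i c. of_int (pure d i c))"
    by (rule hom_at_coeffs)
  also have "(\<lambda>i c. of_int (pure d i c) :: complex) = pure d"
    by (auto simp: fun_eq_iff pure_def)
  finally show ?thesis by (rule sym)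
qed

lemma eval_at_pure: "eval_at_system R (\<lambda>i. sgl (sgl i (d i)) 1) = ev (at_coeffs (pure d)) R"
proof -
  have "(\<lambda>i c. lk (sgl (sgl i (d i)) 1) c) = (pure d :: nat \<Rightarrow> expo \<Rightarrow> complex)"
    by (auto simp: fun_eq_iff pure_def lookup_single when_def)
  then show ?thesis by (simp add: eval_at_system_eq)
qed

lemma is_resultant_res: "is_resultant n d (res {..n} d)"
  unfolding is_resultant_def
proof (intro conjI allI impI)
  show "\<forall>e\<in>kys (res {..n} d). kys e \<subseteq> uvars n d" using vars_res by (auto simp: vars_def)
  show "irreducible (res {..n} d)" using is_res_J by (simp add: is_res_def)
  fix F :: "nat \<Rightarrow> (nat, complex) mpol"
  assume F: "\<forall>i\<le>n. homogeneous n (d i) (F i)"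
  show "eval_at_system (res {..n} d) F = 0 \<longleftrightarrow> has_proj_zero n F"
    using res_vanishes_iff[OF _ is_res_J, of "\<lambda>i. lk (F i)"] has_proj_zero_eq[of n d F] F
    by (simp add: eval_at_system_eq)
next
  have "ev (at_coeffs (pure d)) (res {..n} d) = (1 :: int)" using is_res_J by (simp only: is_res_def)
  then have "ev (at_coeffs (pure d)) (res {..n} d) = (1 :: complex)"
    unfolding ev_pure_complex[of "res {..n} d"] by (simp only: of_int_1)
  then show "eval_at_system (res {..n} d) (\<lambda>i. sgl (sgl i (d i)) 1) = 1" by (simp add: eval_at_pure)
qed

text \<open>
  A polynomial that vanishes at all systems with a zero is a multiple of the resultant; an irreducible
  multiple differs by a sign, which the normalisation excludes.
\<close>

lemma is_resultant_unique:
  assumes R: "is_resultant n d R"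
  shows "R = res {..n} d"
proof -
  have "R \<in> inertia {..n} d" unfolding inertia_def
  proof (intro CollectI allI impI)
    fix F assume hz: "has_zero {..n} d F"
    define Fm where "Fm i = form_poly {..n} (d i) (F i)" for i
    have lk: "lk (Fm i) c = F i c" if "c \<in> expos n (d i)" for i c
      using that finite_expos
      by (simp add: Fm_def form_poly_def mons_atMost lookup_sum lookup_single when_def)
    have hom: "homogeneous n (d i) (Fm i)" for i
    proof -
      have "kys (Fm i) \<subseteq> (\<Union>c\<in>mons {..n} (d i). kys (sgl c (F i c)))"
        unfolding Fm_def form_poly_def by (rule keys_sum)
      also have "\<dots> \<subseteq> mons {..n} (d i)" by (auto split: if_splits)
      finally show ?thesis by (simp add: homogeneous_def mons_atMost)
    qed
    have "has_proj_zero n Fm"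
      using hz unfolding has_proj_zero_def has_zero_def eval_eq_ins Fm_def ins_form_poly by auto
    then have "eval_at_system R Fm = 0" using R hom by (simp add: is_resultant_def)
    moreover have "eval_at_system R Fm = ev (at_coeffs F) R" unfolding eval_at_system_eq
    proof (rule ins_cong)
      fix v assume "v \<in> vars R"
      then have "v \<in> uvars n d" using R by (auto simp: is_resultant_def vars_def)
      then show "at_coeffs (\<lambda>i c. lk (Fm i) c) v = at_coeffs F v" using lk by (auto simp: uvars_def)
    qed
    ultimately show "ev (at_coeffs F) R = 0" by simp
  qed
  then obtain h where h: "R = res {..n} d * h" using is_res_J unfolding is_res_def dvd_def by blast
  have "\<not> res {..n} d dvd 1" using is_res_J by (simp add: is_res_def irreducible_def)
  moreover have "irreducible R" using R by (simp add: is_resultant_def)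
  ultimately have "h dvd 1" using h unfolding irreducible_def by blast
  then have "h = 1 \<or> h = -1" by (rule unit_mpol_int)
  moreover have "h \<noteq> -1"
  proof
    assume "h = -1"
    then have "R = - res {..n} d" using h by simp
    then have "ev (at_coeffs (pure d)) R = - (ev (at_coeffs (pure d)) (res {..n} d) :: complex)" by (simp only: ev.hom_uminus)
    moreover have "ev (at_coeffs (pure d)) R = (1 :: complex)" "ev (at_coeffs (pure d)) (res {..n} d) = (1 :: complex)"
      using R is_resultant_res unfolding is_resultant_def eval_at_pure by blast+
    ultimately show False by simp
  qed
  ultimately show ?thesis using h by simp
qed

lemma Res_eq: "Res n d = res {..n} d"
  unfolding Res_def using is_resultant_res is_resultant_unique by (rule the_equality)

lemma last_block_block: "c \<in> macaulay_index n d \<Longrightarrow> last_block {..n} d c \<le> n \<and> c \<in> macaulay_block n d (last_block {..n} d c)"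
proof -
  assume c: "c \<in> macaulay_index n d"
  then have cm: "c \<in> mons {..n} (macaulay_degree n d)" by (simp add: macaulay_index_def mons_atMost)
  have ex: "\<exists>i\<in>{..n}. d i \<le> lk c i" by (rule crit_not_reduced[OF _ cm]) (simp_all add: crit_atMost)
  have "lk c j < d j" if "last_block {..n} d c < j" "j \<le> n" for j
    using last_block_props(3)[OF _ ex, of j] that by (meson atMost_iff finite_atMost not_le)
  then show ?thesis using last_block_props(1,2)[OF _ ex] c by (auto simp: macaulay_block_def)
qed

text \<open>
  The partition into blocks by the last index \<open>i\<close> with \<open>c\<^sub>i \<ge> d\<^sub>i\<close> is the choice of the forms made above.
\<close>

lemma macaulay_entry_eq:
  assumes c: "c \<in> macaulay_index n d" "c' \<in> macaulay_index n d"
  shows "macaulay_entry n d c c' = mac_entry d (last_block {..n} d) uvar_K c c'"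
proof -
  let ?i = "last_block {..n} d c"
  let ?e = "c - sgl ?i (d ?i)"
  have i: "?i \<le> n" "c \<in> macaulay_block n d ?i" using last_block_block[OF c(1)] by auto
  have cm: "c \<in> mons {..n} (macaulay_degree n d)" "c' \<in> mons {..n} (macaulay_degree n d)" using c by (simp_all add: macaulay_index_def mons_atMost)
  have e: "?e \<in> mons {..n} ((macaulay_degree n d) - d ?i)" "d ?i \<le> (macaulay_degree n d)"
    using minus_sgl_mons[OF _ cm(1), of ?i "d ?i"] i by (auto simp: macaulay_block_def)
  have "general_poly n d ?i = form_poly {..n} (d ?i) (uvar_K ?i)"
    by (simp add: general_poly_def form_poly_def mons_atMost)
  then have "macaulay_entry n d c c' = lk (sgl ?e 1 * form_poly {..n} (d ?i) (uvar_K ?i)) c'"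
    using macaulay_entry_row[of n d ?i c c'] d i by simp
  also have "\<dots> = (\<Sum>e\<in>mons {..n} ((macaulay_degree n d) - d ?i). lk (sgl ?e 1) e * shiftc (uvar_K ?i) e c')"
    by (rule lookup_mult_form_poly[OF _ cm(2) e(2)]) simp
  also have "\<dots> = (\<Sum>e\<in>mons {..n} ((macaulay_degree n d) - d ?i). if e = ?e then shiftc (uvar_K ?i) e c' else 0)"
    by (intro sum.cong refl) (auto simp: lookup_single when_def)
  also have "\<dots> = shiftc (uvar_K ?i) ?e c'" using e(1) by simp
  finally show ?thesis by (simp add: mac_entry_def)
qed

lemma det_macaulay_matrix: "det (macaulay_matrix n d) = ev (at_coeffs uvar_K) (idet (mons {..n} (macaulay_degree n d)) (mac_entry d (last_block {..n} d) gen_coeff))"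
  unfolding ev_mac_entry macaulay_matrix_def macaulay_index_def mons_atMost
  using finite_expos by (intro idet_cong) (auto intro!: macaulay_entry_eq simp: macaulay_index_def)

lemma distinguished_eq: "macaulay_distinguished n d = distinguished {..n} d (macaulay_degree n d)"
  by (simp add: macaulay_distinguished_def distinguished_def macaulay_index_def mons_atMost)

lemma det_macaulay_submatrix: "det (macaulay_submatrix n d) = ev (at_coeffs uvar_K) (idet (distinguished {..n} d (macaulay_degree n d)) (mac_entry d (last_block {..n} d) gen_coeff))"
  unfolding ev_mac_entry macaulay_submatrix_def distinguished_eq
  using finite_expos
  by (intro idet_cong) (auto intro!: macaulay_entry_eq simp: macaulay_index_def distinguished_def mons_atMost)

end

theorem corollary5p13:
  fixes n :: nat and d :: "nat \<Rightarrow> nat"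
  assumes "\<And>i. i \<le> n \<Longrightarrow> 0 < d i"
  shows "det (macaulay_submatrix n d) \<noteq> 0 \<and>
    to_fract (int_to_complex (Res n d)) =
      det (macaulay_matrix n d) / det (macaulay_submatrix n d)"
proof -
  let ?J = "{..n}" and ?m = "macaulay_degree n d"
  let ?M = "idet (mons ?J ?m) (mac_entry d (last_block ?J d) gen_coeff)"
  let ?N = "idet (distinguished ?J d ?m) (mac_entry d (last_block ?J d) gen_coeff)"
  have M: "det (macaulay_matrix n d) = ev (at_coeffs uvar_K) ?M"
    and N: "det (macaulay_submatrix n d) = ev (at_coeffs uvar_K) ?N"
    and Res: "Res n d = res ?J d"
    and asg: "assignment ?J d ?m (last_block ?J d)"
    using det_macaulay_matrix[of n d] det_macaulay_submatrix[of n d] Res_eq[of n d] asg[of n d] assms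
    by blast+
  have N0: "ev (at_coeffs uvar_K) ?N \<noteq> 0"
  proof
    assume "ev (at_coeffs uvar_K) ?N = 0"
    then have "int_to_complex ?N = 0" using fract_eq_ev[of ?N] by simp
    then have "?N = 0" by (rule int_to_complex_eq_0)
    moreover have "ev (at_coeffs (pure d)) ?N = (1 :: complex)"
      unfolding ev_mac_entry by (rule idet_mac_entry_pure[OF _ asg]) (auto simp: distinguished_def)
    ultimately show False by (simp add: ev.hom_zero)
  qed
  have "?M = res ?J d * ?N"
    using assms by (intro macaulay_formula) (auto simp: crit_atMost)
  then have "ev (at_coeffs uvar_K) ?M = ev (at_coeffs uvar_K) (res ?J d) * ev (at_coeffs uvar_K) ?N"
    by (simp only: ev.hom_mult)
  then show ?thesis using N0 unfolding M N Res fract_eq_ev by simp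
qed

end
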